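(* $\mathrm{MZFC}$ is a conservative extension of $\mathrm{ZFC}$: for any sentence $\psi$ in the language $\mathcal{L}_{\mathrm{ZF}}$ of set theory, $\mathrm{ZFC}\vdash\psi$ if and only if $\mathrm{MZFC}\vdash\psi$. In particular, $\mathrm{MZFC}$ is equiconsistent with $\mathrm{ZFC}$.
   Context: $\mathcal{L}_{\mathrm{ZF}}$ is the first-order language with the single binary relation symbol $\in$. The language $\mathcal{L}_{\mathrm{MZF}}$ of the theory $\mathrm{MZFC}$ consists of $\in$ together with one constant symbol $\mathtt{v}$. The axioms of $\mathrm{MZFC}$ are: (i) all axioms of $\mathrm{ZFC}$; (ii) the sentence "$\mathtt{v}$ is a countable transitive set"; (iii) the schema consisting of the sentences "$\mathtt{v}\models\varphi$" (i.e. the structure $(\mathtt{v},\in)$ satisfies $\varphi$), one for each (metamathematical) axiom $\varphi$ of $\mathrm{ZFC}$. Here $\vdash$ denotes ordinary first-order provability. *)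

theory Defs
  imports Main
begin

(* First-order formulas, with equality, over one binary relation symbol and a set of constant
   symbols drawn from the type 'c.  Variables are de Bruijn indices: index n refers to the n-th
   enclosing quantifier, counted outwards from 0. *)

datatype (tcsyms: 'c) trm =
    Var nat  (\<open>\<^bold>#_\<close> [100] 100)
  | Cst 'c

datatype (csyms: 'c) fm =
    Fls
  | Eq "'c trm" "'c trm"  (infix \<open>\<^bold>=\<close> 60)
  | Mem "'c trm" "'c trm"  (infix \<open>\<^bold>\<in>\<close> 60)
  | Imp "'c fm" "'c fm"  (infixr \<open>\<^bold>\<longrightarrow>\<close> 53)
  | All "'c fm"  (\<open>\<^bold>\<forall>_\<close> [51] 51)

abbreviation Neg :: "'c fm \<Rightarrow> 'c fm" (\<open>\<^bold>\<not>_\<close> [59] 59)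
  where "\<^bold>\<not>p \<equiv> p \<^bold>\<longrightarrow> Fls"

abbreviation Dis :: "'c fm \<Rightarrow> 'c fm \<Rightarrow> 'c fm" (infixr \<open>\<^bold>\<or>\<close> 54)
  where "p \<^bold>\<or> q \<equiv> \<^bold>\<not>p \<^bold>\<longrightarrow> q"

abbreviation Con :: "'c fm \<Rightarrow> 'c fm \<Rightarrow> 'c fm" (infixr \<open>\<^bold>\<and>\<close> 55)
  where "p \<^bold>\<and> q \<equiv> \<^bold>\<not>(p \<^bold>\<longrightarrow> \<^bold>\<not>q)"

abbreviation Iff :: "'c fm \<Rightarrow> 'c fm \<Rightarrow> 'c fm" (infix \<open>\<^bold>\<longleftrightarrow>\<close> 52)
  where "p \<^bold>\<longleftrightarrow> q \<equiv> (p \<^bold>\<longrightarrow> q) \<^bold>\<and> (q \<^bold>\<longrightarrow> p)"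

abbreviation Exi :: "'c fm \<Rightarrow> 'c fm" (\<open>\<^bold>\<exists>_\<close> [51] 51)
  where "\<^bold>\<exists>p \<equiv> \<^bold>\<not>(\<^bold>\<forall>\<^bold>\<not>p)"

primrec tfv :: "'c trm \<Rightarrow> nat set" where
  "tfv (\<^bold>#n) = {n}"
| "tfv (Cst c) = {}"

primrec fv :: "'c fm \<Rightarrow> nat set" where
  "fv Fls = {}"
| "fv (s \<^bold>= t) = tfv s \<union> tfv t"
| "fv (s \<^bold>\<in> t) = tfv s \<union> tfv t"
| "fv (p \<^bold>\<longrightarrow> q) = fv p \<union> fv q"
| "fv (\<^bold>\<forall>p) = {n. Suc n \<in> fv p}"

(* A language is given by its set L of constant symbols. *)
definition sentence :: "'c set \<Rightarrow> 'c fm \<Rightarrow> bool" where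
  "sentence L p \<longleftrightarrow> fv p = {} \<and> csyms p \<subseteq> L"

primrec tsubst :: "(nat \<Rightarrow> 'c trm) \<Rightarrow> 'c trm \<Rightarrow> 'c trm" where
  "tsubst \<sigma> (\<^bold>#n) = \<sigma> n"
| "tsubst \<sigma> (Cst c) = Cst c"

definition tlift :: "'c trm \<Rightarrow> 'c trm" (\<open>\<up>_\<close> [100] 100) where
  "\<up>t = tsubst (\<lambda>n. \<^bold>#(Suc n)) t"

primrec fsubst :: "(nat \<Rightarrow> 'c trm) \<Rightarrow> 'c fm \<Rightarrow> 'c fm" where
  "fsubst \<sigma> Fls = Fls"
| "fsubst \<sigma> (s \<^bold>= t) = (tsubst \<sigma> s \<^bold>= tsubst \<sigma> t)"
| "fsubst \<sigma> (s \<^bold>\<in> t) = (tsubst \<sigma> s \<^bold>\<in> tsubst \<sigma> t)"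
| "fsubst \<sigma> (p \<^bold>\<longrightarrow> q) = (fsubst \<sigma> p \<^bold>\<longrightarrow> fsubst \<sigma> q)"
| "fsubst \<sigma> (\<^bold>\<forall>p) = (\<^bold>\<forall>fsubst (case_nat (\<^bold>#0) (\<lambda>n. \<up>(\<sigma> n))) p)"

definition flift :: "'c fm \<Rightarrow> 'c fm" where
  "flift p = fsubst (\<lambda>n. \<^bold>#(Suc n)) p"

(* p with t substituted for variable 0, the remaining variables moving down by one *)
definition finst :: "'c trm \<Rightarrow> 'c fm \<Rightarrow> 'c fm" where
  "finst t p = fsubst (case_nat t Var) p"

(* Natural deduction for classical first-order logic with equality; every formula occurring in
   a derivation belongs to the language L.  In AllI the hypotheses are lifted, which makes
   variable 0 the eigenvariable. *)
inductive prov :: "'c set \<Rightarrow> 'c fm set \<Rightarrow> 'c fm \<Rightarrow> bool" for L :: "'c set" where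
  Hyp: "p \<in> T \<Longrightarrow> csyms p \<subseteq> L \<Longrightarrow> prov L T p"
| ImpI: "csyms p \<subseteq> L \<Longrightarrow> prov L (insert p T) q \<Longrightarrow> prov L T (p \<^bold>\<longrightarrow> q)"
| ImpE: "prov L T (p \<^bold>\<longrightarrow> q) \<Longrightarrow> prov L T p \<Longrightarrow> prov L T q"
| RAA: "csyms p \<subseteq> L \<Longrightarrow> prov L (insert (\<^bold>\<not>p) T) Fls \<Longrightarrow> prov L T p"
| AllI: "prov L (flift ` T) p \<Longrightarrow> prov L T (\<^bold>\<forall>p)"
| AllE: "prov L T (\<^bold>\<forall>p) \<Longrightarrow> tcsyms t \<subseteq> L \<Longrightarrow> prov L T (finst t p)"
| EqI: "tcsyms t \<subseteq> L \<Longrightarrow> prov L T (t \<^bold>= t)"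
| EqE: "csyms p \<subseteq> L \<Longrightarrow> prov L T (s \<^bold>= t) \<Longrightarrow> prov L T (finst s p) \<Longrightarrow> prov L T (finst t p)"

definition consistent :: "'c set \<Rightarrow> 'c fm set \<Rightarrow> bool" where
  "consistent L T \<longleftrightarrow> \<not> (\<exists>p. prov L T p \<and> prov L T (\<^bold>\<not>p))"


definition subset_fm :: "'c trm \<Rightarrow> 'c trm \<Rightarrow> 'c fm" where
  "subset_fm s t = (\<^bold>\<forall>\<^bold>#0 \<^bold>\<in> \<up>s \<^bold>\<longrightarrow> \<^bold>#0 \<^bold>\<in> \<up>t)"

definition empty_fm :: "'c trm \<Rightarrow> 'c fm" where
  "empty_fm t = (\<^bold>\<forall>\<^bold>\<not>(\<^bold>#0 \<^bold>\<in> \<up>t))"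

(* t = s Un {s} *)
definition succ_fm :: "'c trm \<Rightarrow> 'c trm \<Rightarrow> 'c fm" where
  "succ_fm s t = (\<^bold>\<forall>\<^bold>#0 \<^bold>\<in> \<up>t \<^bold>\<longleftrightarrow> \<^bold>#0 \<^bold>\<in> \<up>s \<^bold>\<or> \<^bold>#0 \<^bold>= \<up>s)"

definition inductive_fm :: "'c trm \<Rightarrow> 'c fm" where
  "inductive_fm t =
     ((\<^bold>\<exists>empty_fm (\<^bold>#0) \<^bold>\<and> \<^bold>#0 \<^bold>\<in> \<up>t) \<^bold>\<and>
      (\<^bold>\<forall>\<^bold>#0 \<^bold>\<in> \<up>t \<^bold>\<longrightarrow> (\<^bold>\<exists>succ_fm (\<^bold>#1) (\<^bold>#0) \<^bold>\<and> \<^bold>#0 \<^bold>\<in> \<up>\<up>t)))"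

(* t is the least inductive set *)
definition omega_fm :: "'c trm \<Rightarrow> 'c fm" where
  "omega_fm t = (inductive_fm t \<^bold>\<and> (\<^bold>\<forall>inductive_fm (\<^bold>#0) \<^bold>\<longrightarrow> subset_fm (\<up>t) (\<^bold>#0)))"

(* p = {s, t} *)
definition upair_fm :: "'c trm \<Rightarrow> 'c trm \<Rightarrow> 'c trm \<Rightarrow> 'c fm" where
  "upair_fm s t p = (\<^bold>\<forall>\<^bold>#0 \<^bold>\<in> \<up>p \<^bold>\<longleftrightarrow> \<^bold>#0 \<^bold>= \<up>s \<^bold>\<or> \<^bold>#0 \<^bold>= \<up>t)"

(* p is the Kuratowski pair {{s}, {s, t}} *)
definition opair_fm :: "'c trm \<Rightarrow> 'c trm \<Rightarrow> 'c trm \<Rightarrow> 'c fm" where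
  "opair_fm s t p =
     (\<^bold>\<exists>\<^bold>\<exists>upair_fm (\<up>\<up>s) (\<up>\<up>s) (\<^bold>#1) \<^bold>\<and> upair_fm (\<up>\<up>s) (\<up>\<up>t) (\<^bold>#0) \<^bold>\<and> upair_fm (\<^bold>#1) (\<^bold>#0) (\<up>\<up>p))"

(* the ordered pair (s, t) belongs to f *)
definition maps_fm :: "'c trm \<Rightarrow> 'c trm \<Rightarrow> 'c trm \<Rightarrow> 'c fm" where
  "maps_fm f s t = (\<^bold>\<exists>opair_fm (\<up>s) (\<up>t) (\<^bold>#0) \<^bold>\<and> \<^bold>#0 \<^bold>\<in> \<up>f)"

(* f is an injective function from a to b; the conjuncts say that f is a set of pairs from a x b,
   and is total, single-valued and injective *)
definition injection_fm :: "'c trm \<Rightarrow> 'c trm \<Rightarrow> 'c trm \<Rightarrow> 'c fm" where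
  "injection_fm f a b =
     ((\<^bold>\<forall>\<^bold>#0 \<^bold>\<in> \<up>f \<^bold>\<longrightarrow>
         (\<^bold>\<exists>\<^bold>\<exists>\<^bold>#1 \<^bold>\<in> \<up>\<up>\<up>a \<^bold>\<and> \<^bold>#0 \<^bold>\<in> \<up>\<up>\<up>b \<^bold>\<and> opair_fm (\<^bold>#1) (\<^bold>#0) (\<^bold>#2))) \<^bold>\<and>
      (\<^bold>\<forall>\<^bold>#0 \<^bold>\<in> \<up>a \<^bold>\<longrightarrow> (\<^bold>\<exists>maps_fm (\<up>\<up>f) (\<^bold>#1) (\<^bold>#0))) \<^bold>\<and>
      (\<^bold>\<forall>\<^bold>\<forall>\<^bold>\<forall>maps_fm (\<up>\<up>\<up>f) (\<^bold>#2) (\<^bold>#1) \<^bold>\<and> maps_fm (\<up>\<up>\<up>f) (\<^bold>#2) (\<^bold>#0) \<^bold>\<longrightarrow> \<^bold>#1 \<^bold>= \<^bold>#0) \<^bold>\<and>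
      (\<^bold>\<forall>\<^bold>\<forall>\<^bold>\<forall>maps_fm (\<up>\<up>\<up>f) (\<^bold>#2) (\<^bold>#0) \<^bold>\<and> maps_fm (\<up>\<up>\<up>f) (\<^bold>#1) (\<^bold>#0) \<^bold>\<longrightarrow> \<^bold>#2 \<^bold>= \<^bold>#1))"

(* countable = finite or countably infinite *)
definition countable_fm :: "'c trm \<Rightarrow> 'c fm" where
  "countable_fm t = (\<^bold>\<exists>\<^bold>\<exists>omega_fm (\<^bold>#1) \<^bold>\<and> injection_fm (\<^bold>#0) (\<up>\<up>t) (\<^bold>#1))"

definition transitive_fm :: "'c trm \<Rightarrow> 'c fm" where
  "transitive_fm t = (\<^bold>\<forall>\<^bold>#0 \<^bold>\<in> \<up>t \<^bold>\<longrightarrow> subset_fm (\<^bold>#0) (\<up>t))"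


definition Extensionality :: "'c fm" where
  "Extensionality = (\<^bold>\<forall>\<^bold>\<forall>(\<^bold>\<forall>\<^bold>#0 \<^bold>\<in> \<^bold>#2 \<^bold>\<longleftrightarrow> \<^bold>#0 \<^bold>\<in> \<^bold>#1) \<^bold>\<longrightarrow> \<^bold>#1 \<^bold>= \<^bold>#0)"

definition Foundation :: "'c fm" where
  "Foundation =
     (\<^bold>\<forall>(\<^bold>\<exists>\<^bold>#0 \<^bold>\<in> \<^bold>#1) \<^bold>\<longrightarrow> (\<^bold>\<exists>\<^bold>#0 \<^bold>\<in> \<^bold>#1 \<^bold>\<and> \<^bold>\<not>(\<^bold>\<exists>\<^bold>#0 \<^bold>\<in> \<^bold>#1 \<^bold>\<and> \<^bold>#0 \<^bold>\<in> \<^bold>#2)))"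

definition Pairing :: "'c fm" where
  "Pairing = (\<^bold>\<forall>\<^bold>\<forall>\<^bold>\<exists>upair_fm (\<^bold>#2) (\<^bold>#1) (\<^bold>#0))"

definition Union_ax :: "'c fm" where
  "Union_ax = (\<^bold>\<forall>\<^bold>\<exists>\<^bold>\<forall>\<^bold>#0 \<^bold>\<in> \<^bold>#1 \<^bold>\<longleftrightarrow> (\<^bold>\<exists>\<^bold>#0 \<^bold>\<in> \<^bold>#3 \<^bold>\<and> \<^bold>#1 \<^bold>\<in> \<^bold>#0))"

definition Power_set :: "'c fm" where
  "Power_set = (\<^bold>\<forall>\<^bold>\<exists>\<^bold>\<forall>\<^bold>#0 \<^bold>\<in> \<^bold>#1 \<^bold>\<longleftrightarrow> subset_fm (\<^bold>#0) (\<^bold>#2))"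

definition Infinity :: "'c fm" where
  "Infinity = (\<^bold>\<exists>inductive_fm (\<^bold>#0))"

(* Every family a of nonempty, pairwise disjoint sets has a set c meeting each member of a in
   exactly one point. *)
definition Choice :: "'c fm" where
  "Choice =
     (\<^bold>\<forall>(\<^bold>\<forall>\<^bold>#0 \<^bold>\<in> \<^bold>#1 \<^bold>\<longrightarrow> (\<^bold>\<exists>\<^bold>#0 \<^bold>\<in> \<^bold>#1)) \<^bold>\<and>
        (\<^bold>\<forall>\<^bold>\<forall>\<^bold>#1 \<^bold>\<in> \<^bold>#2 \<^bold>\<and> \<^bold>#0 \<^bold>\<in> \<^bold>#2 \<^bold>\<and> (\<^bold>\<exists>\<^bold>#0 \<^bold>\<in> \<^bold>#2 \<^bold>\<and> \<^bold>#0 \<^bold>\<in> \<^bold>#1) \<^bold>\<longrightarrow> \<^bold>#1 \<^bold>= \<^bold>#0)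
        \<^bold>\<longrightarrow> (\<^bold>\<exists>\<^bold>\<forall>\<^bold>#0 \<^bold>\<in> \<^bold>#2 \<^bold>\<longrightarrow> (\<^bold>\<exists>\<^bold>\<forall>\<^bold>#0 \<^bold>\<in> \<^bold>#2 \<^bold>\<and> \<^bold>#0 \<^bold>\<in> \<^bold>#3 \<^bold>\<longleftrightarrow> \<^bold>#0 \<^bold>= \<^bold>#1)))"

(* ALL a. EX b. ALL x. x : b <-> x : a & p(x, a), where variables 0 and 1 of p stand for x and a
   and the others are parameters.  The substitution skips the binder of b. *)
definition Separation :: "'c fm \<Rightarrow> 'c fm" where
  "Separation p =
     (\<^bold>\<forall>\<^bold>\<exists>\<^bold>\<forall>\<^bold>#0 \<^bold>\<in> \<^bold>#1 \<^bold>\<longleftrightarrow> \<^bold>#0 \<^bold>\<in> \<^bold>#2 \<^bold>\<and> fsubst (case_nat (\<^bold>#0) (\<lambda>n. \<^bold>#(n + 2))) p)"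

(* ALL a. (ALL x : a. ALL y z. p(x, y, a) & p(x, z, a) --> y = z) -->
          (EX b. ALL y. y : b <-> (EX x : a. p(x, y, a))),
   where variables 0, 1 and 2 of p stand for x, y and a and the others are parameters. *)
definition Replacement :: "'c fm \<Rightarrow> 'c fm" where
  "Replacement p =
     (\<^bold>\<forall>(\<^bold>\<forall>\<^bold>#0 \<^bold>\<in> \<^bold>#1 \<^bold>\<longrightarrow>
          (\<^bold>\<forall>\<^bold>\<forall>fsubst (case_nat (\<^bold>#2) (case_nat (\<^bold>#1) (\<lambda>n. \<^bold>#(n + 3)))) p \<^bold>\<and>
              fsubst (case_nat (\<^bold>#2) (case_nat (\<^bold>#0) (\<lambda>n. \<^bold>#(n + 3)))) p \<^bold>\<longrightarrow> \<^bold>#1 \<^bold>= \<^bold>#0))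
        \<^bold>\<longrightarrow> (\<^bold>\<exists>\<^bold>\<forall>\<^bold>#0 \<^bold>\<in> \<^bold>#1 \<^bold>\<longleftrightarrow>
               (\<^bold>\<exists>\<^bold>#0 \<^bold>\<in> \<^bold>#3 \<^bold>\<and> fsubst (case_nat (\<^bold>#0) (case_nat (\<^bold>#1) (\<lambda>n. \<^bold>#(n + 3)))) p)))"

(* All n-fold universal quantifications that bind every free variable; the parameters of a schema
   instance are quantified this way. *)
definition closures :: "'c fm \<Rightarrow> 'c fm set" where
  "closures p = {q. fv q = {} \<and> (\<exists>n. q = (All ^^ n) p)}"

definition ZFC :: "'c fm set" where
  "ZFC =
     {Extensionality, Foundation, Pairing, Union_ax, Power_set, Infinity, Choice} \<union>
     (\<Union>p\<in>{p. csyms p = {}}. closures (Separation p)) \<union>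
     (\<Union>p\<in>{p. csyms p = {}}. closures (Replacement p))"


datatype csym = v_sym

definition L_ZF :: "csym set" where
  "L_ZF = {}"

definition L_MZF :: "csym set" where
  "L_MZF = {v_sym}"

(* The formula saying that the structure (t, :) satisfies p, by Tarski's satisfaction clauses:
   quantifiers range over the elements of t, and the symbol for membership is interpreted by
   membership.  The recursion is on the metatheoretic formula p, whose free variables (if any)
   are to denote elements of t. *)
primrec sat_fm :: "'c trm \<Rightarrow> 'c fm \<Rightarrow> 'c fm" where
  "sat_fm t Fls = Fls"
| "sat_fm t (r \<^bold>= s) = (r \<^bold>= s)"
| "sat_fm t (r \<^bold>\<in> s) = (r \<^bold>\<in> s)"
| "sat_fm t (p \<^bold>\<longrightarrow> q) = (sat_fm t p \<^bold>\<longrightarrow> sat_fm t q)"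
| "sat_fm t (\<^bold>\<forall>p) = (\<^bold>\<forall>\<^bold>#0 \<^bold>\<in> \<up>t \<^bold>\<longrightarrow> sat_fm (\<up>t) p)"

definition MZFC :: "csym fm set" where
  "MZFC =
     ZFC \<union> {countable_fm (Cst v_sym) \<^bold>\<and> transitive_fm (Cst v_sym)} \<union> sat_fm (Cst v_sym) ` ZFC"

end

theory Submission
  imports Defs "HOL-Library.Countable" "HOL-Library.Infinite_Set"
begin

text \<open>Let \<open>ZFC\<close> not prove \<open>\<psi>\<close>. By completeness there is a model of \<open>ZFC\<close> in which \<open>\<psi>\<close> fails. A proof
  of \<open>\<psi>\<close> in \<open>MZFC\<close> uses only finitely many axioms, so by soundness it suffices to find in this model
  an interpretation of \<open>v\<close> that is countable and transitive and satisfies finitely many given axioms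
  of \<open>ZFC\<close>. Inside the model, Scott's trick and iteration along \<open>\<omega>\<close> give a set closed under
  witnesses for the finitely many subformulas concerned; choice picks witness functions on it, and
  closing off under these functions gives a countable subset that is elementary for these formulas.
  Its Mostowski collapse is the required value of \<open>v\<close>.\<close>

section \<open>Semantics, substitution and soundness\<close>

text \<open>The model given by completeness need not be well-founded, and its \<open>omega\<close>
  may have nonstandard elements. Iteration, ranks, choice functions and collapse in the metatheory
  are therefore of no use: each has to be built inside the model, where Separation, Replacement and
  induction are available only for classes given by formulas. Hence the calculus around
  \<open>df\<close> and \<open>dff\<close>, whose rules \<open>dfs\<close> establish definability by
  resolution along the shape of a class. Truth in the model is not definable in it, so the search
  for witnesses can be one definable relation only for a finite list of formulas. This is why
  compactness of proofs comes before the construction: the value of \<open>v\<close> depends on the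
  derivation, and soundness is applied to the finite set of axioms used there, never to all of
  \<open>MZFC\<close> at once. Extensionality is added to the list, because the collapse of a set is
  injective only if the set is extensional.\<close>

primrec tval :: "('c \<Rightarrow> 'a) \<Rightarrow> (nat \<Rightarrow> 'a) \<Rightarrow> 'c trm \<Rightarrow> 'a" where
  "tval I e (\<^bold>#n) = e n"
| "tval I e (Cst c) = I c"

text \<open>The domain is an argument, so that one definition serves a whole type, a set of the
  model seen through its members, and the term model. Only quantifiers obey the domain; the
  valuation may leave it.\<close>

primrec sat :: "'a set \<Rightarrow> ('a \<Rightarrow> 'a \<Rightarrow> bool) \<Rightarrow> ('c \<Rightarrow> 'a) \<Rightarrow> (nat \<Rightarrow> 'a) \<Rightarrow> 'c fm \<Rightarrow> bool" where
  "sat D E I e Fls = False"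
| "sat D E I e (s \<^bold>= t) = (tval I e s = tval I e t)"
| "sat D E I e (s \<^bold>\<in> t) = E (tval I e s) (tval I e t)"
| "sat D E I e (p \<^bold>\<longrightarrow> q) = (sat D E I e p \<longrightarrow> sat D E I e q)"
| "sat D E I e (\<^bold>\<forall>p) = (\<forall>x\<in>D. sat D E I (case_nat x e) p)"

lemma finite_fv: "finite (fv p)"
proof (induction p)
  case (Eq s t) then show ?case by (cases s; cases t) auto
next
  case (Mem s t) then show ?case by (cases s; cases t) auto
next
  case (All p)
  have "{n. Suc n \<in> fv p} = Suc -` fv p" by auto
  then show ?case using All by (auto intro: finite_vimageI)
qed auto

lemma tval_cong: "\<lbrakk>\<And>n. n \<in> tfv t \<Longrightarrow> e n = e' n; \<And>c. c \<in> tcsyms t \<Longrightarrow> I c = I' c\<rbrakk> \<Longrightarrow> tval I e t = tval I' e' t"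
  by (cases t) auto

lemma sat_cong:
  "\<lbrakk>\<And>n. n \<in> fv p \<Longrightarrow> e n = e' n; \<And>c. c \<in> csyms p \<Longrightarrow> I c = I' c\<rbrakk> \<Longrightarrow>
    sat D E I e p = sat D E I' e' p"
proof (induction p arbitrary: e e')
  case (Eq s t)
  then have "tval I e s = tval I' e' s" "tval I e t = tval I' e' t" by (auto intro!: tval_cong)
  then show ?case by simp
next
  case (Mem s t)
  then have "tval I e s = tval I' e' s" "tval I e t = tval I' e' t" by (auto intro!: tval_cong)
  then show ?case by simp
next
  case (Imp p q)
  have "sat D E I e p = sat D E I' e' p" "sat D E I e q = sat D E I' e' q"
    by (rule Imp.IH; simp add: Imp.prems)+
  then show ?case by simp
next
  case (All p)
  have "sat D E I (case_nat x e) p = sat D E I' (case_nat x e') p" for x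
    by (rule All.IH) (auto simp: All.prems split: nat.splits)
  then show ?case by simp
qed auto

lemma tval_tsubst: "tval I e (tsubst \<sigma> t) = tval I (\<lambda>n. tval I e (\<sigma> n)) t"
  by (cases t) auto

lemma tval_tlift [simp]: "tval I (case_nat x e) (\<up>t) = tval I e t"
  by (simp add: tlift_def tval_tsubst)

lemma case_nat_tval: "(\<lambda>n. tval I (case_nat x e) (case_nat (\<^bold>#0) (\<lambda>n. \<up>(\<sigma> n)) n)) = case_nat x (\<lambda>n. tval I e (\<sigma> n))"
  by (auto split: nat.splits)

lemma sat_fsubst: "sat D E I e (fsubst \<sigma> p) = sat D E I (\<lambda>n. tval I e (\<sigma> n)) p"
  by (induction p arbitrary: e \<sigma>) (simp_all add: tval_tsubst case_nat_tval)

lemma sat_finst: "sat D E I e (finst t p) = sat D E I (case_nat (tval I e t) e) p"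
proof -
  have "(\<lambda>n. tval I e (case_nat t Var n)) = case_nat (tval I e t) e"
    by (auto split: nat.splits)
  then show ?thesis by (simp add: finst_def sat_fsubst)
qed

lemma sat_flift: "sat D E I (case_nat x e) (flift p) = sat D E I e p"
  by (simp add: flift_def sat_fsubst)

text \<open>Confined to the full domain: \<open>AllE\<close> instantiates with arbitrary terms,
  whose values could lie outside a smaller one.\<close>

lemma soundness:
  assumes "prov L T p" and "\<And>q. q \<in> T \<Longrightarrow> sat UNIV E I e q"
  shows "sat UNIV E I e p"
  using assms
proof (induction arbitrary: e rule: prov.induct)
  case (AllI T p)
  have "sat UNIV E I (case_nat x e) p" for x
    using AllI.prems by (intro AllI.IH) (auto simp: sat_flift)
  then show ?case by simp
next
  case (EqE p T s t)
  then show ?case by (simp add: sat_finst)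
next
  case (RAA p T)
  show ?case
  proof (rule ccontr)
    assume "\<not> sat UNIV E I e p"
    then have "sat UNIV E I e q" if "q \<in> insert (\<^bold>\<not>p) T" for q
      using RAA.prems that by auto
    then show False using RAA.IH[of e] by simp
  qed
qed (auto simp: sat_finst)

text \<open>Serves twice: to move the countermodel from a set of natural numbers onto the whole
  type, and to transfer truth along the Mostowski collapse. As \<open>p\<close> has no constants,
  \<open>I\<close> and \<open>I'\<close> may be unrelated.\<close>

lemma sat_iso:
  assumes h: "bij_betw h D D'" and E: "\<And>x y. x \<in> D \<Longrightarrow> y \<in> D \<Longrightarrow> E' (h x) (h y) = E x y"
  shows "\<lbrakk>csyms p = {}; \<And>n. n \<in> fv p \<Longrightarrow> e n \<in> D\<rbrakk> \<Longrightarrow> sat D' E' I' (\<lambda>n. h (e n)) p = sat D E I e p"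
proof (induction p arbitrary: e)
  case (Eq s t)
  then show ?case using h by (cases s; cases t) (auto simp: bij_betw_def inj_on_def)
next
  case (Mem s t)
  then show ?case using E by (cases s; cases t) auto
next
  case (All p)
  have *: "sat D' E' I' (case_nat (h x) (\<lambda>n. h (e n))) p = sat D E I (case_nat x e) p" if "x \<in> D" for x
  proof -
    have "(\<lambda>n. h (case_nat x e n)) = case_nat (h x) (\<lambda>n. h (e n))" by (auto split: nat.splits)
    moreover have "sat D' E' I' (\<lambda>n. h (case_nat x e n)) p = sat D E I (case_nat x e) p"
      by (rule All.IH) (use All.prems that in \<open>auto split: nat.splits\<close>)
    ultimately show ?thesis by simp
  qed
  have "D' = h ` D" using h by (simp add: bij_betw_def)
  then show ?case using * by auto
qed auto

section \<open>Substitution calculus and derived properties of provability\<close>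

lemma tcsyms_tsubst: "(\<And>n. tcsyms (\<sigma> n) \<subseteq> L) \<Longrightarrow> tcsyms t \<subseteq> L \<Longrightarrow> tcsyms (tsubst \<sigma> t) \<subseteq> L"
  by (cases t) auto

lemma tcsyms_tlift [simp]: "tcsyms (\<up>t) = tcsyms t"
  by (cases t) (auto simp: tlift_def)

lemma csyms_fsubst: "(\<And>n. tcsyms (\<sigma> n) \<subseteq> L) \<Longrightarrow> csyms p \<subseteq> L \<Longrightarrow> csyms (fsubst \<sigma> p) \<subseteq> L"
proof (induction p arbitrary: \<sigma>)
  case (All p)
  then show ?case by (simp, intro All.IH) (auto split: nat.splits)
qed (simp_all add: tcsyms_tsubst)

lemma tsubst_cong: "(\<And>n. n \<in> tfv t \<Longrightarrow> \<sigma> n = \<tau> n) \<Longrightarrow> tsubst \<sigma> t = tsubst \<tau> t"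
  by (cases t) auto

lemma fsubst_cong: "(\<And>n. n \<in> fv p \<Longrightarrow> \<sigma> n = \<tau> n) \<Longrightarrow> fsubst \<sigma> p = fsubst \<tau> p"
proof (induction p arbitrary: \<sigma> \<tau>)
  case (All p)
  have "fsubst (case_nat (\<^bold>#0) (\<lambda>n. \<up>(\<sigma> n))) p = fsubst (case_nat (\<^bold>#0) (\<lambda>n. \<up>(\<tau> n))) p"
    by (rule All.IH) (use All.prems in \<open>auto split: nat.splits\<close>)
  then show ?case by simp
next
  case (Imp p q)
  have "fsubst \<sigma> p = fsubst \<tau> p" "fsubst \<sigma> q = fsubst \<tau> q"
    by (rule Imp.IH; simp add: Imp.prems)+
  then show ?case by simp
next
  case (Eq s t)
  then have "tsubst \<sigma> s = tsubst \<tau> s" "tsubst \<sigma> t = tsubst \<tau> t" by (auto intro!: tsubst_cong)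
  then show ?case by simp
next
  case (Mem s t)
  then have "tsubst \<sigma> s = tsubst \<tau> s" "tsubst \<sigma> t = tsubst \<tau> t" by (auto intro!: tsubst_cong)
  then show ?case by simp
qed simp

lemma tsubst_tsubst: "tsubst \<sigma> (tsubst \<tau> t) = tsubst (\<lambda>n. tsubst \<sigma> (\<tau> n)) t"
  by (cases t) auto

lemma tsubst_tlift: "tsubst (case_nat s \<sigma>) (\<up>t) = tsubst \<sigma> t"
  by (cases t) (auto simp: tlift_def)

lemma tlift_tsubst: "\<up>(tsubst \<sigma> t) = tsubst (\<lambda>n. \<up>(\<sigma> n)) t"
  by (cases t) (auto simp: tlift_def)

lemma fsubst_fsubst: "fsubst \<sigma> (fsubst \<tau> p) = fsubst (\<lambda>n. tsubst \<sigma> (\<tau> n)) p"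
proof (induction p arbitrary: \<sigma> \<tau>)
  case (All p)
  have "(\<lambda>n. tsubst (case_nat (\<^bold>#0) (\<lambda>n. \<up>(\<sigma> n))) (case_nat (\<^bold>#0) (\<lambda>n. \<up>(\<tau> n)) n))
      = case_nat (\<^bold>#0) (\<lambda>n. \<up>(tsubst \<sigma> (\<tau> n)))"
    by (auto simp: tsubst_tlift tlift_tsubst split: nat.splits)
  then show ?case using All by simp
qed (auto simp: tsubst_tsubst)

lemma tsubst_Var [simp]: "tsubst Var t = t"
  by (cases t) auto

lemma case_nat_Var: "case_nat (\<^bold>#0) (\<lambda>n. \<up>(\<^bold>#n)) = Var"
  by (auto simp: tlift_def split: nat.splits)

lemma fsubst_Var [simp]: "fsubst Var p = p"
  by (induction p) (auto simp: case_nat_Var)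

lemma fsubst_id: "(\<And>n. n \<in> fv p \<Longrightarrow> \<sigma> n = \<^bold>#n) \<Longrightarrow> fsubst \<sigma> p = p"
  using fsubst_cong[of p \<sigma> Var] by simp

lemma fsubst_flift: "fsubst (case_nat (\<^bold>#0) (\<lambda>n. \<up>(\<sigma> n))) (flift p) = flift (fsubst \<sigma> p)"
  by (simp add: flift_def fsubst_fsubst tlift_def)

lemma fsubst_finst:
  "fsubst \<sigma> (finst t p) = finst (tsubst \<sigma> t) (fsubst (case_nat (\<^bold>#0) (\<lambda>n. \<up>(\<sigma> n))) p)"
proof -
  have "(\<lambda>n. tsubst \<sigma> (case_nat t Var n)) =
    (\<lambda>n. tsubst (case_nat (tsubst \<sigma> t) Var) (case_nat (\<^bold>#0) (\<lambda>n. \<up>(\<sigma> n)) n))"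
    by (auto simp: tsubst_tlift split: nat.splits)
  then show ?thesis by (simp add: finst_def fsubst_fsubst)
qed

text \<open>The induction is for all \<sigma> at once: above \<open>AllI\<close> the substitution
  has to fix variable 0 and act lifted on the rest, which by \<open>fsubst_flift\<close> fits the
  lifted hypotheses.\<close>

lemma prov_fsubst:
  assumes "prov L T p" and "\<And>n. tcsyms (\<sigma> n) \<subseteq> L"
  shows "prov L (fsubst \<sigma> ` T) (fsubst \<sigma> p)"
  using assms
proof (induction arbitrary: \<sigma> rule: prov.induct)
  case (Hyp p T)
  then show ?case by (intro prov.Hyp csyms_fsubst imageI)
next
  case (ImpI p T q)
  then have "csyms (fsubst \<sigma> p) \<subseteq> L" by (intro csyms_fsubst)
  then show ?case using ImpI.IH[of \<sigma>] ImpI.prems by (auto intro!: prov.ImpI)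
next
  case (ImpE T p q)
  have "prov L (fsubst \<sigma> ` T) (fsubst \<sigma> p \<^bold>\<longrightarrow> fsubst \<sigma> q)"
    using ImpE.IH(1)[of \<sigma>] ImpE.prems by simp
  then show ?case by (rule prov.ImpE) (rule ImpE.IH(2)[OF ImpE.prems])
next
  case (RAA p T)
  then have "csyms (fsubst \<sigma> p) \<subseteq> L" by (intro csyms_fsubst)
  then show ?case by (rule prov.RAA) (use RAA.IH[of \<sigma>] RAA.prems in simp)
next
  case (AllI T p)
  let ?s = "case_nat (\<^bold>#0) (\<lambda>n. \<up>(\<sigma> n))"
  have "prov L (fsubst ?s ` flift ` T) (fsubst ?s p)"
    using AllI.prems by (intro AllI.IH) (auto split: nat.splits)
  then have "prov L (flift ` fsubst \<sigma> ` T) (fsubst ?s p)"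
    by (simp add: image_image fsubst_flift)
  then show ?case by (auto intro: prov.AllI)
next
  case (AllE T p t)
  have "tcsyms (tsubst \<sigma> t) \<subseteq> L" using AllE by (intro tcsyms_tsubst)
  then show ?case unfolding fsubst_finst
    by (intro prov.AllE) (use AllE.IH[of \<sigma>] AllE.prems in simp_all)
next
  case (EqI t T)
  then show ?case using tcsyms_tsubst[of \<sigma> L t] by (auto intro!: prov.EqI)
next
  case (EqE p T s t)
  let ?p = "fsubst (case_nat (\<^bold>#0) (\<lambda>n. \<up>(\<sigma> n))) p"
  have "csyms ?p \<subseteq> L"
    using EqE by (intro csyms_fsubst) (auto split: nat.splits)
  then have "prov L (fsubst \<sigma> ` T) (finst (tsubst \<sigma> t) ?p)"
    by (rule prov.EqE[of _ _ _ "tsubst \<sigma> s"])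
      (use EqE.IH[of \<sigma>] EqE.prems in \<open>simp_all add: fsubst_finst\<close>)
  then show ?case by (simp add: fsubst_finst)
qed

lemma prov_mono: "prov L T p \<Longrightarrow> L \<subseteq> L' \<Longrightarrow> T \<subseteq> T' \<Longrightarrow> prov L' T' p"
proof (induction arbitrary: T' rule: prov.induct)
  case (Hyp p T)
  then show ?case by (auto intro: prov.Hyp)
next
  case (ImpI p T q)
  have "prov L' (insert p T') q" by (rule ImpI.IH) (use ImpI.prems in auto)
  then show ?case using ImpI by (auto intro: prov.ImpI)
next
  case (ImpE T p q)
  show ?case by (rule prov.ImpE[OF ImpE.IH]) (fact ImpE.prems)+
next
  case (RAA p T)
  have "prov L' (insert (\<^bold>\<not>p) T') Fls" by (rule RAA.IH) (use RAA.prems in auto)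
  then show ?case using RAA by (auto intro: prov.RAA)
next
  case (AllI T p)
  have "prov L' (flift ` T') p" by (rule AllI.IH) (use AllI.prems in auto)
  then show ?case by (auto intro: prov.AllI)
next
  case (AllE T p t)
  show ?case by (rule prov.AllE[OF AllE.IH]) (use AllE in auto)
next
  case (EqI t T)
  then show ?case by (auto intro: prov.EqI)
next
  case (EqE p T s t)
  have "prov L' T' (s \<^bold>= t)" "prov L' T' (finst s p)"
    by (rule EqE.IH; simp add: EqE.prems)+
  then show ?case using EqE.hyps(1) EqE.prems(1) by (meson prov.EqE subset_trans)
qed

lemma prov_weaken: "prov L T p \<Longrightarrow> T \<subseteq> T' \<Longrightarrow> prov L T' p"
  by (rule prov_mono) auto

lemma prov_compact: "prov L T p \<Longrightarrow> \<exists>F\<subseteq>T. finite F \<and> prov L F p"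
proof (induction rule: prov.induct)
  case (Hyp p T)
  then show ?case by (intro exI[of _ "{p}"]) (auto intro: prov.Hyp)
next
  case (ImpI p T q)
  then obtain F where F: "F \<subseteq> insert p T" "finite F" "prov L F q" by auto
  \<comment> \<open>Deleting \<open>p\<close> from \<open>F\<close> leaves a subset of
    \<open>T\<close>, whether or not the derivation used \<open>p\<close>.\<close>
  have "prov L (insert p (F - {p})) q" by (rule prov_weaken[OF F(3)]) auto
  then have "prov L (F - {p}) (p \<^bold>\<longrightarrow> q)" by (rule prov.ImpI[OF ImpI(1)])
  then show ?case using F(1,2) by (intro exI[of _ "F - {p}"]) auto
next
  case (ImpE T p q)
  then obtain F G where F: "F \<subseteq> T" "finite F" "prov L F (p \<^bold>\<longrightarrow> q)" and G: "G \<subseteq> T" "finite G" "prov L G p"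
    by auto
  have "prov L (F \<union> G) q" by (rule prov.ImpE[OF prov_weaken[OF F(3)] prov_weaken[OF G(3)]]) auto
  then show ?case using F(1,2) G(1,2) by (intro exI[of _ "F \<union> G"]) auto
next
  case (RAA p T)
  then obtain F where F: "F \<subseteq> insert (\<^bold>\<not>p) T" "finite F" "prov L F Fls" by auto
  have "prov L (insert (\<^bold>\<not>p) (F - {\<^bold>\<not>p})) Fls" by (rule prov_weaken[OF F(3)]) auto
  then have "prov L (F - {\<^bold>\<not>p}) p" by (rule prov.RAA[OF RAA(1)])
  then show ?case using F(1,2) by (intro exI[of _ "F - {\<^bold>\<not>p}"]) auto
next
  case (AllI T p)
  then obtain F where F: "F \<subseteq> flift ` T" "finite F" "prov L F p" by auto
  then obtain G where "G \<subseteq> T" "finite G" "F = flift ` G" by (meson finite_subset_image)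
  then show ?case using prov.AllI[of L G p] F(3) by auto
next
  case (AllE T p t)
  then show ?case by (meson prov.AllE)
next
  case (EqI t T)
  then show ?case by (intro exI[of _ "{}"]) (auto intro: prov.EqI)
next
  case (EqE p T s t)
  then obtain F G where F: "F \<subseteq> T" "finite F" "prov L F (s \<^bold>= t)" and G: "G \<subseteq> T" "finite G" "prov L G (finst s p)"
    by auto
  have "prov L (F \<union> G) (finst t p)"
    by (rule prov.EqE[OF EqE(1) prov_weaken[OF F(3)] prov_weaken[OF G(3)]]) auto
  then show ?case using F(1,2) G(1,2) by (intro exI[of _ "F \<union> G"]) auto
qed

lemma prov_explode: "prov L T Fls \<Longrightarrow> csyms p \<subseteq> L \<Longrightarrow> prov L T p"
  by (rule prov.RAA) (auto intro: prov_weaken)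

lemma consistent_iff: "consistent L T \<longleftrightarrow> \<not> prov L T Fls"
proof
  assume "consistent L T"
  then show "\<not> prov L T Fls"
    unfolding consistent_def using prov_explode[of L T Fls] prov_explode[of L T "\<^bold>\<not>Fls"] by auto
next
  assume "\<not> prov L T Fls"
  then show "consistent L T" unfolding consistent_def by (meson prov.ImpE)
qed

text \<open>\<open>AllI\<close> allows only variable 0 as eigenvariable. Renaming \<open>k\<close>
  to 0 and shifting all other variables up acts as \<open>flift\<close> on hypotheses without
  \<open>k\<close> and undoes the instantiation of \<open>p\<close> with \<open>k\<close>.\<close>

lemma fresh_AllI:
  assumes "prov L T (finst (\<^bold>#k) p)" "k \<notin> fv (\<^bold>\<forall>p)" "\<And>q. q \<in> T \<Longrightarrow> k \<notin> fv q"
  shows "prov L T (\<^bold>\<forall>p)"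
proof (rule prov.AllI)
  let ?s = "\<lambda>n. if n = k then \<^bold>#0 else \<^bold>#(Suc n) :: 'a trm"
  have 1: "fsubst ?s q = flift q" if "q \<in> T" for q
    unfolding flift_def using assms(3)[OF that] by (intro fsubst_cong) auto
  have "fsubst ?s (finst (\<^bold>#k) p) = fsubst (\<lambda>n. tsubst ?s (case_nat (\<^bold>#k) Var n)) p"
    by (simp add: finst_def fsubst_fsubst)
  also have "\<dots> = p" using assms(2) by (intro fsubst_id) (auto split: nat.splits)
  finally have 2: "fsubst ?s (finst (\<^bold>#k) p) = p" .
  have "prov L (fsubst ?s ` T) (fsubst ?s (finst (\<^bold>#k) p))"
    by (rule prov_fsubst[OF assms(1)]) auto
  moreover have "fsubst ?s ` T = flift ` T" using 1 by (auto simp: image_def)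
  ultimately show "prov L (flift ` T) p" using 2 by simp
qed

section \<open>Completeness\<close>

instance csym :: countable
  by countable_datatype

instance trm :: (countable) countable
  by countable_datatype

instance fm :: (countable) countable
  by countable_datatype

lemma prov_csyms: "prov L T p \<Longrightarrow> csyms p \<subseteq> L"
proof (induction rule: prov.induct)
  case (AllE T p t)
  then show ?case unfolding finst_def by (intro csyms_fsubst) (auto split: nat.splits)
next
  case (EqE p T s t)
  have "tcsyms t \<subseteq> L" using EqE.IH(1) by simp
  then show ?case using EqE.hyps(1) unfolding finst_def by (intro csyms_fsubst) (auto split: nat.splits)
qed auto

lemma csyms_finst_Var: "csyms p = {} \<Longrightarrow> csyms (finst (\<^bold>#k) p) = {}"
  unfolding finst_def using csyms_fsubst[of "case_nat (\<^bold>#k) Var" "{}" p] by (auto split: nat.splits)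

text \<open>Since the theory consists of sentences, the free variables can serve as Henkin constants; the
  domain of the term model is a set of representatives of their classes modulo provable equality.\<close>

locale henkin =
  fixes T0 :: "'c::countable fm set"
  assumes consistent_T0: "\<not> prov {} T0 Fls"
    and sentences_T0: "p \<in> T0 \<Longrightarrow> sentence {} p"
begin

definition fresh :: "'c fm set \<Rightarrow> nat" where
  "fresh F = (SOME k. \<forall>p\<in>F. k \<notin> fv p)"

text \<open>The existential quantifier is an abbreviation, so negated universal formulas are the
  only ones that call for a witness. The result is a set with at most one element, so that other
  formulas contribute nothing.\<close>

definition witness :: "'c fm \<Rightarrow> 'c fm set \<Rightarrow> 'c fm set" where
  "witness p F = {w. \<exists>q. p = \<^bold>\<not>(\<^bold>\<forall>q) \<and> w = \<^bold>\<not>(finst (\<^bold>#(fresh (insert p F))) q)}"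

text \<open>\<open>T0\<close> is kept out of the stages: they remain finite, so a fresh variable
  exists at each step, and it is fresh for \<open>T0\<close> as well because \<open>T0\<close>
  consists of sentences.\<close>

primrec stage :: "nat \<Rightarrow> 'c fm set" where
  "stage 0 = {}"
| "stage (Suc n) =
     (let p = from_nat n in
      if csyms p = {} \<and> \<not> prov {} (insert p (T0 \<union> stage n)) Fls
      then insert p (stage n) \<union> witness p (stage n) else stage n)"

lemmas stage_Suc = stage.simps(2)
declare stage_Suc [simp del]

definition T :: "'c fm set" where
  "T = T0 \<union> (\<Union>n. stage n)"

lemma fresh: "finite F \<Longrightarrow> p \<in> F \<Longrightarrow> fresh F \<notin> fv p"
proof -
  assume F: "finite F" "p \<in> F"
  have "finite (\<Union>p\<in>F. fv p)" using F by (simp add: finite_fv)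
  then obtain k where "k \<notin> (\<Union>p\<in>F. fv p)" using ex_new_if_finite infinite_UNIV_nat by blast
  then have "\<forall>p\<in>F. k \<notin> fv p" by auto
  then have "\<forall>p\<in>F. fresh F \<notin> fv p" unfolding fresh_def by (rule someI)
  then show ?thesis using F by auto
qed

lemma witness_cases: "witness p F = {} \<or>
    (\<exists>q. p = \<^bold>\<not>(\<^bold>\<forall>q) \<and> witness p F = {\<^bold>\<not>(finst (\<^bold>#(fresh (insert p F))) q)})"
  unfolding witness_def by auto

lemma finite_stage: "finite (stage n)"
proof (induction n)
  case (Suc n)
  have "finite (witness p (stage n))" for p
    using witness_cases[of p "stage n"] by (elim disjE exE conjE) simp_all
  then show ?case using Suc by (simp add: Let_def stage_Suc)
qed simp

lemma csyms_stage: "p \<in> stage n \<Longrightarrow> csyms p = {}"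
proof (induction n arbitrary: p)
  case (Suc n)
  have w: "csyms p = {}" if "csyms r = {}" "p \<in> witness r (stage n)" for p r
    using that by (auto simp: witness_def csyms_finst_Var)
  from Suc.prems consider "p \<in> stage n" | "p = from_nat n" "csyms p = {}"
    | r where "csyms r = {}" "p \<in> witness r (stage n)"
    unfolding stage_Suc Let_def by (auto split: if_splits)
  then show ?case using Suc.IH w by cases blast+
qed simp

lemma fv_T0: "p \<in> T0 \<Longrightarrow> fv p = {}" and csyms_T0: "p \<in> T0 \<Longrightarrow> csyms p = {}"
  using sentences_T0 by (auto simp: sentence_def)

text \<open>If adding the witness formula made the stage inconsistent, the stage with
  \<open>p\<close> would prove the instance at the fresh variable \<open>k\<close>, hence the
  universal formula that \<open>p\<close> negates.\<close>

lemma consistent_stage: "\<not> prov {} (T0 \<union> stage n) Fls"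
proof (induction n)
  case 0
  show ?case using consistent_T0 by simp
next
  case (Suc n)
  define p :: "'c fm" where "p = from_nat n"
  show ?case
  proof (cases "csyms p = {} \<and> \<not> prov {} (insert p (T0 \<union> stage n)) Fls")
    case False
    then have "stage (Suc n) = stage n" unfolding stage_Suc Let_def p_def by (rule if_not_P)
    then show ?thesis using Suc by simp
  next
    case True
    then have s: "T0 \<union> stage (Suc n) = witness p (stage n) \<union> insert p (T0 \<union> stage n)"
      unfolding stage_Suc Let_def p_def by (subst if_P) auto
    show ?thesis
    proof (cases "witness p (stage n) = {}")
      case True': True
      then show ?thesis using True s by simp
    next
      case False
      define k where "k = fresh (insert p (stage n))"
      obtain q where q: "p = \<^bold>\<not>(\<^bold>\<forall>q)" "witness p (stage n) = {\<^bold>\<not>(finst (\<^bold>#k) q)}"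
        using False witness_cases[of p "stage n"] unfolding k_def by blast
      have k: "k \<notin> fv r" if "r \<in> insert p (T0 \<union> stage n)" for r
        using that fv_T0 fresh[of "insert p (stage n)" r] finite_stage unfolding k_def by auto
      have "csyms q = {}" using True q by simp
      then have c: "csyms (finst (\<^bold>#k) q) \<subseteq> {}" by (simp add: csyms_finst_Var)
      show ?thesis
      proof
        assume "prov {} (T0 \<union> stage (Suc n)) Fls"
        then have "prov {} (insert (\<^bold>\<not>(finst (\<^bold>#k) q)) (insert p (T0 \<union> stage n))) Fls"
          unfolding s q(2) by (simp add: insert_commute)
        then have "prov {} (insert p (T0 \<union> stage n)) (finst (\<^bold>#k) q)"
          by (rule prov.RAA[OF c])
        then have "prov {} (insert p (T0 \<union> stage n)) (\<^bold>\<forall>q)"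
          by (rule fresh_AllI) (use k k[of p] q in auto)
        moreover have "prov {} (insert p (T0 \<union> stage n)) (\<^bold>\<not>(\<^bold>\<forall>q))"
          using True q by (intro prov.Hyp) auto
        ultimately show False using True prov.ImpE by blast
      qed
    qed
  qed
qed

lemma stage_mono: "m \<le> n \<Longrightarrow> stage m \<subseteq> stage n"
proof (induction rule: dec_induct)
  case (step n)
  then show ?case by (auto simp: Let_def stage_Suc)
qed simp

lemma csyms_T: "p \<in> T \<Longrightarrow> csyms p = {}"
  by (auto simp: T_def csyms_T0 csyms_stage)

lemma consistent_T: "\<not> prov {} T Fls"
proof
  assume "prov {} T Fls"
  then obtain F where F: "F \<subseteq> T" "finite F" "prov {} F Fls"
    using prov_compact[of "{}" T Fls] by blast
  have "\<exists>n. F \<subseteq> T0 \<union> stage n"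
    using F(2,1)
  proof (induction rule: finite_induct)
    case (insert p F)
    then obtain n where n: "F \<subseteq> T0 \<union> stage n" by auto
    obtain m where m: "p \<in> T0 \<union> stage m" using insert unfolding T_def by auto
    have "insert p F \<subseteq> T0 \<union> stage (max m n)"
      using n m stage_mono[of m "max m n"] stage_mono[of n "max m n"] by auto
    then show ?case ..
  qed simp
  then show False using F(3) prov_weaken consistent_stage by blast
qed

lemma T_decides:
  assumes "csyms p = {}" "p \<notin> T"
  shows "prov {} T (\<^bold>\<not>p)"
proof -
  \<comment> \<open>The formula was considered at the stage numbered by its own code; being absent
    from \<open>T\<close>, it must have been rejected there as inconsistent.\<close>
  obtain n where n: "p = from_nat n" by (metis from_nat_to_nat)
  have "p \<notin> stage (Suc n)" using assms(2) unfolding T_def by blast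
  then have "prov {} (insert p (T0 \<union> stage n)) Fls"
    using assms(1) n by (auto simp: Let_def stage_Suc split: if_splits)
  then have "prov {} (T0 \<union> stage n) (\<^bold>\<not>p)" using assms(1) by (intro prov.ImpI) auto
  then show ?thesis by (rule prov_weaken) (auto simp: T_def)
qed

lemma T_iff_prov: "p \<in> T \<longleftrightarrow> prov {} T p"
proof
  assume "p \<in> T"
  then show "prov {} T p" using csyms_T by (intro prov.Hyp) auto
next
  assume p: "prov {} T p"
  then have "csyms p = {}" using prov_csyms by blast
  then show "p \<in> T" using T_decides[of p] p consistent_T prov.ImpE by blast
qed

lemma T_imp: "csyms p = {} \<Longrightarrow> csyms q = {} \<Longrightarrow> (p \<^bold>\<longrightarrow> q) \<in> T \<longleftrightarrow> (p \<in> T \<longrightarrow> q \<in> T)"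
proof
  assume "(p \<^bold>\<longrightarrow> q) \<in> T"
  then show "p \<in> T \<longrightarrow> q \<in> T" using T_iff_prov prov.ImpE by blast
next
  assume c: "csyms p = {}" "csyms q = {}" and pq: "p \<in> T \<longrightarrow> q \<in> T"
  have "prov {} T (p \<^bold>\<longrightarrow> q)"
  proof (cases "p \<in> T")
    case True
    then have "prov {} T q" using pq T_iff_prov by simp
    then have "prov {} (insert p T) q" by (rule prov_weaken) auto
    then show ?thesis using c by (intro prov.ImpI) auto
  next
    case False
    then have "prov {} T (\<^bold>\<not>p)" using T_decides c by simp
    then have "prov {} (insert p T) (\<^bold>\<not>p)" by (rule prov_weaken) auto
    moreover have "prov {} (insert p T) p" using c by (intro prov.Hyp) auto
    ultimately have "prov {} (insert p T) Fls" by (rule prov.ImpE)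
    then have "prov {} (insert p T) q" by (rule prov_explode) (use c in simp)
    then show ?thesis using c by (intro prov.ImpI) auto
  qed
  then show "(p \<^bold>\<longrightarrow> q) \<in> T" by (simp add: T_iff_prov)
qed

lemma T_Fls: "Fls \<notin> T"
  using T_iff_prov consistent_T by simp

lemma T_neg: "csyms p = {} \<Longrightarrow> \<^bold>\<not>p \<in> T \<longleftrightarrow> p \<notin> T"
  using T_imp[of p Fls] T_Fls by auto

text \<open>Variables are the only terms of the empty language. If the universal formula is missing,
  its negation is in \<open>T\<close> and was given a refuting variable at the stage that considered
  it.\<close>

lemma T_all:
  assumes c: "csyms q = {}"
  shows "(\<^bold>\<forall>q) \<in> T \<longleftrightarrow> (\<forall>k. finst (\<^bold>#k) q \<in> T)"
proof
  assume "(\<^bold>\<forall>q) \<in> T"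
  then show "\<forall>k. finst (\<^bold>#k) q \<in> T"
    using T_iff_prov prov.AllE[of "{}" T q] by auto
next
  assume a: "\<forall>k. finst (\<^bold>#k) q \<in> T"
  show "(\<^bold>\<forall>q) \<in> T"
  proof (rule ccontr)
    assume "(\<^bold>\<forall>q) \<notin> T"
    then have p: "\<^bold>\<not>(\<^bold>\<forall>q) \<in> T" using T_neg c by simp
    define p where "p = \<^bold>\<not>(\<^bold>\<forall>q)"
    obtain n where n: "p = from_nat n" by (metis from_nat_to_nat)
    have "\<not> prov {} (insert p (T0 \<union> stage n)) Fls"
    proof
      assume "prov {} (insert p (T0 \<union> stage n)) Fls"
      then have "prov {} T Fls" by (rule prov_weaken) (use p p_def in \<open>auto simp: T_def\<close>)
      then show False using consistent_T by simp
    qed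
    then have "witness p (stage n) \<subseteq> stage (Suc n)"
      unfolding stage_Suc Let_def n[symmetric] using c p_def by auto
    then obtain k where "\<^bold>\<not>(finst (\<^bold>#k) q) \<in> stage (Suc n)"
      unfolding witness_def p_def by auto
    then have "\<^bold>\<not>(finst (\<^bold>#k) q) \<in> T" unfolding T_def by blast
    then show False using a T_neg csyms_finst_Var[OF c] by blast
  qed
qed

section \<open>The term model\<close>

lemma T_subst:
  assumes "(\<^bold>#x \<^bold>= \<^bold>#y) \<in> T" "csyms p = {}" "finst (\<^bold>#x) p \<in> T"
  shows "finst (\<^bold>#y) p \<in> T"
  using assms unfolding T_iff_prov by (metis prov.EqE empty_subsetI)

lemma T_refl: "(\<^bold>#x \<^bold>= \<^bold>#x) \<in> T"
  unfolding T_iff_prov by (rule prov.EqI) auto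

lemma T_sym: "(\<^bold>#x \<^bold>= \<^bold>#y) \<in> T \<Longrightarrow> (\<^bold>#y \<^bold>= \<^bold>#x) \<in> T"
  \<comment> \<open>Variable 0 is the slot for Leibniz's rule; the fixed side is written
    \<open>Suc x\<close> because instantiation lowers the other variables by one.\<close>
  using T_subst[of x y "\<^bold>#0 \<^bold>= \<^bold>#(Suc x)"] T_refl[of x] by (simp add: finst_def)

lemma T_trans: "(\<^bold>#x \<^bold>= \<^bold>#y) \<in> T \<Longrightarrow> (\<^bold>#y \<^bold>= \<^bold>#z) \<in> T \<Longrightarrow> (\<^bold>#x \<^bold>= \<^bold>#z) \<in> T"
  using T_subst[of y z "\<^bold>#(Suc x) \<^bold>= \<^bold>#0"] by (simp add: finst_def)

text \<open>Least representatives instead of classes make the domain a set of natural numbers, which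
  \<open>enumerate\<close> can later map onto the whole type.\<close>

definition rep :: "nat \<Rightarrow> nat" where
  "rep x = (LEAST y. (\<^bold>#x \<^bold>= \<^bold>#y) \<in> T)"

lemma T_rep: "(\<^bold>#x \<^bold>= \<^bold>#(rep x)) \<in> T"
  unfolding rep_def using T_refl by (rule LeastI)

lemma rep_eq_iff: "rep x = rep y \<longleftrightarrow> (\<^bold>#x \<^bold>= \<^bold>#y) \<in> T"
proof
  assume "rep x = rep y"
  then show "(\<^bold>#x \<^bold>= \<^bold>#y) \<in> T" using T_rep[of x] T_rep[of y] T_sym T_trans by metis
next
  assume "(\<^bold>#x \<^bold>= \<^bold>#y) \<in> T"
  then have "(\<^bold>#x \<^bold>= \<^bold>#z) \<in> T \<longleftrightarrow> (\<^bold>#y \<^bold>= \<^bold>#z) \<in> T" for z using T_sym T_trans by blast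
  then show "rep x = rep y" unfolding rep_def by simp
qed

definition mem :: "nat \<Rightarrow> nat \<Rightarrow> bool" where
  "mem x y \<longleftrightarrow> (\<^bold>#x \<^bold>\<in> \<^bold>#y) \<in> T"

lemma mem_cong:
  assumes "(\<^bold>#x \<^bold>= \<^bold>#x') \<in> T" "(\<^bold>#y \<^bold>= \<^bold>#y') \<in> T" "mem x y"
  shows "mem x' y'"
proof -
  have "mem x' y"
    using T_subst[OF assms(1), of "\<^bold>#0 \<^bold>\<in> \<^bold>#(Suc y)"] assms(3) by (simp add: finst_def mem_def)
  then show ?thesis
    using T_subst[OF assms(2), of "\<^bold>#(Suc x') \<^bold>\<in> \<^bold>#0"] by (simp add: finst_def mem_def)
qed

lemma mem_rep: "mem (rep x) (rep y) \<longleftrightarrow> (\<^bold>#x \<^bold>\<in> \<^bold>#y) \<in> T"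
  using mem_cong T_rep T_sym mem_def by blast

text \<open>The induction is over all renamings \<sigma>, so that the quantifier case can put a name
  \<open>k\<close> into slot 0.\<close>

lemma truth: "csyms p = {} \<Longrightarrow>
    sat (range rep) mem I (\<lambda>n. rep (\<sigma> n)) p \<longleftrightarrow> fsubst (\<lambda>n. \<^bold>#(\<sigma> n)) p \<in> T"
proof (induction p arbitrary: \<sigma>)
  case Fls
  then show ?case using T_Fls by simp
next
  case (Eq s t)
  then show ?case by (cases s; cases t) (auto simp: rep_eq_iff)
next
  case (Mem s t)
  then show ?case by (cases s; cases t) (auto simp: mem_rep)
next
  case (Imp p q)
  have "csyms (fsubst (\<lambda>n. \<^bold>#(\<sigma> n)) r) = {}" if "csyms r = {}" for r :: "'c fm"
    using csyms_fsubst[of "\<lambda>n. \<^bold>#(\<sigma> n)" "{}" r] that by simp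
  then show ?case using Imp T_imp by simp
next
  case (All p)
  let ?q = "fsubst (case_nat (\<^bold>#0) (\<lambda>n. \<up>(\<^bold>#(\<sigma> n)))) p"
  have q: "csyms ?q = {}"
    using csyms_fsubst[of "case_nat (\<^bold>#0) (\<lambda>n. \<up>(\<^bold>#(\<sigma> n)))" "{}" p] All.prems by (auto split: nat.splits)
  have *: "sat (range rep) mem I (case_nat (rep k) (\<lambda>n. rep (\<sigma> n))) p \<longleftrightarrow> finst (\<^bold>#k) ?q \<in> T" for k
  proof -
    have "case_nat (rep k) (\<lambda>n. rep (\<sigma> n)) = (\<lambda>n. rep (case_nat k \<sigma> n))"
      by (auto split: nat.splits)
    moreover have "finst (\<^bold>#k) ?q = fsubst (\<lambda>n. \<^bold>#(case_nat k \<sigma> n)) p"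
      unfolding finst_def fsubst_fsubst
      by (rule fsubst_cong) (auto simp: tlift_def split: nat.splits)
    ultimately show ?thesis using All.IH[of "case_nat k \<sigma>"] All.prems by simp
  qed
  show ?case using * T_all[OF q] by auto
qed

lemma model: "p \<in> T0 \<Longrightarrow> sat (range rep) mem I e p"
proof -
  assume p: "p \<in> T0"
  then have "fsubst (\<lambda>n. \<^bold>#(id n)) p \<in> T" by (simp add: T_def)
  then have "sat (range rep) mem I (\<lambda>n. rep (id n)) p" using truth csyms_T0[OF p] by blast
  then show ?thesis using sat_cong[of p "\<lambda>n. rep (id n)" e I I] fv_T0[OF p] by auto
qed

end

lemma model_existence:
  fixes T :: "'c::countable fm set"
  assumes "\<not> prov {} T Fls" and "\<And>p. p \<in> T \<Longrightarrow> sentence {} p"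
  obtains D :: "nat set" and E where "D \<noteq> {}" "\<And>p I e. p \<in> T \<Longrightarrow> sat D E I e p"
proof -
  interpret henkin T by unfold_locales (use assms in auto)
  show ?thesis by (rule that[of "range rep" mem]) (use model in auto)
qed

section \<open>Definable classes in a model of ZFC\<close>

text \<open>The connectives other than implication are abbreviations; unfolding their semantics leaves the
  left-hand sides below.\<close>

lemma connectives:
  "((P \<longrightarrow> Q \<longrightarrow> False) \<longrightarrow> False) \<longleftrightarrow> P \<and> Q"
  "((P \<longrightarrow> False) \<longrightarrow> Q) \<longleftrightarrow> P \<or> Q"
  "((\<forall>x. A x \<longrightarrow> False) \<longrightarrow> False) \<longleftrightarrow> (\<exists>x. A x)"
  "((\<forall>x\<in>D. A x \<longrightarrow> False) \<longrightarrow> False) \<longleftrightarrow> (\<exists>x\<in>D. A x)"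
  "(P \<longrightarrow> Q) \<and> (Q \<longrightarrow> P) \<longleftrightarrow> (P \<longleftrightarrow> Q)"
  by blast+

text \<open>Schema instances arrive as universal closures; this recovers the matrix under every
  valuation, that is, for every choice of parameters.\<close>

lemma sat_All_pow: "(\<And>e. sat UNIV E I e ((All ^^ n) p)) \<Longrightarrow> sat UNIV E I e p"
proof (induction n arbitrary: e)
  case (Suc n)
  have "sat UNIV E I e ((All ^^ n) p)" for e
  proof -
    have "sat UNIV E I (case_nat (e 0) (\<lambda>n. e (Suc n))) ((All ^^ n) p)"
      using Suc.prems[of "\<lambda>n. e (Suc n)"] by simp
    moreover have "case_nat (e 0) (\<lambda>n. e (Suc n)) = e" by (auto split: nat.splits)
    ultimately show ?thesis by simp
  qed
  then show ?case by (rule Suc.IH)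
qed simp

lemma fv_All_pow: "fv ((All ^^ n) p) = {k. k + n \<in> fv p}"
  by (induction n) auto

lemma closures_nonempty: "\<exists>n. (All ^^ n) p \<in> closures p"
proof -
  obtain m where "\<forall>k\<in>fv p. k < m" using finite_nat_set_iff_bounded finite_fv by blast
  then have "fv ((All ^^ m) p) = {}" by (auto simp: fv_All_pow)
  then show ?thesis unfolding closures_def by auto
qed

primrec ttr :: "('c \<Rightarrow> nat) \<Rightarrow> 'c trm \<Rightarrow> 'd trm" where
  "ttr g (\<^bold>#n) = \<^bold>#n"
| "ttr g (Cst c) = \<^bold>#(g c)"

text \<open>Below a quantifier the indices standing for constants rise by one. On a formula without
  constants the translation merely changes the type of constant symbols.\<close>

primrec ftr :: "('c \<Rightarrow> nat) \<Rightarrow> 'c fm \<Rightarrow> 'd fm" where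
  "ftr g Fls = Fls"
| "ftr g (s \<^bold>= t) = (ttr g s \<^bold>= ttr g t)"
| "ftr g (s \<^bold>\<in> t) = (ttr g s \<^bold>\<in> ttr g t)"
| "ftr g (p \<^bold>\<longrightarrow> q) = (ftr g p \<^bold>\<longrightarrow> ftr g q)"
| "ftr g (\<^bold>\<forall>p) = (\<^bold>\<forall>ftr (\<lambda>c. Suc (g c)) p)"

lemma csyms_ftr: "csyms (ftr g p :: 'b fm) = {}" for g :: "'a \<Rightarrow> nat"
proof -
  have "tcsyms (ttr g t :: 'b trm) = {}" for g :: "'a \<Rightarrow> nat" and t by (cases t) auto
  then show ?thesis by (induction p arbitrary: g) auto
qed

lemma tval_ttr: "(\<And>c. c \<in> tcsyms t \<Longrightarrow> e (g c) = I c) \<Longrightarrow> tval I' e (ttr g t) = tval I e t"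
  by (cases t) auto

lemma sat_ftr: "(\<And>c. c \<in> csyms p \<Longrightarrow> e (g c) = I c) \<Longrightarrow> sat D E I' e (ftr g p) = sat D E I e p"
proof (induction p arbitrary: e g)
  case (Eq s t)
  then have "tval I' e (ttr g s) = tval I e s" "tval I' e (ttr g t) = tval I e t"
    by (auto intro!: tval_ttr)
  then show ?case by simp
next
  case (Mem s t)
  then have "tval I' e (ttr g s) = tval I e s" "tval I' e (ttr g t) = tval I e t"
    by (auto intro!: tval_ttr)
  then show ?case by simp
next
  case (Imp p q)
  have "sat D E I' e (ftr g p) = sat D E I e p" "sat D E I' e (ftr g q) = sat D E I e q"
    by (rule Imp.IH; simp add: Imp.prems)+
  then show ?case by simp
next
  case (All p)
  have "sat D E I' (case_nat x e) (ftr (\<lambda>c. Suc (g c)) p) = sat D E I (case_nat x e) p" for x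
    by (rule All.IH) (simp add: All.prems)
  then show ?case by simp
qed simp

lemma finite_csyms: "finite (csyms p)"
proof -
  have "finite (tcsyms t)" for t :: "'a trm" by (cases t) auto
  then show ?thesis by (induction p) auto
qed

text \<open>Constants of a formula can be turned into parameters numbered above its free variables.\<close>

lemma constants_to_variables:
  fixes p :: "'a fm"
  shows "\<exists>(q :: 'c fm) m r. csyms q = {} \<and> 3 \<le> m \<and>
    (\<forall>D E (I :: 'a \<Rightarrow> 'b) I' e e'. (\<forall>n<m. e' n = e n) \<longrightarrow> (\<forall>n\<ge>m. e' n = I (r n)) \<longrightarrow>
       sat D E I' e' q = sat D E I e p)"
proof -
  obtain m' where "\<forall>k\<in>fv p. k < m'" using finite_nat_set_iff_bounded finite_fv by blast
  \<comment> \<open>The bound 3 leaves room for the variables 0, 1 and 2 that the schema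
    \<open>Replacement\<close> reserves for x, y and a.\<close>
  define m where "m = max 3 m'"
  have m: "3 \<le> m" "\<forall>k\<in>fv p. k < m" using \<open>\<forall>k\<in>fv p. k < m'\<close> by (auto simp: m_def)
  obtain f :: "'a \<Rightarrow> nat" where f: "inj_on f (csyms p)"
    using finite_imp_inj_to_nat_seg[OF finite_csyms] by metis
  let ?q = "ftr (\<lambda>c. m + f c) p :: 'c fm"
  let ?r = "\<lambda>n. inv_into (csyms p) f (n - m)"
  have "sat D E I' e' ?q = sat D E I e p"
    if e: "\<forall>n<m. e' n = e n" "\<forall>n\<ge>m. e' n = I (?r n)" for D E and I :: "'a \<Rightarrow> 'b" and I' e e'
  proof -
    have "sat D E I' e' ?q = sat D E I e' p"
      by (rule sat_ftr) (use e f in auto)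
    also have "\<dots> = sat D E I e p" by (rule sat_cong) (use m e in auto)
    finally show ?thesis .
  qed
  then show ?thesis using m(1) csyms_ftr[of "\<lambda>c. m + f c" p]
    by (intro exI[of _ ?q] exI[of _ m] exI[of _ ?r]) (simp del: ftr.simps)
qed

locale zfc =
  fixes E :: "'a \<Rightarrow> 'a \<Rightarrow> bool" (infix \<open>\<epsilon>\<close> 50)
  assumes ZFC: "p \<in> (ZFC :: csym fm set) \<Longrightarrow> sat UNIV (\<epsilon>) I e p"
begin

text \<open>Parameters are handled by formulas in which every element of the model is a constant that names
  itself. The function \<open>e\<close> assigns values to the variables.\<close>

definition df :: "((nat \<Rightarrow> 'a) \<Rightarrow> bool) \<Rightarrow> bool" where
  "df P \<longleftrightarrow> (\<exists>p. \<forall>e. P e = sat UNIV (\<epsilon>) id e p)"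

definition dff :: "((nat \<Rightarrow> 'a) \<Rightarrow> 'a) \<Rightarrow> bool" where
  "dff f \<longleftrightarrow> df (\<lambda>e. e 0 = f (\<lambda>n. e (Suc n)))"

lemma df_imp: "df P \<Longrightarrow> df Q \<Longrightarrow> df (\<lambda>e. P e \<longrightarrow> Q e)"
  unfolding df_def
proof (elim exE)
  fix p q assume "\<forall>e. P e = sat UNIV (\<epsilon>) id e p" "\<forall>e. Q e = sat UNIV (\<epsilon>) id e q"
  then show "\<exists>r. \<forall>e. (P e \<longrightarrow> Q e) = sat UNIV (\<epsilon>) id e r" by (intro exI[of _ "p \<^bold>\<longrightarrow> q"]) simp
qed

lemma df_const: "df (\<lambda>e. B)"
  unfolding df_def by (intro exI[of _ "if B then Fls \<^bold>\<longrightarrow> Fls else Fls"]) auto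

lemma df_not: "df P \<Longrightarrow> df (\<lambda>e. \<not> P e)"
  using df_imp[OF _ df_const[of False]] by simp

lemma df_disj: "df P \<Longrightarrow> df Q \<Longrightarrow> df (\<lambda>e. P e \<or> Q e)"
  using df_imp[OF df_not] by (simp add: disj_imp)

lemma df_conj: "df P \<Longrightarrow> df Q \<Longrightarrow> df (\<lambda>e. P e \<and> Q e)"
  using df_not[OF df_imp[OF _ df_not]] by simp

lemma df_iff: "df P \<Longrightarrow> df Q \<Longrightarrow> df (\<lambda>e. P e \<longleftrightarrow> Q e)"
  using df_conj[OF df_imp df_imp] by (simp add: iff_conv_conj_imp)

text \<open>\<open>Q\<close> is a higher-order pattern in the conclusion, so resolution reads it off
  the goal; the premise is the body with the bound variable turned into variable 0. Rules of this
  form make \<open>intro dfs\<close> follow the syntax.\<close>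

lemma df_all:
  assumes "df (\<lambda>e. Q (\<lambda>n. e (Suc n)) (e 0))"
  shows "df (\<lambda>e. \<forall>x. Q e x)"
proof -
  obtain p where p: "\<And>e. Q (\<lambda>n. e (Suc n)) (e 0) = sat UNIV (\<epsilon>) id e p"
    using assms unfolding df_def by blast
  have "(\<forall>x. Q e x) = sat UNIV (\<epsilon>) id e (\<^bold>\<forall>p)" for e
    using p[of "case_nat _ e"] by simp
  then show ?thesis unfolding df_def by blast
qed

lemma df_ex: "df (\<lambda>e. Q (\<lambda>n. e (Suc n)) (e 0)) \<Longrightarrow> df (\<lambda>e. \<exists>x. Q e x)"
  using df_not[OF df_all[of "\<lambda>e x. \<not> Q e x"]] df_not by simp

lemma df_Var_eq: "df (\<lambda>e. e i = e j)"
  unfolding df_def by (intro exI[of _ "\<^bold>#i \<^bold>= \<^bold>#j"]) simp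

lemma df_Var_mem: "df (\<lambda>e. e i \<epsilon> e j)"
  unfolding df_def by (intro exI[of _ "\<^bold>#i \<^bold>\<in> \<^bold>#j"]) simp

lemma df_rename: "df P \<Longrightarrow> df (\<lambda>e. P (\<lambda>n. e (r n)))"
  unfolding df_def
proof (elim exE)
  fix p assume "\<forall>e. P e = sat UNIV (\<epsilon>) id e p"
  then show "\<exists>q. \<forall>e. P (\<lambda>n. e (r n)) = sat UNIV (\<epsilon>) id e q"
    by (intro exI[of _ "fsubst (\<lambda>n. \<^bold>#(r n)) p"]) (simp add: sat_fsubst)
qed

lemma dff_Var: "dff (\<lambda>e. e i)"
  unfolding dff_def by (rule df_Var_eq)

lemma dff_const: "dff (\<lambda>e. c)"
  unfolding dff_def df_def by (intro exI[of _ "\<^bold>#0 \<^bold>= Cst c"]) simp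

lemma dff_shift: "dff f \<Longrightarrow> dff (\<lambda>e. f (\<lambda>n. e (Suc n)))"
  unfolding dff_def using df_rename[of _ "case_nat 0 (\<lambda>n. Suc (Suc n))"] by fastforce

text \<open>A definable function has no term in the language, so its value is introduced by an
  existential quantifier over its graph.\<close>

lemma df_let:
  assumes "dff f" "df (\<lambda>e. Q (\<lambda>n. e (Suc n)) (e 0))"
  shows "df (\<lambda>e. Q e (f e))"
proof -
  have "df (\<lambda>e. \<exists>x. x = f e \<and> Q e x)"
    by (rule df_ex) (rule df_conj[OF assms(1)[unfolded dff_def] assms(2)])
  then show ?thesis by simp
qed

lemma df_eq: "dff f \<Longrightarrow> dff g \<Longrightarrow> df (\<lambda>e. f e = g e)"
proof -
  assume f: "dff f" and g: "dff g"
  have "df (\<lambda>e. e 0 = g (\<lambda>n. e (Suc n)))" using g by (simp add: dff_def)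
  then show ?thesis by (rule df_let[OF f, of "\<lambda>e x. x = g e"])
qed

lemma df_mem: "dff f \<Longrightarrow> dff g \<Longrightarrow> df (\<lambda>e. f e \<epsilon> g e)"
proof -
  assume f: "dff f" and g: "dff g"
  have "df (\<lambda>e. e 0 \<epsilon> g (\<lambda>n. e (Suc n)))"
    by (rule df_let[OF dff_shift[OF g], of "\<lambda>e y. e 0 \<epsilon> y"]) (rule df_Var_mem)
  then show ?thesis by (rule df_let[OF f, of "\<lambda>e x. x \<epsilon> g e"])
qed

lemma dff_if: "df P \<Longrightarrow> dff f \<Longrightarrow> dff g \<Longrightarrow> dff (\<lambda>e. if P e then f e else g e)"
proof -
  assume a: "df P" "dff f" "dff g"
  have "df (\<lambda>e. (P (\<lambda>n. e (Suc n)) \<and> e 0 = f (\<lambda>n. e (Suc n))) \<or>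
                (\<not> P (\<lambda>n. e (Suc n)) \<and> e 0 = g (\<lambda>n. e (Suc n))))"
    by (rule df_disj[OF df_conj[OF df_rename[OF a(1)] a(2)[unfolded dff_def]]
        df_conj[OF df_not[OF df_rename[OF a(1)]] a(3)[unfolded dff_def]]])
  then show ?thesis unfolding dff_def by (rule back_subst[of df]) (auto simp: fun_eq_iff)
qed

text \<open>Recursion on a fixed formula in the metatheory; no definition of truth uniform in
  \<open>p\<close> is involved. It amounts to substituting definable functions for
  variables.\<close>

lemma df_sat:
  assumes "\<And>n. dff (\<sigma> n)"
  shows "df (\<lambda>e. sat UNIV (\<epsilon>) id (\<lambda>n. \<sigma> n e) p)"
  using assms
proof (induction p arbitrary: \<sigma>)
  case Fls
  show ?case using df_const[of False] by simp
next
  case (Eq s t)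
  have "dff (\<lambda>e. tval id (\<lambda>n. \<sigma> n e) u)" for u
    by (cases u) (use Eq dff_const in simp_all)
  then show ?case by (simp only: sat.simps) (rule df_eq)
next
  case (Mem s t)
  have "dff (\<lambda>e. tval id (\<lambda>n. \<sigma> n e) u)" for u
    by (cases u) (use Mem dff_const in simp_all)
  then show ?case by (simp only: sat.simps) (rule df_mem)
next
  case (Imp p q)
  then show ?case by (simp only: sat.simps) (intro df_imp; blast)
next
  case (All p)
  let ?t = "case_nat (\<lambda>e. e 0) (\<lambda>n e. \<sigma> n (\<lambda>n. e (Suc n)))"
  have t: "(\<lambda>n. ?t n e) = case_nat (e 0) (\<lambda>n. \<sigma> n (\<lambda>n. e (Suc n)))" for e
    by (auto split: nat.splits)
  have "df (\<lambda>e. sat UNIV (\<epsilon>) id (\<lambda>n. ?t n e) p)"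
    by (rule All.IH) (use All.prems dff_Var dff_shift in \<open>auto split: nat.splits\<close>)
  then show ?case unfolding t
    by (simp add: id_def) (rule df_all[where Q = "\<lambda>e x. sat UNIV (\<epsilon>) id (case_nat x (\<lambda>n. \<sigma> n e)) p", simplified id_def])
qed

lemma df_subst:
  assumes "df P" "\<And>n. dff (\<sigma> n)"
  shows "df (\<lambda>e. P (\<lambda>n. \<sigma> n e))"
proof -
  obtain p where "P = (\<lambda>e. sat UNIV (\<epsilon>) id e p)" using assms(1) unfolding df_def by auto
  then show ?thesis using df_sat[OF assms(2)] by simp
qed

lemma dff_subst:
  assumes "dff f" "\<And>n. dff (\<sigma> n)"
  shows "dff (\<lambda>e. f (\<lambda>n. \<sigma> n e))"
proof -
  let ?t = "case_nat (\<lambda>e. e 0) (\<lambda>n e. \<sigma> n (\<lambda>n. e (Suc n)))"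
  have t: "dff (?t n)" for n
    using assms(2) dff_Var dff_shift by (auto split: nat.splits)
  show ?thesis
    using df_subst[of _ ?t, OF assms(1)[unfolded dff_def] t] by (simp add: dff_def)
qed

text \<open>Definability with parameters of relations (\<open>R\<close>) and functions (\<open>F\<close>) by number of arguments.\<close>

definition R1 :: "('a \<Rightarrow> bool) \<Rightarrow> bool" where "R1 P \<longleftrightarrow> df (\<lambda>e. P (e 0))"
definition R2 :: "('a \<Rightarrow> 'a \<Rightarrow> bool) \<Rightarrow> bool" where "R2 P \<longleftrightarrow> df (\<lambda>e. P (e 0) (e (Suc 0)))"
definition R3 :: "('a \<Rightarrow> 'a \<Rightarrow> 'a \<Rightarrow> bool) \<Rightarrow> bool" where
  "R3 P \<longleftrightarrow> df (\<lambda>e. P (e 0) (e (Suc 0)) (e (Suc (Suc 0))))"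
definition F1 :: "('a \<Rightarrow> 'a) \<Rightarrow> bool" where "F1 G \<longleftrightarrow> dff (\<lambda>e. G (e 0))"
definition F2 :: "('a \<Rightarrow> 'a \<Rightarrow> 'a) \<Rightarrow> bool" where "F2 G \<longleftrightarrow> dff (\<lambda>e. G (e 0) (e (Suc 0)))"
definition F3 :: "('a \<Rightarrow> 'a \<Rightarrow> 'a \<Rightarrow> 'a) \<Rightarrow> bool" where
  "F3 G \<longleftrightarrow> dff (\<lambda>e. G (e 0) (e (Suc 0)) (e (Suc (Suc 0))))"

text \<open>Substitution into a predicate of valuations needs a function for every index; all
  indices from 2 on receive \<open>h\<close>.\<close>

lemma three_args:
  assumes "dff f" "dff g" "dff h"
  shows "dff (case_nat f (case_nat g (\<lambda>_. h)) n)"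
  using assms by (auto split: nat.splits)

lemma R3_app: "R3 P \<Longrightarrow> dff f \<Longrightarrow> dff g \<Longrightarrow> dff h \<Longrightarrow> df (\<lambda>e. P (f e) (g e) (h e))"
  unfolding R3_def by (drule df_subst[where \<sigma> = "case_nat f (case_nat g (\<lambda>_. h))", OF _ three_args]) simp_all
lemma F3_app: "F3 P \<Longrightarrow> dff f \<Longrightarrow> dff g \<Longrightarrow> dff h \<Longrightarrow> dff (\<lambda>e. P (f e) (g e) (h e))"
  unfolding F3_def by (drule dff_subst[where \<sigma> = "case_nat f (case_nat g (\<lambda>_. h))", OF _ three_args]) simp_all
lemma R2_app: "R2 P \<Longrightarrow> dff f \<Longrightarrow> dff g \<Longrightarrow> df (\<lambda>e. P (f e) (g e))"
  unfolding R2_def by (drule df_subst[where \<sigma> = "case_nat f (case_nat g (\<lambda>_. g))", OF _ three_args]) simp_all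
lemma F2_app: "F2 P \<Longrightarrow> dff f \<Longrightarrow> dff g \<Longrightarrow> dff (\<lambda>e. P (f e) (g e))"
  unfolding F2_def by (drule dff_subst[where \<sigma> = "case_nat f (case_nat g (\<lambda>_. g))", OF _ three_args]) simp_all
lemma R1_app: "R1 P \<Longrightarrow> dff f \<Longrightarrow> df (\<lambda>e. P (f e))"
  unfolding R1_def by (drule df_subst[where \<sigma> = "case_nat f (case_nat f (\<lambda>_. f))", OF _ three_args]) simp_all
lemma F1_app: "F1 P \<Longrightarrow> dff f \<Longrightarrow> dff (\<lambda>e. P (f e))"
  unfolding F1_def by (drule dff_subst[where \<sigma> = "case_nat f (case_nat f (\<lambda>_. f))", OF _ three_args]) simp_all

named_theorems dfs

lemmas [dfs] = df_imp df_const df_not df_disj df_conj df_iff df_all df_ex df_eq df_mem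
  dff_Var dff_const dff_if

text \<open>The value of \<open>code\<close> is the same junk element for all proper classes; hence \<open>dff_code\<close> needs no
  side condition that the class is a set.\<close>

definition code :: "'a set \<Rightarrow> 'a" where
  "code X = (if \<exists>a. \<forall>x. x \<epsilon> a \<longleftrightarrow> x \<in> X then SOME a. \<forall>x. x \<epsilon> a \<longleftrightarrow> x \<in> X else undefined)"

definition is_set :: "'a set \<Rightarrow> bool" where
  "is_set X \<longleftrightarrow> (\<exists>a. \<forall>x. x \<epsilon> a \<longleftrightarrow> x \<in> X)"

lemma Ext: "(\<And>x. x \<epsilon> a \<longleftrightarrow> x \<epsilon> b) \<Longrightarrow> a = b"
proof -
  have "sat UNIV (\<epsilon>) undefined undefined (Extensionality :: csym fm)" by (rule ZFC) (simp add: ZFC_def)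
  then show "(\<And>x. x \<epsilon> a \<longleftrightarrow> x \<epsilon> b) \<Longrightarrow> a = b"
    by (auto simp: Extensionality_def eval_nat_numeral)
qed

lemma mem_code: "is_set X \<Longrightarrow> x \<epsilon> code X \<longleftrightarrow> x \<in> X"
proof -
  assume X: "is_set X"
  then have "\<forall>x. x \<epsilon> (SOME a. \<forall>x. x \<epsilon> a \<longleftrightarrow> x \<in> X) \<longleftrightarrow> x \<in> X"
    unfolding is_set_def by (rule someI_ex)
  then show ?thesis using X unfolding is_set_def code_def by simp
qed

lemma code_eqI:
  assumes "\<And>x. x \<epsilon> a \<longleftrightarrow> x \<in> X"
  shows "code X = a"
proof (rule Ext)
  have "is_set X" using assms unfolding is_set_def by blast
  then show "x \<epsilon> code X \<longleftrightarrow> x \<epsilon> a" for x using assms by (simp add: mem_code)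
qed

lemma dff_code [dfs]:
  assumes "df (\<lambda>e. P (\<lambda>n. e (Suc n)) (e 0))"
  shows "dff (\<lambda>e. code {x. P e x})"
proof -
  have 1: "y = code {x. P e x} \<longleftrightarrow> (\<forall>x. x \<epsilon> y \<longleftrightarrow> P e x) \<or> \<not> (\<exists>y. \<forall>x. x \<epsilon> y \<longleftrightarrow> P e x) \<and> y = undefined" for e y
  proof (cases "\<exists>y. \<forall>x. x \<epsilon> y \<longleftrightarrow> P e x")
    case True
    then have "is_set {x. P e x}" by (auto simp: is_set_def)
    then show ?thesis using True mem_code[of "{x. P e x}"] code_eqI[of y "{x. P e x}"] by auto
  next
    case False
    then show ?thesis by (auto simp: code_def)
  qed
  have P2: "df (\<lambda>e. P (\<lambda>n. e (Suc (Suc n))) (e 0))"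
    using df_rename[OF assms, of "case_nat 0 (\<lambda>n. Suc (Suc n))"] by simp
  have P3: "df (\<lambda>e. P (\<lambda>n. e (Suc (Suc (Suc n)))) (e 0))"
    using df_rename[OF assms, of "case_nat 0 (\<lambda>n. Suc (Suc (Suc n)))"] by simp
  show ?thesis
    unfolding dff_def 1 by (intro P2 P3 dfs)
qed

text \<open>The bridge from \<open>df\<close> to the schemas, which admit only formulas without
  constants: parameters become the values \<open>f n\<close> of a valuation from index
  \<open>m\<close> on, clear of the reserved variables.\<close>

lemma formula_with_parameters:
  assumes "df P"
  shows "\<exists>(q :: csym fm) m f. csyms q = {} \<and> 3 \<le> m \<and>
    (\<forall>e I. (\<forall>n\<ge>m. e n = f n) \<longrightarrow> sat UNIV (\<epsilon>) I e q = P e)"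
proof -
  obtain p where p: "\<And>e. P e = sat UNIV (\<epsilon>) id e p" using assms unfolding df_def by blast
  obtain q :: "csym fm" and m r where q: "csyms q = {}" "3 \<le> m"
    and sat: "\<forall>D E (I :: 'a \<Rightarrow> 'a) I' e e'. (\<forall>n<m. e' n = e n) \<longrightarrow> (\<forall>n\<ge>m. e' n = I (r n)) \<longrightarrow>
       sat D E I' e' q = sat D E I e p"
    using constants_to_variables[of p, where ?'b = 'a and ?'c = csym] by (elim exE conjE) (rule that)
  have "sat UNIV (\<epsilon>) I e q = P e" if "\<forall>n\<ge>m. e n = r n" for e I
    unfolding p by (rule sat[rule_format]) (use that in auto)
  then show ?thesis using q by blast
qed

section \<open>The axiom schemas for definable classes\<close>

lemma separation:
  assumes "R1 P"
  shows "is_set {x. x \<epsilon> a \<and> P x}"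
proof -
  obtain q :: "csym fm" and f :: "nat \<Rightarrow> 'a" and m where q: "csyms q = {}" "3 \<le> m"
    "\<forall>e I. (\<forall>n\<ge>m. e n = f n) \<longrightarrow> sat UNIV (\<epsilon>) I e q = P (e 0)"
    using formula_with_parameters[OF assms[unfolded R1_def]] by blast
  obtain n where n: "(All ^^ n) (Separation q) \<in> closures (Separation q)" using closures_nonempty by blast
  have ax: "sat UNIV (\<epsilon>) undefined e (Separation q)" for e
    by (rule sat_All_pow[of _ _ n]) (rule ZFC, use n q in \<open>auto simp: ZFC_def\<close>)
  \<comment> \<open>Under the binders of x, b and a, variable k of \<open>q\<close> with k \<ge> 2
    is read at position k + 1, hence has the value \<open>?f (k - 2)\<close>, which is
    \<open>f k\<close>.\<close>
  let ?f = "\<lambda>n. f (n + 2)"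
  have P: "sat UNIV (\<epsilon>) undefined
      (\<lambda>n. tval undefined (case_nat x (case_nat b (case_nat a ?f))) (case_nat (\<^bold>#0) (\<lambda>n. \<^bold>#(n + 2)) n)) q = P x" for x b
    by (subst q(3)[rule_format]) (use q(2) in \<open>auto simp: eval_nat_numeral split: nat.splits\<close>)
  have "\<exists>b. \<forall>x. x \<epsilon> b \<longleftrightarrow> x \<epsilon> a \<and> P x"
    using bspec[OF ax[of ?f, unfolded Separation_def sat.simps sat_fsubst], of a]
    unfolding P by (simp add: eval_nat_numeral) (erule exE, rule exI, blast)
  then show ?thesis by (simp add: is_set_def)
qed

lemma replacement_rel:
  assumes "R2 R" and single: "\<And>x y z. R x y \<Longrightarrow> R x z \<Longrightarrow> y = z"
  shows "is_set {y. \<exists>x. x \<epsilon> a \<and> R x y}"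
proof -
  obtain q :: "csym fm" and f :: "nat \<Rightarrow> 'a" and m where q: "csyms q = {}" "3 \<le> m"
    "\<forall>e I. (\<forall>n\<ge>m. e n = f n) \<longrightarrow> sat UNIV (\<epsilon>) I e q = R (e 0) (e (Suc 0))"
    using formula_with_parameters[OF assms(1)[unfolded R2_def]] by blast
  obtain n where n: "(All ^^ n) (Replacement q) \<in> closures (Replacement q)" using closures_nonempty by blast
  have ax: "sat UNIV (\<epsilon>) undefined e (Replacement q)" for e
    by (rule sat_All_pow[of _ _ n]) (rule ZFC, use n q in \<open>auto simp: ZFC_def\<close>)
  let ?f = "\<lambda>n. f (n + 3)"
  \<comment> \<open>Every occurrence of \<open>q\<close> in the axiom lies under three quantifiers
    inside that of a, so one evaluation rule serves all; they differ only in the indices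
    \<open>i\<close> and \<open>j\<close>.\<close>
  have P: "sat UNIV (\<epsilon>) undefined (\<lambda>n. tval undefined (case_nat x0 (case_nat x1 (case_nat x2 (case_nat a ?f))))
        (case_nat (\<^bold>#i) (case_nat (\<^bold>#j) (\<lambda>n. \<^bold>#(n + 3))) n)) q =
      R (case_nat x0 (case_nat x1 (case_nat x2 (case_nat a ?f))) i)
        (case_nat x0 (case_nat x1 (case_nat x2 (case_nat a ?f))) j)" for x0 x1 x2 i j
    by (subst q(3)[rule_format]) (use q(2) in \<open>auto simp: eval_nat_numeral split: nat.splits\<close>)
  have "\<exists>b. \<forall>y. y \<epsilon> b \<longleftrightarrow> (\<exists>x. x \<epsilon> a \<and> R x y)"
    using ax[of ?f] single unfolding Replacement_def sat.simps sat_fsubst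
    by (drule_tac bspec[of _ _ a], simp, unfold P, simp add: eval_nat_numeral)
      (drule mp, blast, erule exE, rule exI, blast)
  then show ?thesis by (simp add: is_set_def)
qed

section \<open>Set theory inside the model\<close>

lemma replacement:
  assumes "F1 F"
  shows "is_set {y. \<exists>x. x \<epsilon> a \<and> y = F x}"
  by (rule replacement_rel[of "\<lambda>x y. y = F x"], unfold R2_def, intro dfs F1_app[OF assms]) auto

lemma is_set_mem: "is_set {x. x \<epsilon> a}"
  by (auto simp: is_set_def)

lemma is_set_subset:
  assumes "is_set Y" "R1 P" "\<And>x. P x \<Longrightarrow> x \<in> Y"
  shows "is_set {x. P x}"
proof -
  have "{x. P x} = {x. x \<epsilon> code Y \<and> P x}" using assms by (auto simp: mem_code)
  then show ?thesis using separation[OF assms(2)] by simp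
qed

definition upair :: "'a \<Rightarrow> 'a \<Rightarrow> 'a" where "upair a b = code {x. x = a \<or> x = b}"
definition bigcup :: "'a \<Rightarrow> 'a" where "bigcup a = code {x. \<exists>y. y \<epsilon> a \<and> x \<epsilon> y}"
definition sub :: "'a \<Rightarrow> 'a \<Rightarrow> bool" (infix \<open>\<sqsubseteq>\<close> 50) where "a \<sqsubseteq> b \<longleftrightarrow> (\<forall>x. x \<epsilon> a \<longrightarrow> x \<epsilon> b)"
definition power :: "'a \<Rightarrow> 'a" where "power a = code {x. x \<sqsubseteq> a}"
definition null :: "'a" where "null = code {x. False}"
definition cup :: "'a \<Rightarrow> 'a \<Rightarrow> 'a" where "cup a b = bigcup (upair a b)"
definition succ :: "'a \<Rightarrow> 'a" where "succ a = cup a (upair a a)"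
definition pair :: "'a \<Rightarrow> 'a \<Rightarrow> 'a" where "pair a b = upair (upair a a) (upair a b)"
text \<open>Described through the members of the value, so that \<open>dff_code\<close> yields
  definability without a description operator. \<open>recur\<close>, \<open>nrec_step\<close> and
  the choice functions below use the same device.\<close>

definition first :: "'a \<Rightarrow> 'a" where "first p = code {z. \<exists>x y. p = pair x y \<and> z \<epsilon> x}"
definition second :: "'a \<Rightarrow> 'a" where "second p = code {z. \<exists>x y. p = pair x y \<and> z \<epsilon> y}"

lemma F2_upair: "F2 upair" unfolding F2_def upair_def by (intro dfs)
lemmas [dfs] = F2_app[OF F2_upair]
lemma F1_bigcup: "F1 bigcup" unfolding F1_def bigcup_def by (intro dfs)
lemmas [dfs] = F1_app[OF F1_bigcup]
lemma R2_sub: "R2 (\<sqsubseteq>)" unfolding R2_def sub_def by (intro dfs)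
lemmas [dfs] = R2_app[OF R2_sub]
lemma F1_power: "F1 power" unfolding F1_def power_def by (intro dfs)
lemmas [dfs] = F1_app[OF F1_power]
lemma F2_cup: "F2 cup" unfolding F2_def cup_def by (intro dfs)
lemmas [dfs] = F2_app[OF F2_cup]
lemma F1_succ: "F1 succ" unfolding F1_def succ_def by (intro dfs)
lemmas [dfs] = F1_app[OF F1_succ]
lemma F2_pair: "F2 pair" unfolding F2_def pair_def by (intro dfs)
lemmas [dfs] = F2_app[OF F2_pair]
lemma F1_first: "F1 first" unfolding F1_def first_def by (intro dfs)
lemmas [dfs] = F1_app[OF F1_first]
lemma F1_second: "F1 second" unfolding F1_def second_def by (intro dfs)
lemmas [dfs] = F1_app[OF F1_second]

lemma mem_upair [simp]: "x \<epsilon> upair a b \<longleftrightarrow> x = a \<or> x = b"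
proof -
  have "sat UNIV (\<epsilon>) undefined undefined (Pairing :: csym fm)" by (rule ZFC) (simp add: ZFC_def)
  then have "is_set {x. x = a \<or> x = b}"
    by (simp add: Pairing_def upair_fm_def is_set_def eval_nat_numeral)
      (drule spec[of _ a], drule spec[of _ b], erule exE, rule exI, blast)
  then show ?thesis by (simp add: upair_def mem_code)
qed

lemma mem_bigcup [simp]: "x \<epsilon> bigcup a \<longleftrightarrow> (\<exists>y. y \<epsilon> a \<and> x \<epsilon> y)"
proof -
  have "sat UNIV (\<epsilon>) undefined undefined (Union_ax :: csym fm)" by (rule ZFC) (simp add: ZFC_def)
  then have "is_set {x. \<exists>y. y \<epsilon> a \<and> x \<epsilon> y}"
    by (simp add: Union_ax_def is_set_def eval_nat_numeral) (drule spec[of _ a], erule exE, rule exI, blast)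
  then show ?thesis by (simp add: bigcup_def mem_code)
qed

lemma sat_subset_fm: "sat UNIV (\<epsilon>) I e (subset_fm s t) \<longleftrightarrow> tval I e s \<sqsubseteq> tval I e t"
  by (simp add: subset_fm_def sub_def)

lemma mem_power [simp]: "x \<epsilon> power a \<longleftrightarrow> x \<sqsubseteq> a"
proof -
  have "sat UNIV (\<epsilon>) undefined undefined (Power_set :: csym fm)" by (rule ZFC) (simp add: ZFC_def)
  then have "is_set {x. x \<sqsubseteq> a}"
    by (simp add: Power_set_def sat_subset_fm is_set_def eval_nat_numeral) blast
  then show ?thesis by (simp add: power_def mem_code)
qed

lemma not_mem_null [simp]: "\<not> x \<epsilon> null"
proof -
  have "is_set {x. x \<epsilon> undefined \<and> False}" by (rule separation) (simp add: R1_def df_const)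
  then show ?thesis by (simp add: null_def mem_code)
qed

lemma eq_null_iff: "a = null \<longleftrightarrow> (\<forall>x. \<not> x \<epsilon> a)"
  using Ext[of a null] by auto

lemma mem_cup [simp]: "x \<epsilon> cup a b \<longleftrightarrow> x \<epsilon> a \<or> x \<epsilon> b"
  by (auto simp: cup_def)

lemma mem_succ [simp]: "x \<epsilon> succ a \<longleftrightarrow> x \<epsilon> a \<or> x = a"
  by (auto simp: succ_def)

lemma upair_eq_iff: "upair a b = upair c d \<longleftrightarrow> a = c \<and> b = d \<or> a = d \<and> b = c"
proof
  assume "upair a b = upair c d"
  then have "x = a \<or> x = b \<longleftrightarrow> x = c \<or> x = d" for x using mem_upair by metis
  then show "a = c \<and> b = d \<or> a = d \<and> b = c" by metis
next
  show "a = c \<and> b = d \<or> a = d \<and> b = c \<Longrightarrow> upair a b = upair c d" by (rule Ext) auto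
qed

lemma pair_eq_iff [simp]: "pair a b = pair c d \<longleftrightarrow> a = c \<and> b = d"
  unfolding pair_def upair_eq_iff by auto

lemma first_pair [simp]: "first (pair a b) = a"
  unfolding first_def by (rule code_eqI) auto

lemma second_pair [simp]: "second (pair a b) = b"
  unfolding second_def by (rule code_eqI) auto

lemma pair_ne_null [simp]: "pair a b \<noteq> null" "null \<noteq> pair a b"
  using mem_upair[of "upair a a" "upair a a" "upair a b"] not_mem_null unfolding pair_def by metis+

lemma succ_ne_null [simp]: "succ a \<noteq> null" "null \<noteq> succ a"
  using mem_succ[of a a] not_mem_null by metis+

lemma sub_refl [simp]: "a \<sqsubseteq> a" and sub_trans: "a \<sqsubseteq> b \<Longrightarrow> b \<sqsubseteq> c \<Longrightarrow> a \<sqsubseteq> c"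
  and sub_mem: "a \<sqsubseteq> b \<Longrightarrow> x \<epsilon> a \<Longrightarrow> x \<epsilon> b"
  by (auto simp: sub_def)

lemma foundation:
  assumes "R1 P" "x \<epsilon> a" "P x"
  shows "\<exists>m. m \<epsilon> a \<and> P m \<and> (\<forall>y. y \<epsilon> m \<longrightarrow> y \<epsilon> a \<longrightarrow> \<not> P y)"
proof -
  define b where "b = code {x. x \<epsilon> a \<and> P x}"
  have b: "x \<epsilon> b \<longleftrightarrow> x \<epsilon> a \<and> P x" for x
    unfolding b_def using separation[OF assms(1)] by (simp add: mem_code)
  have "sat UNIV (\<epsilon>) undefined undefined (Foundation :: csym fm)" by (rule ZFC) (simp add: ZFC_def)
  then have "\<exists>m. m \<epsilon> b \<and> \<not> (\<exists>y. y \<epsilon> m \<and> y \<epsilon> b)" using b assms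
    by (simp add: Foundation_def eval_nat_numeral) metis
  then show ?thesis using b by blast
qed

lemma R1_True: "R1 (\<lambda>x. True)" unfolding R1_def by (intro dfs)

lemma mem_irrefl [simp]: "\<not> a \<epsilon> a"
  using foundation[OF R1_True, of a "upair a a"] by auto

lemma mem_asym: "a \<epsilon> b \<Longrightarrow> \<not> b \<epsilon> a"
  using foundation[OF R1_True, of a "upair a b"] by auto

lemma succ_inj [simp]: "succ a = succ b \<longleftrightarrow> a = b"
proof
  assume "succ a = succ b"
  then have "a \<epsilon> succ b" "b \<epsilon> succ a" using mem_succ by metis+
  then show "a = b" using mem_asym by auto
qed simp

section \<open>Natural numbers of the model\<close>

definition omega :: "'a" where
  "omega = code {n. \<forall>I. null \<epsilon> I \<longrightarrow> (\<forall>m. m \<epsilon> I \<longrightarrow> succ m \<epsilon> I) \<longrightarrow> n \<epsilon> I}"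

lemma sat_empty_fm: "sat UNIV (\<epsilon>) I e (empty_fm t) \<longleftrightarrow> tval I e t = null"
  by (simp add: empty_fm_def eq_null_iff)

lemma sat_succ_fm: "sat UNIV (\<epsilon>) I e (succ_fm s t) \<longleftrightarrow> tval I e t = succ (tval I e s)"
proof -
  have "sat UNIV (\<epsilon>) I e (succ_fm s t) \<longleftrightarrow> (\<forall>x. x \<epsilon> tval I e t \<longleftrightarrow> x \<epsilon> succ (tval I e s))"
    by (auto simp: succ_fm_def)
  then show ?thesis using Ext by auto
qed

lemma sat_inductive_fm: "sat UNIV (\<epsilon>) I e (inductive_fm t) \<longleftrightarrow>
    null \<epsilon> tval I e t \<and> (\<forall>m. m \<epsilon> tval I e t \<longrightarrow> succ m \<epsilon> tval I e t)"
  by (simp add: inductive_fm_def sat_empty_fm sat_succ_fm)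

lemma mem_omega: "n \<epsilon> omega \<longleftrightarrow> (\<forall>I. null \<epsilon> I \<longrightarrow> (\<forall>m. m \<epsilon> I \<longrightarrow> succ m \<epsilon> I) \<longrightarrow> n \<epsilon> I)"
proof -
  have "sat UNIV (\<epsilon>) undefined undefined (Infinity :: csym fm)" by (rule ZFC) (simp add: ZFC_def)
  then obtain I where I: "null \<epsilon> I" "\<forall>m. m \<epsilon> I \<longrightarrow> succ m \<epsilon> I"
    by (auto simp: Infinity_def sat_inductive_fm)
  have "is_set {n. \<forall>I. null \<epsilon> I \<longrightarrow> (\<forall>m. m \<epsilon> I \<longrightarrow> succ m \<epsilon> I) \<longrightarrow> n \<epsilon> I}"
    by (rule is_set_subset[OF is_set_mem[of I]], unfold R1_def, intro dfs) (use I in auto)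
  then show ?thesis by (simp add: omega_def mem_code)
qed

lemma null_omega [simp]: "null \<epsilon> omega" and succ_omega [simp]: "n \<epsilon> omega \<Longrightarrow> succ n \<epsilon> omega"
  by (auto simp: mem_omega)

text \<open>Restricted to definable \<open>P\<close>: Separation must turn the property into an
  inductive set. For an arbitrary \<open>P\<close> it could fail at nonstandard elements of
  \<open>omega\<close>.\<close>

lemma omega_induct:
  assumes "R1 P" "n \<epsilon> omega" "P null" "\<And>n. n \<epsilon> omega \<Longrightarrow> P n \<Longrightarrow> P (succ n)"
  shows "P n"
proof -
  define b where "b = code {n. n \<epsilon> omega \<and> P n}"
  have b: "x \<epsilon> b \<longleftrightarrow> x \<epsilon> omega \<and> P x" for x
    unfolding b_def using separation[OF assms(1)] by (simp add: mem_code)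
  show ?thesis using assms mem_omega[of n] b null_omega succ_omega by metis
qed

lemma omega_cases:
  assumes "n \<epsilon> omega"
  obtains "n = null" | m where "m \<epsilon> omega" "n = succ m"
proof -
  have "n = null \<or> (\<exists>m. m \<epsilon> omega \<and> n = succ m)"
    by (rule omega_induct[OF _ assms], unfold R1_def, intro dfs) auto
  then show ?thesis using that by auto
qed

text \<open>Recursion along membership restricted to the class \<open>B p\<close>: the value at \<open>x\<close> depends on the set of
  values at those elements of \<open>x\<close> that lie in the class. A good set \<open>f\<close> is a partial solution.\<close>

definition Good :: "('a \<Rightarrow> 'a \<Rightarrow> bool) \<Rightarrow> ('a \<Rightarrow> 'a \<Rightarrow> 'a \<Rightarrow> 'a) \<Rightarrow> 'a \<Rightarrow> 'a \<Rightarrow> bool" where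
  "Good B G p f \<longleftrightarrow> (\<forall>x y. pair x y \<epsilon> f \<longrightarrow>
     (\<forall>u. u \<epsilon> x \<longrightarrow> B p u \<longrightarrow> (\<exists>w. pair u w \<epsilon> f)) \<and>
     y = G p x (code {w. \<exists>u. u \<epsilon> x \<and> B p u \<and> pair u w \<epsilon> f}))"

definition recur :: "('a \<Rightarrow> 'a \<Rightarrow> bool) \<Rightarrow> ('a \<Rightarrow> 'a \<Rightarrow> 'a \<Rightarrow> 'a) \<Rightarrow> 'a \<Rightarrow> 'a \<Rightarrow> 'a" where
  "recur B G p x = code {z. \<exists>f y. Good B G p f \<and> pair x y \<epsilon> f \<and> z \<epsilon> y}"

lemma R2_Good: "R2 B \<Longrightarrow> F3 G \<Longrightarrow> R2 (Good B G)"
proof -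
  assume a: "R2 B" "F3 G"
  show ?thesis unfolding R2_def Good_def by (intro dfs R2_app[OF a(1)] F3_app[OF a(2)])
qed

lemma F2_recur: "R2 B \<Longrightarrow> F3 G \<Longrightarrow> F2 (recur B G)"
proof -
  assume a: "R2 B" "F3 G"
  show ?thesis unfolding F2_def recur_def by (intro dfs R2_app[OF R2_Good[OF a]])
qed

text \<open>Used with three classes: \<open>omega\<close>, the universe, and the members of a given
  set. \<open>ind\<close> is induction along membership within the class; \<open>closed\<close>
  bounds the predecessors by a set, so that Replacement can collect partial solutions.\<close>

context
  fixes B :: "'a \<Rightarrow> 'a \<Rightarrow> bool" and G :: "'a \<Rightarrow> 'a \<Rightarrow> 'a \<Rightarrow> 'a" and p :: 'a
  assumes B: "R2 B" and G: "F3 G"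
    and ind: "\<And>P x. R1 P \<Longrightarrow> (\<And>x. B p x \<Longrightarrow> (\<And>u. u \<epsilon> x \<Longrightarrow> B p u \<Longrightarrow> P u) \<Longrightarrow> P x) \<Longrightarrow> B p x \<Longrightarrow> P x"
    and closed: "\<And>x. B p x \<Longrightarrow> \<exists>d. (\<forall>u. u \<epsilon> x \<longrightarrow> B p u \<longrightarrow> u \<epsilon> d) \<and>
       (\<forall>u u'. u \<epsilon> d \<longrightarrow> u' \<epsilon> u \<longrightarrow> B p u' \<longrightarrow> u' \<epsilon> d)"
begin

abbreviation "good f \<equiv> Good B G p f"

lemma GoodD:
  assumes "good f" "pair x y \<epsilon> f"
  shows "u \<epsilon> x \<Longrightarrow> B p u \<Longrightarrow> \<exists>w. pair u w \<epsilon> f"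
    and "y = G p x (code {w. \<exists>u. u \<epsilon> x \<and> B p u \<and> pair u w \<epsilon> f})"
  using assms unfolding Good_def by blast+

text \<open>Both solutions contain values at all predecessors of x in the class and agree there by
  induction, so \<open>G\<close> is applied to the same set of earlier values.\<close>

lemma Good_unique:
  "B p x \<Longrightarrow> \<forall>f g y z. good f \<longrightarrow> good g \<longrightarrow> pair x y \<epsilon> f \<longrightarrow> pair x z \<epsilon> g \<longrightarrow> y = z"
proof (rule ind[of "\<lambda>x. \<forall>f g y z. good f \<longrightarrow> good g \<longrightarrow> pair x y \<epsilon> f \<longrightarrow> pair x z \<epsilon> g \<longrightarrow> y = z"])
  show "R1 (\<lambda>x. \<forall>f g y z. good f \<longrightarrow> good g \<longrightarrow> pair x y \<epsilon> f \<longrightarrow> pair x z \<epsilon> g \<longrightarrow> y = z)"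
    unfolding R1_def by (intro dfs R2_app[OF R2_Good[OF B G]])
next
  fix x
  assume IH: "\<And>u. u \<epsilon> x \<Longrightarrow> B p u \<Longrightarrow>
    \<forall>f g y z. good f \<longrightarrow> good g \<longrightarrow> pair u y \<epsilon> f \<longrightarrow> pair u z \<epsilon> g \<longrightarrow> y = z"
  show "\<forall>f g y z. good f \<longrightarrow> good g \<longrightarrow> pair x y \<epsilon> f \<longrightarrow> pair x z \<epsilon> g \<longrightarrow> y = z"
  proof (intro allI impI)
    fix f g y z
    assume a: "good f" "good g" "pair x y \<epsilon> f" "pair x z \<epsilon> g"
    have "pair u w \<epsilon> f \<longleftrightarrow> pair u w \<epsilon> g" if u: "u \<epsilon> x" "B p u" for u w
    proof -
      obtain v v' where v: "pair u v \<epsilon> f" "pair u v' \<epsilon> g"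
        using GoodD(1)[OF a(1,3) u] GoodD(1)[OF a(2,4) u] by blast
      show ?thesis using IH[OF u] a(1,2) v by metis
    qed
    then have "{w. \<exists>u. u \<epsilon> x \<and> B p u \<and> pair u w \<epsilon> f} = {w. \<exists>u. u \<epsilon> x \<and> B p u \<and> pair u w \<epsilon> g}"
      by blast
    then show "y = z" using GoodD(2)[OF a(1,3)] GoodD(2)[OF a(2,4)] by simp
  qed
qed

lemma Good_unique': "B p x \<Longrightarrow> good f \<Longrightarrow> good g \<Longrightarrow> pair x y \<epsilon> f \<Longrightarrow> pair x z \<epsilon> g \<Longrightarrow> y = z"
  using Good_unique by blast

text \<open>By uniqueness, Replacement collects all values of good sets at elements of
  \<open>d\<close> into one set \<open>h\<close>. It is good, and one more pair extends it to
  x.\<close>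

lemma Good_exists: "B p x \<Longrightarrow> \<exists>f y. good f \<and> pair x y \<epsilon> f"
proof (rule ind[of "\<lambda>x. \<exists>f y. good f \<and> pair x y \<epsilon> f"])
  show "R1 (\<lambda>x. \<exists>f y. good f \<and> pair x y \<epsilon> f)"
    unfolding R1_def by (intro dfs R2_app[OF R2_Good[OF B G]])
next
  fix x
  assume Bx: "B p x" and IH: "\<And>u. u \<epsilon> x \<Longrightarrow> B p u \<Longrightarrow> \<exists>f y. good f \<and> pair u y \<epsilon> f"
  show "\<exists>f y. good f \<and> pair x y \<epsilon> f"
  proof (rule ccontr)
    assume no: "\<nexists>f y. good f \<and> pair x y \<epsilon> f"
    obtain d where d: "\<And>u. u \<epsilon> x \<Longrightarrow> B p u \<Longrightarrow> u \<epsilon> d"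
      "\<And>u u'. u \<epsilon> d \<Longrightarrow> u' \<epsilon> u \<Longrightarrow> B p u' \<Longrightarrow> u' \<epsilon> d" using closed[OF Bx] by blast
    define h where "h = code {q. \<exists>u. u \<epsilon> d \<and> (B p u \<and> (\<exists>f w. good f \<and> pair u w \<epsilon> f \<and> q = pair u w))}"
    have "is_set {q. \<exists>u. u \<epsilon> d \<and> (B p u \<and> (\<exists>f w. good f \<and> pair u w \<epsilon> f \<and> q = pair u w))}"
    proof (rule replacement_rel)
      show "R2 (\<lambda>u q. B p u \<and> (\<exists>f w. good f \<and> pair u w \<epsilon> f \<and> q = pair u w))"
        unfolding R2_def by (intro dfs R2_app[OF B] R2_app[OF R2_Good[OF B G]])
      show "y = z" if "B p u \<and> (\<exists>f w. good f \<and> pair u w \<epsilon> f \<and> y = pair u w)"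
        "B p u \<and> (\<exists>f w. good f \<and> pair u w \<epsilon> f \<and> z = pair u w)" for u y z
        using that Good_unique' by blast
    qed
    then have h: "q \<epsilon> h \<longleftrightarrow> (\<exists>u. u \<epsilon> d \<and> B p u \<and> (\<exists>f w. good f \<and> pair u w \<epsilon> f \<and> q = pair u w))" for q
      unfolding h_def by (simp add: mem_code)
    have hx: "pair u w \<epsilon> h \<longleftrightarrow> u \<epsilon> d \<and> B p u \<and> (\<exists>f. good f \<and> pair u w \<epsilon> f)" for u w
      unfolding h by auto
    have good_h: "good h"
      unfolding Good_def
    proof (intro allI impI conjI)
      fix u w assume "pair u w \<epsilon> h"
      then obtain f where f: "u \<epsilon> d" "B p u" "good f" "pair u w \<epsilon> f" using hx by blast
      have sub: "pair u' w' \<epsilon> h \<longleftrightarrow> pair u' w' \<epsilon> f" if u': "u' \<epsilon> u" "B p u'" for u' w'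
      proof -
        obtain v where v: "pair u' v \<epsilon> f" using GoodD(1)[OF f(3,4) u'] by blast
        show ?thesis using hx d(2)[OF f(1) u'] u' f(3) v Good_unique' by metis
      qed
      show "\<exists>w'. pair u' w' \<epsilon> h" if "u' \<epsilon> u" "B p u'" for u'
        using GoodD(1)[OF f(3,4) that] sub[OF that] by blast
      have "{w'. \<exists>u'. u' \<epsilon> u \<and> B p u' \<and> pair u' w' \<epsilon> h} = {w'. \<exists>u'. u' \<epsilon> u \<and> B p u' \<and> pair u' w' \<epsilon> f}"
        using sub by blast
      then show "w = G p u (code {w'. \<exists>u'. u' \<epsilon> u \<and> B p u' \<and> pair u' w' \<epsilon> h})"
        using GoodD(2)[OF f(3,4)] by simp
    qed
    define y where "y = G p x (code {w. \<exists>u. u \<epsilon> x \<and> B p u \<and> pair u w \<epsilon> h})"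
    define k where "k = cup h (upair (pair x y) (pair x y))"
    have k: "pair u w \<epsilon> k \<longleftrightarrow> pair u w \<epsilon> h \<or> u = x \<and> w = y" for u w
      unfolding k_def by simp
    \<comment> \<open>The gain from arguing by contradiction: \<open>h\<close> has no value at x
      yet, so adding \<open>pair x y\<close> cannot create a second one.\<close>
    have noh: "\<not> pair x w \<epsilon> h" for w using no good_h by blast
    have "good k"
      unfolding Good_def
    proof (intro allI impI conjI)
      fix u w assume uw: "pair u w \<epsilon> k"
      \<comment> \<open>The new pair is never consulted: x as a predecessor of an argument of
        \<open>h\<close> would have a value in \<open>h\<close>, and x is not its own
        predecessor.\<close>
      have same: "pair u' w' \<epsilon> k \<longleftrightarrow> pair u' w' \<epsilon> h" if "u' \<epsilon> u" "B p u'" for u' w'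
        using uw that noh GoodD(1)[OF good_h, of u w u'] k mem_irrefl by metis
      then have eq: "{w'. \<exists>u'. u' \<epsilon> u \<and> B p u' \<and> pair u' w' \<epsilon> k} = {w'. \<exists>u'. u' \<epsilon> u \<and> B p u' \<and> pair u' w' \<epsilon> h}"
        by blast
      show "\<exists>w'. pair u' w' \<epsilon> k" if u': "u' \<epsilon> u" "B p u'" for u'
      proof (cases "pair u w \<epsilon> h")
        case True
        then show ?thesis using GoodD(1)[OF good_h True u'] k by blast
      next
        case False
        then have "u = x" using uw k by blast
        then show ?thesis using IH[of u'] u' d(1)[of u'] hx k by blast
      qed
      show "w = G p u (code {w'. \<exists>u'. u' \<epsilon> u \<and> B p u' \<and> pair u' w' \<epsilon> k})"
        unfolding eq using uw k GoodD(2)[OF good_h] y_def by blast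
    qed
    then show False using no k by blast
  qed
qed

lemma recur_eqI: "B p x \<Longrightarrow> good f \<Longrightarrow> pair x y \<epsilon> f \<Longrightarrow> recur B G p x = y"
  unfolding recur_def using Good_unique' by (intro code_eqI) blast

lemma recur: "B p x \<Longrightarrow> recur B G p x = G p x (code {w. \<exists>u. u \<epsilon> x \<and> B p u \<and> w = recur B G p u})"
proof -
  assume x: "B p x"
  then obtain f y where f: "good f" "pair x y \<epsilon> f" using Good_exists by blast
  have "pair u w \<epsilon> f \<longleftrightarrow> w = recur B G p u" if "u \<epsilon> x" "B p u" for u w
    using GoodD(1)[OF f that] recur_eqI[OF that(2) f(1)] by metis
  then have "{w. \<exists>u. u \<epsilon> x \<and> B p u \<and> pair u w \<epsilon> f} = {w. \<exists>u. u \<epsilon> x \<and> B p u \<and> w = recur B G p u}"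
    by blast
  then show ?thesis using recur_eqI[OF x f] GoodD(2)[OF f] by simp
qed

end

lemma is_set_recur_image:
  assumes "R2 B" "F3 G"
  shows "is_set {w. \<exists>u. u \<epsilon> x \<and> B p u \<and> w = recur B G p u}"
  by (rule replacement_rel[of "\<lambda>u w. B p u \<and> w = recur B G p u"], unfold R2_def,
      intro dfs R2_app[OF assms(1)] F2_app[OF F2_recur[OF assms]]) auto

text \<open>Each value is paired with its argument, so that the set of previous values is the graph of the
  function computed so far.\<close>

definition nrec_step :: "('a \<Rightarrow> 'a) \<Rightarrow> ('a \<Rightarrow> 'a \<Rightarrow> 'a) \<Rightarrow> 'a \<Rightarrow> 'a \<Rightarrow> 'a \<Rightarrow> 'a" where
  "nrec_step A H p x s = pair x (if x = null then A p
     else H p (code {z. \<exists>u y. x = succ u \<and> pair u y \<epsilon> s \<and> z \<epsilon> y}))"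

definition nrec :: "('a \<Rightarrow> 'a) \<Rightarrow> ('a \<Rightarrow> 'a \<Rightarrow> 'a) \<Rightarrow> 'a \<Rightarrow> 'a \<Rightarrow> 'a" where
  "nrec A H p n = second (recur (\<lambda>_ u. u \<epsilon> omega) (nrec_step A H) p n)"

lemma F3_nrec_step: "F1 A \<Longrightarrow> F2 H \<Longrightarrow> F3 (nrec_step A H)"
proof -
  assume a: "F1 A" "F2 H"
  show ?thesis unfolding F3_def nrec_step_def by (intro dfs F1_app[OF a(1)] F2_app[OF a(2)])
qed

lemma R2_omega: "R2 (\<lambda>_ u. u \<epsilon> omega)"
  unfolding R2_def by (intro dfs)

lemma F2_nrec: "F1 A \<Longrightarrow> F2 H \<Longrightarrow> F2 (nrec A H)"
proof -
  assume a: "F1 A" "F2 H"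
  show ?thesis unfolding F2_def nrec_def by (intro dfs F2_app[OF F2_recur[OF R2_omega F3_nrec_step[OF a]]])
qed

lemma omega_recur:
  assumes "F3 G" "n \<epsilon> omega"
  shows "recur (\<lambda>_ u. u \<epsilon> omega) G p n = G p n (code {w. \<exists>u. u \<epsilon> n \<and> u \<epsilon> omega \<and> w = recur (\<lambda>_ u. u \<epsilon> omega) G p u})"
proof (rule recur[OF R2_omega assms(1)])
  fix P x
  assume P: "R1 P" and step: "\<And>x. x \<epsilon> omega \<Longrightarrow> (\<And>u. u \<epsilon> x \<Longrightarrow> u \<epsilon> omega \<Longrightarrow> P u) \<Longrightarrow> P x" and "x \<epsilon> omega"
  \<comment> \<open>Course-of-values induction: simple induction on the statement that
    \<open>P\<close> holds at all elements.\<close>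
  have "\<forall>u. u \<epsilon> x \<longrightarrow> P u"
    by (rule omega_induct[OF _ \<open>x \<epsilon> omega\<close>], unfold R1_def, intro dfs R1_app[OF P]) (use step in auto)
  then show "P x" using step \<open>x \<epsilon> omega\<close> by blast
next
  fix x
  assume "x \<epsilon> omega"
  show "\<exists>d. (\<forall>u. u \<epsilon> x \<longrightarrow> u \<epsilon> omega \<longrightarrow> u \<epsilon> d) \<and> (\<forall>u u'. u \<epsilon> d \<longrightarrow> u' \<epsilon> u \<longrightarrow> u' \<epsilon> omega \<longrightarrow> u' \<epsilon> d)"
    \<comment> \<open>The class is \<open>omega\<close> itself, which trivially contains all
      predecessors that lie in the class.\<close>
    by (intro exI[of _ omega]) auto
qed (use assms in auto)

lemma nrec_null:
  assumes "F1 A" "F2 H"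
  shows "nrec A H p null = A p"
  unfolding nrec_def by (subst omega_recur[OF F3_nrec_step[OF assms]]) (simp_all add: nrec_step_def)

lemma nrec_succ:
  assumes "F1 A" "F2 H" "n \<epsilon> omega"
  shows "nrec A H p (succ n) = H p (nrec A H p n)"
proof -
  let ?R = "recur (\<lambda>_ u. u \<epsilon> omega) (nrec_step A H) p"
  have R: "?R u = pair u (nrec A H p u)" if "u \<epsilon> omega" for u
    unfolding nrec_def using omega_recur[OF F3_nrec_step[OF assms(1,2)] that, of p] by (simp add: nrec_step_def)
  define s where "s = code {w. \<exists>u. u \<epsilon> succ n \<and> u \<epsilon> omega \<and> w = ?R u}"
  have s: "w \<epsilon> s \<longleftrightarrow> (\<exists>u. u \<epsilon> succ n \<and> u \<epsilon> omega \<and> w = ?R u)" for w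
    unfolding s_def
    by (simp only: mem_code[OF is_set_recur_image[OF R2_omega F3_nrec_step[OF assms(1,2)]]] mem_Collect_eq)
  have "pair n y \<epsilon> s \<longleftrightarrow> y = nrec A H p n" for y
    unfolding s using R assms(3) by auto
  then have "code {z. \<exists>u y. succ n = succ u \<and> pair u y \<epsilon> s \<and> z \<epsilon> y} = nrec A H p n"
    by (intro code_eqI) simp
  then have "?R (succ n) = pair (succ n) (H p (nrec A H p n))"
    using omega_recur[OF F3_nrec_step[OF assms(1,2)] succ_omega[OF assms(3)], of p]
    by (simp add: nrec_step_def s_def)
  then show ?thesis by (simp add: nrec_def)
qed

lemma is_set_nrec_image:
  assumes "F1 A" "F2 H"
  shows "is_set {y. \<exists>n. n \<epsilon> omega \<and> y = nrec A H p n}"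
  by (rule replacement, unfold F1_def, intro dfs F2_app[OF F2_nrec[OF assms]])

section \<open>Transitive closures, membership induction and ranks\<close>

lemma transitive_closure: "\<exists>d. x \<epsilon> d \<and> (\<forall>u v. u \<epsilon> d \<longrightarrow> v \<epsilon> u \<longrightarrow> v \<epsilon> d)"
proof -
  have d: "F1 (\<lambda>x. x)" "F2 (\<lambda>_. bigcup)" unfolding F1_def F2_def by (intro dfs)+
  \<comment> \<open>Iterated unions starting from {x}. Recursion along \<open>omega\<close> precedes
    recursion along membership because the latter needs this closure as its bounding set.\<close>
  let ?T = "nrec (\<lambda>x. x) (\<lambda>_. bigcup) (upair x x)"
  define d where "d = bigcup (code {y. \<exists>n. n \<epsilon> omega \<and> y = ?T n})"
  have mem: "u \<epsilon> d \<longleftrightarrow> (\<exists>n. n \<epsilon> omega \<and> u \<epsilon> ?T n)" for u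
    unfolding d_def mem_bigcup mem_code[OF is_set_nrec_image[OF d]] by blast
  have "x \<epsilon> d" unfolding mem using nrec_null[OF d, of "upair x x"] by (intro exI[of _ null]) simp
  moreover have "v \<epsilon> d" if uv: "u \<epsilon> d" "v \<epsilon> u" for u v
  proof -
    obtain n where n: "n \<epsilon> omega" "u \<epsilon> ?T n" using uv(1) mem by blast
    have "?T (succ n) = bigcup (?T n)" by (rule nrec_succ[OF d n(1)])
    then have "v \<epsilon> ?T (succ n)" using n(2) uv(2) mem_bigcup by metis
    then show ?thesis using n(1) succ_omega mem by blast
  qed
  ultimately show ?thesis by blast
qed

text \<open>Foundation provides minimal elements only within a set, so the class of counterexamples
  is cut down to a transitive set containing one.\<close>

lemma eps_induct:
  assumes "R1 P" "\<And>x. (\<And>u. u \<epsilon> x \<Longrightarrow> P u) \<Longrightarrow> P x"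
  shows "P x"
proof (rule ccontr)
  assume x: "\<not> P x"
  obtain d where d: "x \<epsilon> d" "\<And>u v. u \<epsilon> d \<Longrightarrow> v \<epsilon> u \<Longrightarrow> v \<epsilon> d" using transitive_closure by blast
  have "R1 (\<lambda>x. \<not> P x)" unfolding R1_def by (intro dfs R1_app[OF assms(1)])
  from foundation[OF this d(1) x] show False using d(2) assms(2) by blast
qed

text \<open>\<open>V x\<close> is the level of the cumulative hierarchy indexed by the rank of \<open>x\<close>; no ordinals are needed.\<close>

definition Vstep :: "'a \<Rightarrow> 'a \<Rightarrow> 'a \<Rightarrow> 'a" where
  "Vstep p x s = code {z. \<exists>w. w \<epsilon> s \<and> z \<sqsubseteq> w}"

definition V :: "'a \<Rightarrow> 'a" where
  "V x = recur (\<lambda>_ _. True) Vstep null x"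

lemma F3_Vstep: "F3 Vstep" unfolding F3_def Vstep_def by (intro dfs)

lemma R2_True: "R2 (\<lambda>_ _. True)" unfolding R2_def by (intro dfs)

lemma F1_V: "F1 V"
  unfolding F1_def V_def by (intro dfs F2_app[OF F2_recur[OF R2_True F3_Vstep]])
lemmas [dfs] = F1_app[OF F1_V]

lemma V_rec: "V x = Vstep null x (code {w. \<exists>u. u \<epsilon> x \<and> w = V u})"
proof -
  have "recur (\<lambda>_ _. True) Vstep null x = Vstep null x (code {w. \<exists>u. u \<epsilon> x \<and> True \<and> w = recur (\<lambda>_ _. True) Vstep null u})"
  proof (rule recur[OF R2_True F3_Vstep])
    show "P y" if "R1 P" "\<And>x. True \<Longrightarrow> (\<And>u. u \<epsilon> x \<Longrightarrow> True \<Longrightarrow> P u) \<Longrightarrow> P x" for P y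
      by (rule eps_induct[OF that(1)], rule that(2)[OF TrueI]) blast
    show "\<exists>d. (\<forall>u. u \<epsilon> y \<longrightarrow> True \<longrightarrow> u \<epsilon> d) \<and> (\<forall>u u'. u \<epsilon> d \<longrightarrow> u' \<epsilon> u \<longrightarrow> True \<longrightarrow> u' \<epsilon> d)" for y
      using transitive_closure[of y] by blast
  qed simp
  then show ?thesis by (simp add: V_def)
qed

lemma mem_V: "z \<epsilon> V x \<longleftrightarrow> (\<exists>u. u \<epsilon> x \<and> z \<sqsubseteq> V u)"
proof -
  define s where "s = code {w. \<exists>u. u \<epsilon> x \<and> w = V u}"
  have s: "w \<epsilon> s \<longleftrightarrow> (\<exists>u. u \<epsilon> x \<and> w = V u)" for w
    unfolding s_def using mem_code[OF replacement[OF F1_V]] by simp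
  have "z \<epsilon> bigcup (code {y. \<exists>w. w \<epsilon> s \<and> y = power w}) \<longleftrightarrow> (\<exists>w. w \<epsilon> s \<and> z \<sqsubseteq> w)" for z
    using mem_code[OF replacement[OF F1_power]] by auto
  then have "is_set {z. \<exists>w. w \<epsilon> s \<and> z \<sqsubseteq> w}" unfolding is_set_def by blast
  then have "z \<epsilon> V x \<longleftrightarrow> (\<exists>w. w \<epsilon> s \<and> z \<sqsubseteq> w)"
    using V_rec[of x] by (simp add: Vstep_def s_def mem_code)
  then show ?thesis using s by auto
qed

lemma V_subset: "z \<epsilon> V x \<Longrightarrow> y \<sqsubseteq> z \<Longrightarrow> y \<epsilon> V x"
  using mem_V sub_trans by blast

lemma sub_V: "x \<sqsubseteq> V x"
proof (rule eps_induct[of "\<lambda>x. x \<sqsubseteq> V x"])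
  show "R1 (\<lambda>x. x \<sqsubseteq> V x)" unfolding R1_def by (intro dfs)
next
  fix x assume IH: "\<And>u. u \<epsilon> x \<Longrightarrow> u \<sqsubseteq> V u"
  show "x \<sqsubseteq> V x" unfolding sub_def using IH mem_V by blast
qed

text \<open>Let w be in \<open>V x\<close> but not in \<open>V y\<close>, with w included in
  \<open>V u\<close> for some u in x. For y' in y, inclusion of \<open>V u\<close> in
  \<open>V y'\<close> would put w into \<open>V y\<close>; so induction gives \<open>V y'\<close> in
  \<open>V u\<close>. Hence \<open>V y\<close> is included in \<open>V u\<close> and belongs to
  \<open>V x\<close>.\<close>

lemma V_linear: "\<forall>y. V x \<sqsubseteq> V y \<or> V y \<epsilon> V x"
proof (rule eps_induct[of "\<lambda>x. \<forall>y. V x \<sqsubseteq> V y \<or> V y \<epsilon> V x"])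
  show "R1 (\<lambda>x. \<forall>y. V x \<sqsubseteq> V y \<or> V y \<epsilon> V x)" unfolding R1_def by (intro dfs)
next
  fix x assume IH: "\<And>u. u \<epsilon> x \<Longrightarrow> \<forall>y. V u \<sqsubseteq> V y \<or> V y \<epsilon> V u"
  show "\<forall>y. V x \<sqsubseteq> V y \<or> V y \<epsilon> V x"
  proof (intro allI, rule disjCI)
    fix y assume "\<not> V y \<epsilon> V x"
    show "V x \<sqsubseteq> V y"
    proof (rule ccontr)
      assume "\<not> V x \<sqsubseteq> V y"
      then obtain w where w: "w \<epsilon> V x" "\<not> w \<epsilon> V y" by (auto simp: sub_def)
      then obtain u where u: "u \<epsilon> x" "w \<sqsubseteq> V u" using mem_V by blast
      have "V y' \<epsilon> V u" if "y' \<epsilon> y" for y'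
        using IH[OF u(1)] w(2) u(2) that mem_V sub_trans by blast
      then have "V y \<sqsubseteq> V u" unfolding sub_def[of "V y"] using mem_V[of _ y] V_subset by blast
      then show False using \<open>\<not> V y \<epsilon> V x\<close> u(1) mem_V by blast
    qed
  qed
qed

text \<open>Scott's trick.\<close>

lemma V_least:
  assumes "R1 C" "C z"
  shows "\<exists>z. C z \<and> (\<forall>z'. C z' \<longrightarrow> V z \<sqsubseteq> V z')"
proof -
  have *: "\<exists>z. C z \<and> (\<forall>z'. C z' \<longrightarrow> \<not> V z' \<epsilon> V z)"
  proof -
    \<comment> \<open>The induction runs over the value \<open>V z\<close>, not over z, and finds a
      membership-minimal one; \<open>V_linear\<close> then makes it least.\<close>
    have P: "R1 (\<lambda>v. \<forall>z. C z \<longrightarrow> v = V z \<longrightarrow> (\<exists>z. C z \<and> (\<forall>z'. C z' \<longrightarrow> \<not> V z' \<epsilon> V z)))"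
      unfolding R1_def by (intro dfs R1_app[OF assms(1)])
    have "\<forall>z. C z \<longrightarrow> v = V z \<longrightarrow> (\<exists>z. C z \<and> (\<forall>z'. C z' \<longrightarrow> \<not> V z' \<epsilon> V z))" for v
      by (rule eps_induct[OF P]) blast
    then show ?thesis using assms(2) by blast
  qed
  then show ?thesis using V_linear by blast
qed

section \<open>Definable choice functions on sets\<close>

lemma choice_set:
  assumes "\<And>x. x \<epsilon> a \<Longrightarrow> \<exists>y. y \<epsilon> x"
    and "\<And>x y u. x \<epsilon> a \<Longrightarrow> y \<epsilon> a \<Longrightarrow> u \<epsilon> x \<Longrightarrow> u \<epsilon> y \<Longrightarrow> x = y"
  shows "\<exists>c. \<forall>x. x \<epsilon> a \<longrightarrow> (\<exists>u. \<forall>v. v \<epsilon> x \<and> v \<epsilon> c \<longleftrightarrow> v = u)"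
proof -
  have "sat UNIV (\<epsilon>) undefined (\<lambda>_. undefined) (Choice :: csym fm)" by (rule ZFC) (simp add: ZFC_def)
  then have "(\<forall>x. x \<epsilon> a \<longrightarrow> (\<exists>y. y \<epsilon> x)) \<and>
      (\<forall>x y. x \<epsilon> a \<and> y \<epsilon> a \<and> (\<exists>u. u \<epsilon> x \<and> u \<epsilon> y) \<longrightarrow> x = y) \<longrightarrow>
      (\<exists>c. \<forall>x. x \<epsilon> a \<longrightarrow> (\<exists>u. \<forall>v. v \<epsilon> x \<and> v \<epsilon> c \<longleftrightarrow> v = u))"
    unfolding Choice_def
    by (simp only: sat.simps tval.simps eval_nat_numeral One_nat_def nat.case ball_UNIV
        BitM.simps numeral_One connectives) (drule spec[of _ a], assumption)
  then show ?thesis using assms by blast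
qed

text \<open>The axiom selects from disjoint families only, so candidates for x are tagged as
  \<open>pair x z\<close>, which makes distinct cells disjoint.\<close>

lemma choice:
  assumes Q: "R2 Q" and ex: "\<And>x. x \<epsilon> a \<Longrightarrow> \<exists>z. z \<epsilon> b \<and> Q x z"
  shows "\<exists>w. F1 w \<and> (\<forall>x. x \<epsilon> a \<longrightarrow> w x \<epsilon> b \<and> Q x (w x))"
proof -
  define cell where "cell x = code {q. \<exists>z. z \<epsilon> b \<and> Q x z \<and> q = pair x z}" for x
  have "is_set {q. \<exists>z. z \<epsilon> b \<and> Q x z \<and> q = pair x z}" for x
    by (rule replacement_rel[of "\<lambda>z q. Q x z \<and> q = pair x z"], unfold R2_def, intro dfs R2_app[OF Q]) auto
  then have cell: "q \<epsilon> cell x \<longleftrightarrow> (\<exists>z. z \<epsilon> b \<and> Q x z \<and> q = pair x z)" for q x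
    unfolding cell_def by (simp add: mem_code)
  have F1_cell: "F1 cell" unfolding F1_def cell_def by (intro dfs R2_app[OF Q])
  define fam where "fam = code {y. \<exists>x. x \<epsilon> a \<and> y = cell x}"
  have fam: "y \<epsilon> fam \<longleftrightarrow> (\<exists>x. x \<epsilon> a \<and> y = cell x)" for y
    unfolding fam_def by (simp add: mem_code[OF replacement[OF F1_cell]])
  have "\<exists>c. \<forall>x. x \<epsilon> fam \<longrightarrow> (\<exists>u. \<forall>v. v \<epsilon> x \<and> v \<epsilon> c \<longleftrightarrow> v = u)"
  proof (rule choice_set)
    show "\<exists>y. y \<epsilon> x" if x: "x \<epsilon> fam" for x
    proof -
      obtain t where t: "t \<epsilon> a" "x = cell t" using x fam by auto
      then obtain z where "z \<epsilon> b" "Q t z" using ex by blast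
      then have "pair t z \<epsilon> x" using t cell by blast
      then show ?thesis by blast
    qed
    show "x = y" if "x \<epsilon> fam" "y \<epsilon> fam" "u \<epsilon> x" "u \<epsilon> y" for x y u
      using that unfolding fam by (auto simp: cell)
  qed
  then obtain c where c: "\<And>x. x \<epsilon> fam \<Longrightarrow> \<exists>u. \<forall>v. v \<epsilon> x \<and> v \<epsilon> c \<longleftrightarrow> v = u" by blast
  \<comment> \<open>The selector \<open>c\<close> enters as a parameter. It meets the cell of x in
    one pair, so the union over z yields that z itself.\<close>
  define w where "w x = code {t. \<exists>z. z \<epsilon> b \<and> Q x z \<and> pair x z \<epsilon> c \<and> t \<epsilon> z}" for x
  have "F1 w" unfolding F1_def w_def by (intro dfs R2_app[OF Q])
  moreover have "w x \<epsilon> b \<and> Q x (w x)" if x: "x \<epsilon> a" for x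
  proof -
    have "cell x \<epsilon> fam" using fam x by blast
    then obtain u where u: "\<And>v. v \<epsilon> cell x \<and> v \<epsilon> c \<longleftrightarrow> v = u" using c by blast
    then obtain z where z: "z \<epsilon> b" "Q x z" "u = pair x z" using cell by blast
    have "z' = z" if "z' \<epsilon> b" "Q x z'" "pair x z' \<epsilon> c" for z'
      using u[of "pair x z'"] that unfolding cell z(3) by simp
    moreover have "pair x z \<epsilon> c" using u[of "pair x z"] unfolding z(3) by simp
    ultimately have "w x = z" unfolding w_def using z(1,2) by (intro code_eqI) blast
    then show ?thesis using z by simp
  qed
  ultimately show ?thesis by blast
qed

lemma is_set_image2:
  assumes F: "F2 F"
  shows "is_set {q. \<exists>x y. x \<epsilon> a \<and> y \<epsilon> b \<and> q = F x y}"
proof -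
  define row where "row x = code {q. \<exists>y. y \<epsilon> b \<and> q = F x y}" for x
  have "F1 (F x)" for x unfolding F1_def by (intro dfs F2_app[OF F])
  then have row: "q \<epsilon> row x \<longleftrightarrow> (\<exists>y. y \<epsilon> b \<and> q = F x y)" for q x
    unfolding row_def by (simp add: mem_code[OF replacement])
  have F1_row: "F1 row" unfolding F1_def row_def by (intro dfs F2_app[OF F])
  have "q \<epsilon> bigcup (code {r. \<exists>x. x \<epsilon> a \<and> r = row x}) \<longleftrightarrow> (\<exists>x y. x \<epsilon> a \<and> y \<epsilon> b \<and> q = F x y)" for q
  proof -
    have "q \<epsilon> bigcup (code {r. \<exists>x. x \<epsilon> a \<and> r = row x}) \<longleftrightarrow> (\<exists>x. x \<epsilon> a \<and> q \<epsilon> row x)"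
      unfolding mem_bigcup mem_code[OF replacement[OF F1_row]] by blast
    then show ?thesis unfolding row by blast
  qed
  then show ?thesis unfolding is_set_def by blast
qed

section \<open>Arithmetic on \<open>omega\<close> for an injective pairing function\<close>

definition double :: "'a \<Rightarrow> 'a" where
  "double n = nrec (\<lambda>_. null) (\<lambda>_ y. succ (succ y)) null n"

lemma double_fun: "F1 (\<lambda>_. null)" "F2 (\<lambda>_ y. succ (succ y))"
  unfolding F1_def F2_def by (intro dfs)+

lemma F1_double: "F1 double"
  unfolding F1_def double_def by (intro dfs F2_app[OF F2_nrec[OF double_fun]])
lemmas [dfs] = F1_app[OF F1_double]

lemma double_null [simp]: "double null = null"
  unfolding double_def by (rule nrec_null[OF double_fun])

lemma double_succ: "n \<epsilon> omega \<Longrightarrow> double (succ n) = succ (succ (double n))"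
  unfolding double_def by (rule nrec_succ[OF double_fun])

lemma double_omega: "n \<epsilon> omega \<Longrightarrow> double n \<epsilon> omega"
  by (rule omega_induct[of "\<lambda>n. double n \<epsilon> omega"], unfold R1_def, intro dfs) (auto simp: double_succ)

lemma double_inj: "m \<epsilon> omega \<Longrightarrow> \<forall>n. n \<epsilon> omega \<longrightarrow> double m = double n \<longrightarrow> m = n"
proof (rule omega_induct[of "\<lambda>m. \<forall>n. n \<epsilon> omega \<longrightarrow> double m = double n \<longrightarrow> m = n"], unfold R1_def, intro dfs)
  show "\<forall>n. n \<epsilon> omega \<longrightarrow> double null = double n \<longrightarrow> null = n"
  proof (intro allI impI)
    fix n assume "n \<epsilon> omega" "double null = double n"
    then show "null = n" by (cases rule: omega_cases[of n]) (auto simp: double_succ)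
  qed
next
  fix m assume m: "m \<epsilon> omega" and IH: "\<forall>n. n \<epsilon> omega \<longrightarrow> double m = double n \<longrightarrow> m = n"
  show "\<forall>n. n \<epsilon> omega \<longrightarrow> double (succ m) = double n \<longrightarrow> succ m = n"
  proof (intro allI impI)
    fix n assume n: "n \<epsilon> omega" and eq: "double (succ m) = double n"
    show "succ m = n" using n
    proof (cases rule: omega_cases[of n])
      case 1
      then show ?thesis using eq m by (simp add: double_succ)
    next
      case (2 k)
      then have "double m = double k" using eq m by (simp add: double_succ)
      then show ?thesis using IH 2 by blast
    qed
  qed
qed

lemma double_ne_succ_double: "m \<epsilon> omega \<Longrightarrow> \<forall>n. n \<epsilon> omega \<longrightarrow> double m \<noteq> succ (double n)"
proof (rule omega_induct[of "\<lambda>m. \<forall>n. n \<epsilon> omega \<longrightarrow> double m \<noteq> succ (double n)"], unfold R1_def, intro dfs)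
  fix m assume m: "m \<epsilon> omega" and IH: "\<forall>n. n \<epsilon> omega \<longrightarrow> double m \<noteq> succ (double n)"
  show "\<forall>n. n \<epsilon> omega \<longrightarrow> double (succ m) \<noteq> succ (double n)"
  proof (intro allI impI notI)
    fix n assume "n \<epsilon> omega" "double (succ m) = succ (double n)"
    then show False using m IH by (cases rule: omega_cases[of n]) (auto simp: double_succ)
  qed
qed simp_all

text \<open>The injection \<open>(m, n) \<mapsto> 2\<^sup>m (2 n + 1)\<close>.\<close>

definition npair :: "'a \<Rightarrow> 'a \<Rightarrow> 'a" where
  "npair m n = nrec (\<lambda>n. succ (double n)) (\<lambda>_ y. double y) n m"

lemma npair_fun: "F1 (\<lambda>n. succ (double n))" "F2 (\<lambda>_ y. double y)"
  unfolding F1_def F2_def by (intro dfs)+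

lemma F2_npair: "F2 npair"
  unfolding F2_def npair_def by (intro dfs F2_app[OF F2_nrec[OF npair_fun]])
lemmas [dfs] = F2_app[OF F2_npair]

lemma npair_null: "npair null n = succ (double n)"
  unfolding npair_def by (rule nrec_null[OF npair_fun])

lemma npair_succ: "m \<epsilon> omega \<Longrightarrow> npair (succ m) n = double (npair m n)"
  unfolding npair_def by (rule nrec_succ[OF npair_fun])

lemma npair_omega: "m \<epsilon> omega \<Longrightarrow> n \<epsilon> omega \<Longrightarrow> npair m n \<epsilon> omega"
  by (rule omega_induct[of "\<lambda>m. npair m n \<epsilon> omega"], unfold R1_def, intro dfs) (auto simp: npair_null npair_succ double_omega)

text \<open>By parity: a code with first component 0 is odd, any other is even. Two even codes are
  halved and the induction hypothesis applies.\<close>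

lemma npair_inj:
  assumes n: "n \<epsilon> omega" "n' \<epsilon> omega"
  shows "m \<epsilon> omega \<Longrightarrow> \<forall>m'. m' \<epsilon> omega \<longrightarrow> npair m n = npair m' n' \<longrightarrow> m = m' \<and> n = n'"
proof (rule omega_induct[of "\<lambda>m. \<forall>m'. m' \<epsilon> omega \<longrightarrow> npair m n = npair m' n' \<longrightarrow> m = m' \<and> n = n'"], unfold R1_def, intro dfs)
  show "\<forall>m'. m' \<epsilon> omega \<longrightarrow> npair null n = npair m' n' \<longrightarrow> null = m' \<and> n = n'"
  proof (intro allI impI)
    fix m' assume m': "m' \<epsilon> omega" and eq: "npair null n = npair m' n'"
    show "null = m' \<and> n = n'" using m'
    proof (cases rule: omega_cases[of m'])
      case 1
      then show ?thesis using eq n double_inj by (simp add: npair_null)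
    next
      case (2 k)
      then show ?thesis using eq n double_ne_succ_double[of "npair k n'"] npair_omega by (auto simp: npair_null npair_succ)
    qed
  qed
next
  fix m assume m: "m \<epsilon> omega" and IH: "\<forall>m'. m' \<epsilon> omega \<longrightarrow> npair m n = npair m' n' \<longrightarrow> m = m' \<and> n = n'"
  show "\<forall>m'. m' \<epsilon> omega \<longrightarrow> npair (succ m) n = npair m' n' \<longrightarrow> succ m = m' \<and> n = n'"
  proof (intro allI impI)
    fix m' assume m': "m' \<epsilon> omega" and eq: "npair (succ m) n = npair m' n'"
    show "succ m = m' \<and> n = n'" using m'
    proof (cases rule: omega_cases[of m'])
      case 1
      then show ?thesis using eq n m double_ne_succ_double[of "npair m n"] npair_omega by (auto simp: npair_null npair_succ)
    next
      case (2 k)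
      then have "double (npair m n) = double (npair k n')" using eq m by (simp add: npair_succ)
      then have "npair m n = npair k n'" using double_inj npair_omega m n 2 by blast
      then show ?thesis using IH 2 by blast
    qed
  qed
qed

text \<open>Closing off under candidate witnesses of least rank keeps every stage a set.\<close>

lemma closed_set:
  assumes R: "R3 R" and total: "\<And>x y. \<exists>z. R z x y"
  shows "\<exists>A. null \<epsilon> A \<and> (\<forall>x y. x \<epsilon> A \<longrightarrow> y \<epsilon> A \<longrightarrow> (\<exists>z. z \<epsilon> A \<and> R z x y))"
proof -
  define S where "S x y = code {z. R z x y \<and> (\<forall>z'. R z' x y \<longrightarrow> V z \<sqsubseteq> V z')}" for x y
  have R1_R: "R1 (\<lambda>z. R z x y)" for x y unfolding R1_def by (intro dfs R3_app[OF R])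
  have S: "z \<epsilon> S x y \<longleftrightarrow> R z x y \<and> (\<forall>z'. R z' x y \<longrightarrow> V z \<sqsubseteq> V z')" for z x y
  proof -
    obtain z0 where z0: "R z0 x y" using total by blast
    \<comment> \<open>For any witness \<open>z0\<close>, each witness z of least rank satisfies z
      \<sqsubseteq> \<open>V z\<close> \<sqsubseteq> \<open>V z0\<close>, so all of them lie in
      \<open>power (V z0)\<close>.\<close>
    have "is_set {z. R z x y \<and> (\<forall>z'. R z' x y \<longrightarrow> V z \<sqsubseteq> V z')}"
    proof (rule is_set_subset[OF is_set_mem[of "power (V z0)"]])
      show "R1 (\<lambda>z. R z x y \<and> (\<forall>z'. R z' x y \<longrightarrow> V z \<sqsubseteq> V z'))"
        unfolding R1_def by (intro dfs R3_app[OF R])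
      show "z \<in> {z. z \<epsilon> power (V z0)}" if "R z x y \<and> (\<forall>z'. R z' x y \<longrightarrow> V z \<sqsubseteq> V z')" for z
        using that z0 sub_V[of z] sub_trans by simp
    qed
    then show ?thesis unfolding S_def by (simp add: mem_code)
  qed
  have F2_S: "F2 S" unfolding F2_def S_def by (intro dfs R3_app[OF R])
  define H where "H p X = cup X (code {z. \<exists>s. (\<exists>x y. x \<epsilon> X \<and> y \<epsilon> X \<and> s = S x y) \<and> z \<epsilon> s})" for p X :: 'a
  have H: "z \<epsilon> H p X \<longleftrightarrow> z \<epsilon> X \<or> (\<exists>x y. x \<epsilon> X \<and> y \<epsilon> X \<and> z \<epsilon> S x y)" for z p X
  proof -
    have *: "s \<epsilon> code {s. \<exists>x y. x \<epsilon> X \<and> y \<epsilon> X \<and> s = S x y} \<longleftrightarrow> (\<exists>x y. x \<epsilon> X \<and> y \<epsilon> X \<and> s = S x y)" for s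
      by (simp only: mem_code[OF is_set_image2[OF F2_S]] mem_Collect_eq)
    have "is_set {z. \<exists>s. (\<exists>x y. x \<epsilon> X \<and> y \<epsilon> X \<and> s = S x y) \<and> z \<epsilon> s}"
      unfolding is_set_def
      by (rule exI[of _ "bigcup (code {s. \<exists>x y. x \<epsilon> X \<and> y \<epsilon> X \<and> s = S x y})"]) (simp only: mem_bigcup * mem_Collect_eq simp_thms)
    from mem_code[OF this] show ?thesis unfolding H_def mem_cup by blast
  qed
  have F2_H: "F2 H" unfolding F2_def H_def by (intro dfs F2_app[OF F2_S])
  have F1_A: "F1 (\<lambda>_. upair null null)" unfolding F1_def by (intro dfs)
  let ?A = "nrec (\<lambda>_. upair null null) H null"
  note A0 = nrec_null[OF F1_A F2_H, of null] and A1 = nrec_succ[OF F1_A F2_H, of _ null]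
  have F1_nrec: "F1 ?A" unfolding F1_def by (intro dfs F2_app[OF F2_nrec[OF F1_A F2_H]])
  have mono: "H null X \<sqsubseteq> H null Y" if "X \<sqsubseteq> Y" for X Y
    using that unfolding sub_def H by blast
  have inc: "X \<sqsubseteq> H null X" for X unfolding sub_def H by blast
  have A0_sub: "upair null null \<sqsubseteq> ?A n" if n: "n \<epsilon> omega" for n
  proof (rule omega_induct[OF _ n])
    show "R1 (\<lambda>n. upair null null \<sqsubseteq> ?A n)" unfolding R1_def by (intro dfs F1_app[OF F1_nrec])
    show "upair null null \<sqsubseteq> ?A (succ n)" if "n \<epsilon> omega" "upair null null \<sqsubseteq> ?A n" for n
      using A1[OF that(1)] inc[of "?A n"] sub_trans[OF that(2)] by simp
  qed (simp add: A0)
  \<comment> \<open>Induction on n takes the place of an order on \<open>omega\<close>: it brings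
    any two elements of the union into a common stage.\<close>
  have directed: "\<exists>k. k \<epsilon> omega \<and> ?A m \<sqsubseteq> ?A k \<and> ?A n \<sqsubseteq> ?A k" if m: "m \<epsilon> omega" and n: "n \<epsilon> omega" for m n
  proof (rule omega_induct[OF _ n])
    show "R1 (\<lambda>n. \<exists>k. k \<epsilon> omega \<and> ?A m \<sqsubseteq> ?A k \<and> ?A n \<sqsubseteq> ?A k)"
      unfolding R1_def by (intro dfs F1_app[OF F1_nrec])
    show "\<exists>k. k \<epsilon> omega \<and> ?A m \<sqsubseteq> ?A k \<and> ?A null \<sqsubseteq> ?A k"
      by (rule exI[of _ m]) (use A0_sub[OF m] A0 m in simp)
    fix n assume n: "n \<epsilon> omega" and "\<exists>k. k \<epsilon> omega \<and> ?A m \<sqsubseteq> ?A k \<and> ?A n \<sqsubseteq> ?A k"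
    then obtain k where k: "k \<epsilon> omega" "?A m \<sqsubseteq> ?A k" "?A n \<sqsubseteq> ?A k" by blast
    have "?A m \<sqsubseteq> ?A (succ k)" unfolding A1[OF k(1)] by (rule sub_trans[OF k(2) inc])
    moreover have "?A (succ n) \<sqsubseteq> ?A (succ k)" unfolding A1[OF k(1)] A1[OF n] by (rule mono[OF k(3)])
    ultimately show "\<exists>k. k \<epsilon> omega \<and> ?A m \<sqsubseteq> ?A k \<and> ?A (succ n) \<sqsubseteq> ?A k" using k(1) succ_omega by blast
  qed
  define A where "A = bigcup (code {y. \<exists>n. n \<epsilon> omega \<and> y = ?A n})"
  have A: "z \<epsilon> A \<longleftrightarrow> (\<exists>n. n \<epsilon> omega \<and> z \<epsilon> ?A n)" for z
    unfolding A_def mem_bigcup mem_code[OF is_set_nrec_image[OF F1_A F2_H]] by blast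
  have "null \<epsilon> A" unfolding A using A0 by (intro exI[of _ null]) simp
  moreover have "\<exists>z. z \<epsilon> A \<and> R z x y" if xy: "x \<epsilon> A" "y \<epsilon> A" for x y
  proof -
    obtain m n where mn: "m \<epsilon> omega" "x \<epsilon> ?A m" "n \<epsilon> omega" "y \<epsilon> ?A n" using xy A by blast
    obtain k where k: "k \<epsilon> omega" "?A m \<sqsubseteq> ?A k" "?A n \<sqsubseteq> ?A k" using directed[OF mn(1,3)] by blast
    obtain z where z: "R z x y" "\<forall>z'. R z' x y \<longrightarrow> V z \<sqsubseteq> V z'"
      using V_least[OF R1_R] total by blast
    then have "z \<epsilon> S x y" using S by blast
    then have "z \<epsilon> ?A (succ k)" unfolding A1[OF k(1)] H using sub_mem[OF k(2) mn(2)] sub_mem[OF k(3) mn(4)] by blast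
    then show ?thesis using z(1) A k(1) succ_omega by blast
  qed
  ultimately show ?thesis by blast
qed

text \<open>Unary choice on the set of pairs over \<open>A\<close>, with arguments recovered by
  \<open>first\<close> and \<open>second\<close>.\<close>

lemma choice2:
  assumes R: "R3 R" and ex: "\<And>x y. x \<epsilon> A \<Longrightarrow> y \<epsilon> A \<Longrightarrow> \<exists>z. z \<epsilon> A \<and> R z x y"
  shows "\<exists>W. F2 W \<and> (\<forall>x y. x \<epsilon> A \<longrightarrow> y \<epsilon> A \<longrightarrow> W x y \<epsilon> A \<and> R (W x y) x y)"
proof -
  have Q: "R2 (\<lambda>q z. R z (first q) (second q))" unfolding R2_def by (intro dfs R3_app[OF R])
  define P where "P = code {q. \<exists>x y. x \<epsilon> A \<and> y \<epsilon> A \<and> q = pair x y}"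
  have P: "q \<epsilon> P \<longleftrightarrow> (\<exists>x y. x \<epsilon> A \<and> y \<epsilon> A \<and> q = pair x y)" for q
    unfolding P_def by (simp only: mem_code[OF is_set_image2[OF F2_pair]] mem_Collect_eq)
  have "\<exists>w. F1 w \<and> (\<forall>q. q \<epsilon> P \<longrightarrow> w q \<epsilon> A \<and> R (w q) (first q) (second q))"
    by (rule choice[OF Q]) (use ex P in auto)
  then obtain w where w: "F1 w" "\<And>q. q \<epsilon> P \<Longrightarrow> w q \<epsilon> A \<and> R (w q) (first q) (second q)" by blast
  have "F2 (\<lambda>x y. w (pair x y))" unfolding F2_def by (intro dfs F1_app[OF w(1)])
  moreover have "w (pair x y) \<epsilon> A \<and> R (w (pair x y)) x y" if "x \<epsilon> A" "y \<epsilon> A" for x y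
    using w(2)[of "pair x y"] P that by auto
  ultimately show ?thesis by blast
qed

text \<open>The enumeration is the least relation \<open>e\<close> that contains \<open>(0, 0)\<close> and with \<open>(m, x)\<close> and
  \<open>(n, y)\<close> also \<open>(2\<^sup>m (2 n + 1) + 1, W x y)\<close>.\<close>

lemma enumerated_closure:
  assumes W: "F2 W" and A: "null \<epsilon> A" "\<And>x y. x \<epsilon> A \<Longrightarrow> y \<epsilon> A \<Longrightarrow> W x y \<epsilon> A"
  shows "\<exists>e. pair null null \<epsilon> e \<and>
    (\<forall>m x n y. pair m x \<epsilon> e \<longrightarrow> pair n y \<epsilon> e \<longrightarrow> pair (succ (npair m n)) (W x y) \<epsilon> e) \<and>
    (\<forall>q. q \<epsilon> e \<longrightarrow> (\<exists>k x. k \<epsilon> omega \<and> x \<epsilon> A \<and> q = pair k x)) \<and>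
    (\<forall>k x y. pair k x \<epsilon> e \<longrightarrow> pair k y \<epsilon> e \<longrightarrow> x = y)"
proof -
  define C where "C X \<longleftrightarrow> pair null null \<epsilon> X \<and>
    (\<forall>m x n y. pair m x \<epsilon> X \<longrightarrow> pair n y \<epsilon> X \<longrightarrow> pair (succ (npair m n)) (W x y) \<epsilon> X)" for X
  have R1_C: "R1 C" unfolding R1_def C_def by (intro dfs F2_app[OF W])
  \<comment> \<open>The set of all pairs over \<open>omega\<close> and \<open>A\<close> is closed,
    so the intersection of all closed sets is a set and consists of such pairs.\<close>
  define E0 where "E0 = code {q. \<exists>x y. x \<epsilon> omega \<and> y \<epsilon> A \<and> q = pair x y}"
  have E0: "q \<epsilon> E0 \<longleftrightarrow> (\<exists>x y. x \<epsilon> omega \<and> y \<epsilon> A \<and> q = pair x y)" for q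
    unfolding E0_def by (simp only: mem_code[OF is_set_image2[OF F2_pair]] mem_Collect_eq)
  have C_E0: "C E0" unfolding C_def E0 using A npair_omega succ_omega by simp
  define e where "e = code {q. \<forall>X. C X \<longrightarrow> q \<epsilon> X}"
  have e: "q \<epsilon> e \<longleftrightarrow> (\<forall>X. C X \<longrightarrow> q \<epsilon> X)" for q
  proof -
    have "is_set {q. \<forall>X. C X \<longrightarrow> q \<epsilon> X}"
      by (rule is_set_subset[OF is_set_mem[of E0]], unfold R1_def, intro dfs R1_app[OF R1_C]) (use C_E0 in blast)
    then show ?thesis unfolding e_def by (simp add: mem_code)
  qed
  have base: "pair null null \<epsilon> e" unfolding e by (simp add: C_def)
  have step: "pair (succ (npair m n)) (W x y) \<epsilon> e" if "pair m x \<epsilon> e" "pair n y \<epsilon> e" for m x n y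
    using that unfolding e C_def by blast
  have e_sub: "\<exists>k x. k \<epsilon> omega \<and> x \<epsilon> A \<and> q = pair k x" if "q \<epsilon> e" for q
    using that C_E0 unfolding e E0[symmetric] by blast
  have e_induct: "P q" if P: "R1 P" and q: "q \<epsilon> e" and b: "P (pair null null)"
    and s: "\<And>m x n y. pair m x \<epsilon> e \<Longrightarrow> pair n y \<epsilon> e \<Longrightarrow> P (pair m x) \<Longrightarrow> P (pair n y) \<Longrightarrow>
              P (pair (succ (npair m n)) (W x y))" for P q
  proof -
    define X where "X = code {q. q \<epsilon> e \<and> P q}"
    have X: "q \<epsilon> X \<longleftrightarrow> q \<epsilon> e \<and> P q" for q
      unfolding X_def by (simp add: mem_code[OF separation[OF P]])
    have "C X" unfolding C_def X using base step b s by blast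
    then show ?thesis using q X e by blast
  qed
  have inv: "q = pair null null \<or> (\<exists>m x n y. pair m x \<epsilon> e \<and> pair n y \<epsilon> e \<and> q = pair (succ (npair m n)) (W x y))"
    if "q \<epsilon> e" for q
    by (rule e_induct[OF _ that], unfold R1_def, intro dfs F2_app[OF W]) blast+
  \<comment> \<open>Each index arises in one way: 0 only from the base, and
    \<open>succ (npair m n)\<close> determines m and n. \<open>first\<close> and
    \<open>second\<close> turn the claim into a property of the single element q, as
    \<open>e_induct\<close> requires.\<close>
  have "\<forall>x'. pair (first q) x' \<epsilon> e \<longrightarrow> x' = second q" if "q \<epsilon> e" for q
  proof (rule e_induct[OF _ that])
    show "R1 (\<lambda>q. \<forall>x'. pair (first q) x' \<epsilon> e \<longrightarrow> x' = second q)" unfolding R1_def by (intro dfs)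
    show "\<forall>x'. pair (first (pair null null)) x' \<epsilon> e \<longrightarrow> x' = second (pair null null)"
      using inv by fastforce
    fix m x n y
    assume mx: "pair m x \<epsilon> e" and ny: "pair n y \<epsilon> e"
      and "\<forall>x'. pair (first (pair m x)) x' \<epsilon> e \<longrightarrow> x' = second (pair m x)"
      and "\<forall>x'. pair (first (pair n y)) x' \<epsilon> e \<longrightarrow> x' = second (pair n y)"
    then have IH: "pair m x' \<epsilon> e \<Longrightarrow> x' = x" "pair n y' \<epsilon> e \<Longrightarrow> y' = y" for x' y' by simp_all
    have omega: "k \<epsilon> omega" if "pair k z \<epsilon> e" for k z using e_sub[OF that] by auto
    show "\<forall>x'. pair (first (pair (succ (npair m n)) (W x y))) x' \<epsilon> e \<longrightarrow> x' = second (pair (succ (npair m n)) (W x y))"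
    proof (intro allI impI)
      fix x' assume "pair (first (pair (succ (npair m n)) (W x y))) x' \<epsilon> e"
      then have "pair (succ (npair m n)) x' \<epsilon> e" by simp
      from inv[OF this] obtain m' a n' b where *: "pair m' a \<epsilon> e" "pair n' b \<epsilon> e"
        "npair m n = npair m' n'" "x' = W a b" by auto
      have "m = m' \<and> n = n'" using npair_inj[OF omega[OF ny] omega[OF *(2)] omega[OF mx]] omega[OF *(1)] *(3) by blast
      then show "x' = second (pair (succ (npair m n)) (W x y))" using IH * by simp
    qed
  qed
  then have "x = y" if "pair k x \<epsilon> e" "pair k y \<epsilon> e" for k x y
    using that by fastforce
  then show ?thesis using base step e_sub by blast
qed

text \<open>Witness functions can be chosen only on a set, so a closed set \<open>A\<close> comes
  first. The closure of \<open>null\<close> under the chosen function then keeps the closure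
  property and is enumerated by \<open>e\<close>.\<close>

lemma countable_hull:
  assumes R: "R3 R" and total: "\<And>x y. \<exists>z. R z x y"
  shows "\<exists>N e. null \<epsilon> N \<and> (\<forall>x y. x \<epsilon> N \<longrightarrow> y \<epsilon> N \<longrightarrow> (\<exists>z. z \<epsilon> N \<and> R z x y)) \<and>
    (\<forall>x. x \<epsilon> N \<longrightarrow> (\<exists>k. k \<epsilon> omega \<and> pair k x \<epsilon> e)) \<and>
    (\<forall>k x y. pair k x \<epsilon> e \<longrightarrow> pair k y \<epsilon> e \<longrightarrow> x = y)"
proof -
  obtain A where A: "null \<epsilon> A" "\<And>x y. x \<epsilon> A \<Longrightarrow> y \<epsilon> A \<Longrightarrow> \<exists>z. z \<epsilon> A \<and> R z x y"
    using closed_set[OF assms] by blast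
  obtain W where W: "F2 W" "\<And>x y. x \<epsilon> A \<Longrightarrow> y \<epsilon> A \<Longrightarrow> W x y \<epsilon> A \<and> R (W x y) x y"
    using choice2[OF R A(2)] by blast
  obtain e where e: "pair null null \<epsilon> e"
    "\<And>m x n y. pair m x \<epsilon> e \<Longrightarrow> pair n y \<epsilon> e \<Longrightarrow> pair (succ (npair m n)) (W x y) \<epsilon> e"
    "\<And>q. q \<epsilon> e \<Longrightarrow> \<exists>k x. k \<epsilon> omega \<and> x \<epsilon> A \<and> q = pair k x"
    "\<forall>k x y. pair k x \<epsilon> e \<longrightarrow> pair k y \<epsilon> e \<longrightarrow> x = y"
    using enumerated_closure[OF W(1) A(1)] W(2) by blast
  define N where "N = code {x. \<exists>k. pair k x \<epsilon> e}"
  have sub: "k \<epsilon> omega \<and> x \<epsilon> A" if "pair k x \<epsilon> e" for k x using e(3)[OF that] by auto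
  have N: "x \<epsilon> N \<longleftrightarrow> (\<exists>k. pair k x \<epsilon> e)" for x
  proof -
    have "is_set {x. \<exists>k. pair k x \<epsilon> e}"
      by (rule is_set_subset[OF is_set_mem[of A]], unfold R1_def, intro dfs) (use sub in blast)
    then show ?thesis unfolding N_def by (simp add: mem_code)
  qed
  have "null \<epsilon> N" using N e(1) by blast
  moreover have "\<exists>z. z \<epsilon> N \<and> R z x y" if xy: "x \<epsilon> N" "y \<epsilon> N" for x y
  proof -
    obtain m n where mn: "pair m x \<epsilon> e" "pair n y \<epsilon> e" using xy N by blast
    then have "W x y \<epsilon> N" using e(2) N by blast
    then show ?thesis using W(2) sub[OF mn(1)] sub[OF mn(2)] by blast
  qed
  moreover have "\<exists>k. k \<epsilon> omega \<and> pair k x \<epsilon> e" if "x \<epsilon> N" for x using that N sub by blast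
  ultimately show ?thesis using e(4) by blast
qed

section \<open>Meaning in the model of the formulas about \<open>v\<close>\<close>

lemma sat_upair_fm: "sat UNIV (\<epsilon>) I e (upair_fm s t p) \<longleftrightarrow> tval I e p = upair (tval I e s) (tval I e t)"
proof -
  have "sat UNIV (\<epsilon>) I e (upair_fm s t p) \<longleftrightarrow>
      (\<forall>x. x \<epsilon> tval I e p \<longleftrightarrow> x \<epsilon> upair (tval I e s) (tval I e t))"
    by (auto simp: upair_fm_def)
  then show ?thesis using Ext by auto
qed

lemma sat_opair_fm: "sat UNIV (\<epsilon>) I e (opair_fm s t p) \<longleftrightarrow> tval I e p = pair (tval I e s) (tval I e t)"
  by (simp add: opair_fm_def sat_upair_fm pair_def)

lemma sat_maps_fm: "sat UNIV (\<epsilon>) I e (maps_fm f s t) \<longleftrightarrow> pair (tval I e s) (tval I e t) \<epsilon> tval I e f"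
  by (simp add: maps_fm_def sat_opair_fm)

lemma sat_omega_fm: "sat UNIV (\<epsilon>) I e (omega_fm t) \<longleftrightarrow> tval I e t = omega"
proof -
  have "sat UNIV (\<epsilon>) I e (omega_fm t) \<longleftrightarrow> (null \<epsilon> tval I e t \<and> (\<forall>m. m \<epsilon> tval I e t \<longrightarrow> succ m \<epsilon> tval I e t)) \<and>
     (\<forall>J. null \<epsilon> J \<and> (\<forall>m. m \<epsilon> J \<longrightarrow> succ m \<epsilon> J) \<longrightarrow> tval I e t \<sqsubseteq> J)" (is "_ \<longleftrightarrow> ?P (tval I e t)")
    by (simp add: omega_fm_def sat_inductive_fm sat_subset_fm) blast
  also have "?P x \<longleftrightarrow> x = omega" for x
  proof
    assume x: "?P x"
    show "x = omega"
    proof (rule Ext)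
      show "y \<epsilon> x \<longleftrightarrow> y \<epsilon> omega" for y using x null_omega succ_omega unfolding sub_def mem_omega[of y] by blast
    qed
  next
    assume "x = omega"
    then show "?P x" using mem_omega by (auto simp: sub_def)
  qed
  finally show ?thesis .
qed

lemma sat_transitive_fm: "sat UNIV (\<epsilon>) I e (transitive_fm t) \<longleftrightarrow> (\<forall>x. x \<epsilon> tval I e t \<longrightarrow> x \<sqsubseteq> tval I e t)"
  by (simp add: transitive_fm_def sat_subset_fm)

text \<open>The formula asks for an injection that is a set; Replacement provides the graph of the
  definable \<open>w\<close> on \<open>v\<close>.\<close>

lemma sat_countable_fm:
  assumes w: "F1 w" "\<And>x. x \<epsilon> v \<Longrightarrow> w x \<epsilon> omega" "\<And>x y. x \<epsilon> v \<Longrightarrow> y \<epsilon> v \<Longrightarrow> w x = w y \<Longrightarrow> x = y"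
    and t: "tval I e t = v"
  shows "sat UNIV (\<epsilon>) I e (countable_fm t)"
proof -
  define f where "f = code {q. \<exists>x. x \<epsilon> v \<and> q = pair x (w x)}"
  have "F1 (\<lambda>x. pair x (w x))" unfolding F1_def by (intro dfs F1_app[OF w(1)])
  from mem_code[OF replacement[OF this]] have f: "q \<epsilon> f \<longleftrightarrow> (\<exists>x. x \<epsilon> v \<and> q = pair x (w x))" for q
    unfolding f_def by simp
  have fp: "pair x y \<epsilon> f \<longleftrightarrow> x \<epsilon> v \<and> y = w x" for x y
    unfolding f by auto
  have 1: "\<forall>q. q \<epsilon> f \<longrightarrow> (\<exists>a b. a \<epsilon> v \<and> b \<epsilon> omega \<and> q = pair a b)" using f w by blast
  have 2: "\<forall>a. a \<epsilon> v \<longrightarrow> (\<exists>b. pair a b \<epsilon> f)" using fp by blast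
  have 3: "\<forall>a b c. pair a b \<epsilon> f \<and> pair a c \<epsilon> f \<longrightarrow> b = c" by (simp add: fp)
  have 4: "\<forall>a b c. pair a c \<epsilon> f \<and> pair b c \<epsilon> f \<longrightarrow> a = b" using w(3) by (simp add: fp)
  show ?thesis
    unfolding countable_fm_def injection_fm_def
    by (simp only: sat.simps sat_omega_fm sat_opair_fm sat_maps_fm tval.simps tval_tlift t
        eval_nat_numeral One_nat_def nat.case ball_UNIV BitM.simps numeral_One connectives)
      (rule exI[of _ omega], rule exI[of _ f], use 1 2 3 4 in blast)
qed

end

section \<open>Countable transitive models of finitely many axioms\<close>

text \<open>The formulas directly under a quantifier, which are those for which the Tarski-Vaught
  test demands witnesses.\<close>

primrec bodies :: "'c fm \<Rightarrow> 'c fm set" where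
  "bodies Fls = {}"
| "bodies (s \<^bold>= t) = {}"
| "bodies (s \<^bold>\<in> t) = {}"
| "bodies (p \<^bold>\<longrightarrow> q) = bodies p \<union> bodies q"
| "bodies (\<^bold>\<forall>p) = insert p (bodies p)"

lemma finite_bodies: "finite (bodies p)"
  by (induction p) auto

lemma csyms_bodies: "q \<in> bodies p \<Longrightarrow> csyms p = {} \<Longrightarrow> csyms q = {}"
  by (induction p) auto

text \<open>The quantifier \<open>All\<close> is primitive, so the test is phrased with
  counterexamples: a body that fails anywhere must fail somewhere in \<open>D\<close>.\<close>

lemma tarski_vaught:
  assumes "\<And>q e. q \<in> B \<Longrightarrow> (\<And>n. e n \<in> D) \<Longrightarrow> (\<exists>z. \<not> sat UNIV E I (case_nat z e) q) \<Longrightarrow>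
      \<exists>z\<in>D. \<not> sat UNIV E I (case_nat z e) q"
  shows "bodies p \<subseteq> B \<Longrightarrow> (\<And>n. e n \<in> D) \<Longrightarrow> sat D E I e p = sat UNIV E I e p"
proof (induction p arbitrary: e)
  case (All p)
  have "sat D E I (case_nat z e) p = sat UNIV E I (case_nat z e) p" if "z \<in> D" for z
    by (rule All.IH) (use All.prems that in \<open>auto split: nat.splits\<close>)
  then have "sat D E I e (\<^bold>\<forall>p) \<longleftrightarrow> (\<forall>z\<in>D. sat UNIV E I (case_nat z e) p)" by simp
  also have "\<dots> \<longleftrightarrow> (\<forall>z. sat UNIV E I (case_nat z e) p)"
    using assms[of p e] All.prems by auto
  finally show ?case by simp
qed auto

context zfc
begin

text \<open>The index is a natural number of the metatheory, so this is a finite disjunction of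
  possibly unrelated formulas.\<close>

lemma df_Ex_less: "(\<And>i. df (P i)) \<Longrightarrow> df (\<lambda>e. \<exists>i<n. P i e)" for n :: nat
proof (induction n)
  case 0
  show ?case using df_const[of False] by simp
next
  case (Suc n)
  have "df (\<lambda>e. (\<exists>i<n. P i e) \<or> P n e)" using Suc by (intro df_disj) auto
  then show ?case by (simp add: less_Suc_eq ex_disj_distrib conj_disj_distribR)
qed

text \<open>Formula \<open>i\<close> with the parameters \<open>e 0, ..., e (k - 1)\<close> is coded by the element
  \<open>pair (tag i) (tup k e)\<close>, so that one ternary relation \<open>R\<close> can ask both for witnesses and for pairs.\<close>

primrec tag :: "nat \<Rightarrow> 'a" where
  "tag 0 = succ null"
| "tag (Suc i) = pair null (tag i)"

primrec proj :: "nat \<Rightarrow> 'a \<Rightarrow> 'a" where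
  "proj 0 t = first t"
| "proj (Suc n) t = proj n (second t)"

primrec tup :: "nat \<Rightarrow> (nat \<Rightarrow> 'a) \<Rightarrow> 'a" where
  "tup 0 e = succ null"
| "tup (Suc k) e = pair (e 0) (tup k (\<lambda>n. e (Suc n)))"

lemma pair_ne_one: "pair null x \<noteq> succ null"
proof
  assume "pair null x = succ null"
  then have "upair null null \<epsilon> succ null" using mem_upair[of "upair null null" "upair null null"] unfolding pair_def by metis
  then have "upair null null = null" by simp
  then show False using mem_upair[of null null null] not_mem_null by metis
qed

lemma tag_inj: "tag i = tag j \<Longrightarrow> i = j"
proof (induction i arbitrary: j)
  case 0
  then show ?case using pair_ne_one by (cases j) (auto dest: sym)
next
  case (Suc i)
  then show ?case using pair_ne_one by (cases j) auto
qed

lemma F1_proj: "F1 (proj n)"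
proof (induction n)
  case 0
  show ?case unfolding F1_def by (simp, intro dfs)
next
  case (Suc n)
  show ?case unfolding F1_def by (simp, intro dfs F1_app[OF Suc])
qed

lemma proj_tup: "n < k \<Longrightarrow> proj n (tup k e) = e n"
proof (induction k arbitrary: n e)
  case (Suc k)
  then show ?case by (cases n) auto
qed simp

text \<open>\<open>null\<close> is reserved: as second argument of the relation in
  \<open>elementary_hull\<close> it signals a request for a witness. For this reason tags and tuples
  start from \<open>succ null\<close>.\<close>

lemma tag_ne_null: "tag i \<noteq> null" by (cases i) auto
lemma tup_ne_null: "tup k e \<noteq> null" by (cases k) auto

text \<open>\<open>countable_hull\<close> handles binary requests, whereas a formula has any number
  of parameters. They are packed into tuples, which belong to the hull because it is also made to
  answer requests for pairs.\<close>

lemma elementary_hull: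
  fixes Q :: "'c fm set"
  assumes Q: "finite Q" "\<forall>q\<in>Q. csyms q = {}"
  shows "\<exists>N e. null \<epsilon> N \<and>
    (\<forall>q s. q \<in> Q \<longrightarrow> (\<forall>n. s n \<epsilon> N) \<longrightarrow> (\<exists>z. \<not> sat UNIV (\<epsilon>) I (case_nat z s) q) \<longrightarrow>
      (\<exists>z. z \<epsilon> N \<and> \<not> sat UNIV (\<epsilon>) I (case_nat z s) q)) \<and>
    (\<forall>x. x \<epsilon> N \<longrightarrow> (\<exists>k. k \<epsilon> omega \<and> pair k x \<epsilon> e)) \<and>
    (\<forall>k x y. pair k x \<epsilon> e \<longrightarrow> pair k y \<epsilon> e \<longrightarrow> x = y)"
proof -
  obtain qs where qs: "set qs = Q" using finite_list[OF Q(1)] by blast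
  \<comment> \<open>z is a counterexample to the formula whose code is t. Parameters are read off
    the tuple by \<open>proj\<close>, so the relation is definable although their number differs
    between formulas.\<close>
  define R0 where "R0 z t \<longleftrightarrow> (\<exists>i<length qs. first t = tag i \<and>
     \<not> sat UNIV (\<epsilon>) id (case_nat z (\<lambda>n. proj n (second t))) (ftr (\<lambda>_. 0) (qs ! i) :: 'a fm))" for z t
  have R2_R0: "R2 R0"
  proof -
    have "df (\<lambda>e. sat UNIV (\<epsilon>) id (\<lambda>n. case_nat (\<lambda>e. e 0) (\<lambda>n e. proj n (second (e (Suc 0)))) n e) p)" for p
    proof (rule df_sat)
      have "dff (\<lambda>e. proj n (second (e (Suc 0))))" for n by (intro dfs F1_app[OF F1_proj])
      then show "dff (case_nat (\<lambda>e. e 0) (\<lambda>n e. proj n (second (e (Suc 0)))) n)" for n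
        using dff_Var by (auto split: nat.splits)
    qed
    moreover have "(\<lambda>n. case_nat (\<lambda>e. e 0) (\<lambda>n e. proj n (second (e (Suc 0)))) n e) =
        case_nat (e 0) (\<lambda>n. proj n (second (e (Suc 0))))" for e :: "nat \<Rightarrow> 'a"
      by (auto split: nat.splits)
    ultimately have "df (\<lambda>e. sat UNIV (\<epsilon>) id (case_nat (e 0) (\<lambda>n. proj n (second (e (Suc 0))))) p)" for p
      by simp
    then show ?thesis unfolding R2_def R0_def by (intro df_Ex_less dfs)
  qed
  \<comment> \<open>Three kinds of request: (\<open>null\<close>, \<open>null\<close>) yields
    \<open>succ null\<close>, the start of tags and tuples; (x, \<open>null\<close>) yields a
    counterexample for the code x, with \<open>null\<close> as default to keep the relation total;
    any other y yields the pair.\<close>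
  define R where "R z x y \<longleftrightarrow> (y = null \<and> x = null \<and> z = succ null) \<or>
    (y = null \<and> x \<noteq> null \<and> (R0 z x \<or> \<not> (\<exists>z. R0 z x) \<and> z = null)) \<or> (y \<noteq> null \<and> z = pair x y)" for z x y
  have R3_R: "R3 R" unfolding R3_def R_def by (intro dfs R2_app[OF R2_R0])
  have total: "\<exists>z. R z x y" for x y
  proof (cases "y = null")
    case y: True
    show ?thesis
    proof (cases "x = null")
      case True
      then have "R (succ null) x y" using y by (simp add: R_def)
      then show ?thesis ..
    next
      case False
      then have "R (if \<exists>z. R0 z x then SOME z. R0 z x else null) x y"
        using y by (auto simp: R_def intro: someI)
      then show ?thesis ..
    qed
  next
    case False
    then have "R (pair x y) x y" by (simp add: R_def)
    then show ?thesis ..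
  qed
  obtain N e where N: "null \<epsilon> N" "\<And>x y. x \<epsilon> N \<Longrightarrow> y \<epsilon> N \<Longrightarrow> \<exists>z. z \<epsilon> N \<and> R z x y"
    and e: "\<forall>x. x \<epsilon> N \<longrightarrow> (\<exists>k. k \<epsilon> omega \<and> pair k x \<epsilon> e)"
      "\<forall>k x y. pair k x \<epsilon> e \<longrightarrow> pair k y \<epsilon> e \<longrightarrow> x = y"
    using countable_hull[OF R3_R total] by (elim exE conjE) blast
  have one: "succ null \<epsilon> N" using N(2)[OF N(1) N(1)] unfolding R_def by auto
  have pair: "pair x y \<epsilon> N" if "x \<epsilon> N" "y \<epsilon> N" "y \<noteq> null" for x y
    using N(2)[OF that(1,2)] that(3) unfolding R_def by auto
  have R0: "\<exists>z. z \<epsilon> N \<and> R0 z x" if "x \<epsilon> N" "x \<noteq> null" "R0 z x" for x z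
    using N(2)[OF that(1) N(1)] that(2,3) unfolding R_def by auto
  have tag: "tag i \<epsilon> N" for i by (induction i) (auto simp: one pair N(1) tag_ne_null)
  have tup: "tup k s \<epsilon> N" if "\<forall>n. s n \<epsilon> N" for k s
    using that by (induction k arbitrary: s) (auto simp: one pair tup_ne_null)
  have "\<exists>z. z \<epsilon> N \<and> \<not> sat UNIV (\<epsilon>) I (case_nat z s) q"
    if q: "q \<in> Q" and s: "\<forall>n. s n \<epsilon> N" and z: "\<not> sat UNIV (\<epsilon>) I (case_nat z s) q" for q s z
  proof -
    obtain i where i: "i < length qs" "q = qs ! i" using q qs by (metis in_set_conv_nth)
    \<comment> \<open>A tuple of length \<open>k\<close> holds every parameter that can occur in
      \<open>q\<close>; the values of \<open>proj\<close> past its end do not affect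
      satisfaction.\<close>
    obtain k where k: "\<forall>n\<in>fv q. n < k" using finite_nat_set_iff_bounded finite_fv by blast
    let ?t = "pair (tag i) (tup k s)"
    have eq: "sat UNIV (\<epsilon>) id (case_nat z (\<lambda>n. proj n (tup k s))) (ftr (\<lambda>_. 0) q :: 'a fm)
        = sat UNIV (\<epsilon>) I (case_nat z s) q" for z
    proof -
      have "sat UNIV (\<epsilon>) id (case_nat z (\<lambda>n. proj n (tup k s))) (ftr (\<lambda>_. 0) q :: 'a fm)
        = sat UNIV (\<epsilon>) I (case_nat z (\<lambda>n. proj n (tup k s))) q"
        by (rule sat_ftr) (use Q(2) q in simp)
      also have "\<dots> = sat UNIV (\<epsilon>) I (case_nat z s) q"
        by (rule sat_cong) (use k proj_tup Suc_lessD in \<open>auto split: nat.splits\<close>)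
      finally show ?thesis .
    qed
    have R0_iff: "R0 z ?t \<longleftrightarrow> \<not> sat UNIV (\<epsilon>) I (case_nat z s) q" for z
    proof -
      have "tag i = tag j \<longleftrightarrow> j = i" for j using tag_inj by blast
      then show ?thesis unfolding R0_def using i eq by auto
    qed
    have "?t \<epsilon> N" using pair tag tup[OF s] tup_ne_null by blast
    then show ?thesis using R0[of ?t z] z unfolding R0_iff by simp
  qed
  then show ?thesis using N(1) e by (intro exI[of _ N] exI[of _ e]) blast
qed

section \<open>The Mostowski collapse\<close>

lemma F3_snd: "F3 (\<lambda>p x s. s)" unfolding F3_def by (intro dfs)
lemma R2_mem: "R2 (\<lambda>p u. u \<epsilon> p)" unfolding R2_def by (intro dfs)

text \<open>The step returns the set of earlier values itself. \<open>N\<close> is the parameter of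
  the recursion, which keeps the collapse definable in both arguments.\<close>

definition collapse :: "'a \<Rightarrow> 'a \<Rightarrow> 'a" where
  "collapse N x = recur (\<lambda>p u. u \<epsilon> p) (\<lambda>p x s. s) N x"

lemma F2_collapse: "F2 collapse"
  unfolding F2_def collapse_def by (intro dfs F2_app[OF F2_recur[OF R2_mem F3_snd]])
lemmas [dfs] = F2_app[OF F2_collapse]

lemma mem_induct:
  assumes P: "R1 P" and step: "\<And>x. x \<epsilon> N \<Longrightarrow> (\<And>u. u \<epsilon> x \<Longrightarrow> u \<epsilon> N \<Longrightarrow> P u) \<Longrightarrow> P x" and "x \<epsilon> N"
  shows "P x"
proof (rule ccontr)
  assume "\<not> P x"
  have "R1 (\<lambda>x. \<not> P x)" unfolding R1_def by (intro dfs R1_app[OF P])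
  from foundation[OF this \<open>x \<epsilon> N\<close> \<open>\<not> P x\<close>] show False using step by blast
qed

lemma mem_collapse: "x \<epsilon> N \<Longrightarrow> y \<epsilon> collapse N x \<longleftrightarrow> (\<exists>u. u \<epsilon> x \<and> u \<epsilon> N \<and> y = collapse N u)"
proof -
  assume x: "x \<epsilon> N"
  have "collapse N x = code {w. \<exists>u. u \<epsilon> x \<and> u \<epsilon> N \<and> w = collapse N u}"
    unfolding collapse_def
  proof (rule recur[where B = "\<lambda>p u. u \<epsilon> p" and p = N, OF R2_mem F3_snd])
    show "P x" if "R1 P" "\<And>x. x \<epsilon> N \<Longrightarrow> (\<And>u. u \<epsilon> x \<Longrightarrow> u \<epsilon> N \<Longrightarrow> P u) \<Longrightarrow> P x" "x \<epsilon> N" for P x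
      using that by (rule mem_induct)
    show "\<exists>d. (\<forall>u. u \<epsilon> x \<longrightarrow> u \<epsilon> N \<longrightarrow> u \<epsilon> d) \<and> (\<forall>u u'. u \<epsilon> d \<longrightarrow> u' \<epsilon> u \<longrightarrow> u' \<epsilon> N \<longrightarrow> u' \<epsilon> d)" for x
      by (rule exI[of _ N]) blast
  qed (rule x)
  then show ?thesis
    using mem_code[OF is_set_recur_image[OF R2_mem F3_snd, of x N]] unfolding collapse_def by simp
qed

text \<open>Elements with equal collapse have the same members within \<open>N\<close>: each member
  of one has a member of the other with equal collapse, and the two coincide by induction.\<close>

lemma collapse_inj:
  assumes ext: "\<And>x y. x \<epsilon> N \<Longrightarrow> y \<epsilon> N \<Longrightarrow> (\<And>z. z \<epsilon> N \<Longrightarrow> z \<epsilon> x \<longleftrightarrow> z \<epsilon> y) \<Longrightarrow> x = y"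
  shows "x \<epsilon> N \<Longrightarrow> \<forall>y. y \<epsilon> N \<longrightarrow> collapse N x = collapse N y \<longrightarrow> x = y"
proof (rule mem_induct[of "\<lambda>x. \<forall>y. y \<epsilon> N \<longrightarrow> collapse N x = collapse N y \<longrightarrow> x = y" N])
  show "R1 (\<lambda>x. \<forall>y. y \<epsilon> N \<longrightarrow> collapse N x = collapse N y \<longrightarrow> x = y)"
    unfolding R1_def by (intro dfs)
next
  fix x assume x: "x \<epsilon> N"
    and IH: "\<And>u. u \<epsilon> x \<Longrightarrow> u \<epsilon> N \<Longrightarrow> \<forall>y. y \<epsilon> N \<longrightarrow> collapse N u = collapse N y \<longrightarrow> u = y"
  show "\<forall>y. y \<epsilon> N \<longrightarrow> collapse N x = collapse N y \<longrightarrow> x = y"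
  proof (intro allI impI)
    fix y assume y: "y \<epsilon> N" and eq: "collapse N x = collapse N y"
    show "x = y"
    proof (rule ext[OF x y])
      fix z assume z: "z \<epsilon> N"
      show "z \<epsilon> x \<longleftrightarrow> z \<epsilon> y"
      proof
        assume "z \<epsilon> x"
        then have "collapse N z \<epsilon> collapse N y" using eq mem_collapse[OF x] z by metis
        then obtain u where "u \<epsilon> y" "u \<epsilon> N" "collapse N z = collapse N u" using mem_collapse[OF y] by blast
        then show "z \<epsilon> y" using IH[OF \<open>z \<epsilon> x\<close> z] by blast
      next
        assume "z \<epsilon> y"
        then have "collapse N z \<epsilon> collapse N x" using eq mem_collapse[OF y] z by metis
        \<comment> \<open>The induction hypothesis covers only members of x, so it is applied to the
          preimage u and not to z.\<close>
        then obtain u where "u \<epsilon> x" "u \<epsilon> N" "collapse N z = collapse N u" using mem_collapse[OF x] by blast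
        then show "z \<epsilon> x" using IH[of u] z by metis
      qed
    qed
  qed
qed auto

lemma countable_transitive_model:
  fixes T :: "csym fm set"
  assumes T: "finite T" "T \<subseteq> ZFC" "\<And>p. p \<in> T \<Longrightarrow> sentence {} p"
  shows "\<exists>v. sat UNIV (\<epsilon>) (\<lambda>_. v) e (countable_fm (Cst v_sym)) \<and>
    sat UNIV (\<epsilon>) (\<lambda>_. v) e (transitive_fm (Cst v_sym)) \<and>
    (\<forall>p\<in>T. \<forall>I e. sat {x. x \<epsilon> v} (\<epsilon>) I e p)"
proof -
  \<comment> \<open>With Extensionality among the formulas reflected, \<open>N\<close> is
    extensional, as injectivity of the collapse demands.\<close>
  define T' where "T' = insert Extensionality T"
  have T': "finite T'" "T' \<subseteq> ZFC" "\<And>p. p \<in> T' \<Longrightarrow> csyms p = {} \<and> fv p = {}"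
    using T by (auto simp: T'_def ZFC_def sentence_def Extensionality_def)
  define Q where "Q = (\<Union>p\<in>T'. bodies p)"
  have Q: "finite Q" "\<forall>q\<in>Q. csyms q = {}"
    using T' finite_bodies csyms_bodies unfolding Q_def by blast+
  obtain N en where zN: "null \<epsilon> N" and N:
    "\<forall>q s. q \<in> Q \<longrightarrow> (\<forall>n. s n \<epsilon> N) \<longrightarrow> (\<exists>z. \<not> sat UNIV (\<epsilon>) undefined (case_nat z s) q) \<longrightarrow>
      (\<exists>z. z \<epsilon> N \<and> \<not> sat UNIV (\<epsilon>) undefined (case_nat z s) q)"
    and en: "\<And>x. x \<epsilon> N \<Longrightarrow> \<exists>k. k \<epsilon> omega \<and> pair k x \<epsilon> en"
      "\<And>k x y. pair k x \<epsilon> en \<Longrightarrow> pair k y \<epsilon> en \<Longrightarrow> x = y"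
    using elementary_hull[where I = undefined, OF Q] by (elim exE conjE) blast
  let ?D = "{x. x \<epsilon> N}"
  \<comment> \<open>The axioms are sentences; the valuation with constant value \<open>null\<close>
    is chosen because it takes its values in \<open>N\<close>.\<close>
  have sat_N: "sat ?D (\<epsilon>) undefined (\<lambda>_. null) p" if "p \<in> T'" for p
  proof -
    have "sat ?D (\<epsilon>) undefined (\<lambda>_. null) p = sat UNIV (\<epsilon>) undefined (\<lambda>_. null) p"
      by (rule tarski_vaught[of Q]) (use N zN that in \<open>auto simp: Q_def\<close>)
    then show ?thesis using ZFC T'(2) that by blast
  qed
  have ext: "x = y" if "x \<epsilon> N" "y \<epsilon> N" "\<And>z. z \<epsilon> N \<Longrightarrow> z \<epsilon> x \<longleftrightarrow> z \<epsilon> y" for x y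
  proof -
    have "sat ?D (\<epsilon>) undefined (\<lambda>_. null) (Extensionality :: csym fm)" by (rule sat_N) (simp add: T'_def)
    then show ?thesis using that by (auto simp: Extensionality_def eval_nat_numeral)
  qed
  define v where "v = code {y. \<exists>x. x \<epsilon> N \<and> y = collapse N x}"
  have "F1 (collapse N)" unfolding F1_def by (intro dfs)
  from mem_code[OF replacement[OF this]] have v: "y \<epsilon> v \<longleftrightarrow> (\<exists>x. x \<epsilon> N \<and> y = collapse N x)" for y
    unfolding v_def by simp
  have inj: "collapse N x = collapse N y \<Longrightarrow> x = y" if "x \<epsilon> N" "y \<epsilon> N" for x y
    using collapse_inj[OF ext] that by blast
  have iso: "collapse N x \<epsilon> collapse N y \<longleftrightarrow> x \<epsilon> y" if "x \<epsilon> N" "y \<epsilon> N" for x y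
    using mem_collapse[OF that(2)] inj[OF that(1)] that(1) by blast
  have "sat UNIV (\<epsilon>) (\<lambda>_. v) e (transitive_fm (Cst v_sym))"
    unfolding sat_transitive_fm sub_def tval.simps 
  proof (intro allI impI)
    fix y z assume yz: "y \<epsilon> v" "z \<epsilon> y"
    obtain x where x: "x \<epsilon> N" "y = collapse N x" using yz(1) unfolding v by (elim exE conjE)
    obtain u where "u \<epsilon> N" "z = collapse N u"
      using yz(2) unfolding x(2) mem_collapse[OF x(1)] by (elim exE conjE)
    then show "z \<epsilon> v" using v by blast
  qed
  moreover have "sat UNIV (\<epsilon>) (\<lambda>_. v) e (countable_fm (Cst v_sym))"
  proof -
    \<comment> \<open>Choice picks for u an index of its preimage under the collapse. Equal indices
      give equal preimages because \<open>en\<close> is single-valued, so the picked function is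
      injective.\<close>
    have "R2 (\<lambda>u k. \<exists>x. x \<epsilon> N \<and> u = collapse N x \<and> pair k x \<epsilon> en)" unfolding R2_def by (intro dfs)
    moreover have "\<exists>k. k \<epsilon> omega \<and> (\<exists>x. x \<epsilon> N \<and> u = collapse N x \<and> pair k x \<epsilon> en)" if "u \<epsilon> v" for u
    proof -
      obtain x where x: "x \<epsilon> N" "u = collapse N x" using \<open>u \<epsilon> v\<close> v by blast
      then show ?thesis using en(1)[OF x(1)] by blast
    qed
    ultimately have "\<exists>w. F1 w \<and>
      (\<forall>u. u \<epsilon> v \<longrightarrow> w u \<epsilon> omega \<and> (\<exists>x. x \<epsilon> N \<and> u = collapse N x \<and> pair (w u) x \<epsilon> en))"
      by (rule choice)
    then obtain w where w: "F1 w"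
      "\<And>u. u \<epsilon> v \<Longrightarrow> w u \<epsilon> omega \<and> (\<exists>x. x \<epsilon> N \<and> u = collapse N x \<and> pair (w u) x \<epsilon> en)"
      by blast
    show ?thesis
    proof (rule sat_countable_fm[OF w(1)])
      show "w x \<epsilon> omega" if "x \<epsilon> v" for x using w(2) that by blast
      show "x = y" if "x \<epsilon> v" "y \<epsilon> v" "w x = w y" for x y
        using w(2)[OF that(1)] w(2)[OF that(2)] that(3) en(2) by metis
    qed simp
  qed
  moreover have "sat {x. x \<epsilon> v} (\<epsilon>) I e p" if p: "p \<in> T" for p I e
  proof -
    have pT: "p \<in> T'" "csyms p = {}" "fv p = {}" using p T'(3) by (auto simp: T'_def)
    have "bij_betw (collapse N) ?D {x. x \<epsilon> v}"
      unfolding bij_betw_def inj_on_def using inj v by blast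
    then have "sat {x. x \<epsilon> v} (\<epsilon>) I (\<lambda>n. collapse N null) p = sat ?D (\<epsilon>) undefined (\<lambda>n. null) p"
      by (rule sat_iso) (use iso pT in auto)
    then show ?thesis using sat_N[OF pT(1)] sat_cong[of p "\<lambda>n. collapse N null" e I I] pT by auto
  qed
  ultimately show ?thesis by blast
qed

end

section \<open>Conservativity\<close>

text \<open>Infinity of the domain lets us replace it by the whole type of natural numbers.\<close>

lemma infinite_domain:
  fixes D :: "'a set" and I :: "'c \<Rightarrow> 'a"
  assumes "D \<noteq> {}" and "sat D E I e Pairing" "sat D E I e Union_ax" "sat D E I e Foundation"
  shows "infinite D"
proof
  assume fin: "finite D"
  have pairing: "\<exists>p\<in>D. \<forall>x\<in>D. E x p \<longleftrightarrow> x = a \<or> x = b" if "a \<in> D" "b \<in> D" for a b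
    using assms(2) that unfolding Pairing_def upair_fm_def
    by (simp only: sat.simps tval.simps tval_tlift eval_nat_numeral One_nat_def nat.case
        BitM.simps numeral_One connectives)
  have union: "\<exists>u\<in>D. \<forall>x\<in>D. E x u \<longleftrightarrow> (\<exists>y\<in>D. E y a \<and> E x y)" if "a \<in> D" for a
    using assms(3) that unfolding Union_ax_def
    by (simp only: sat.simps tval.simps tval_tlift eval_nat_numeral One_nat_def nat.case
        BitM.simps numeral_One connectives)
  have foundation: "\<exists>m\<in>D. E m a \<and> \<not> (\<exists>y\<in>D. E y m \<and> E y a)" if "a \<in> D" "x \<in> D" "E x a" for a x
    using assms(4) that unfolding Foundation_def
    by (simp add: eval_nat_numeral) blast
  \<comment> \<open>Adding elements one at a time by pairing and union, a finite domain would have a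
    u with every element as a member, u included; the singleton of u then contradicts
    Foundation.\<close>
  have "\<exists>u\<in>D. \<forall>x\<in>F. E x u" if "F \<subseteq> D" for F
    using finite_subset[OF that fin] that
  proof (induction F rule: finite_induct)
    case empty
    then show ?case using assms(1) by blast
  next
    case (insert a F)
    then obtain u where u: "u \<in> D" "\<forall>x\<in>F. E x u" by blast
    obtain s where s: "s \<in> D" "\<forall>x\<in>D. E x s \<longleftrightarrow> x = a \<or> x = a" using pairing[of a a] insert.prems by blast
    obtain p where p: "p \<in> D" "\<forall>x\<in>D. E x p \<longleftrightarrow> x = u \<or> x = s" using pairing[OF u(1) s(1)] by blast
    obtain w where w: "w \<in> D" "\<forall>x\<in>D. E x w \<longleftrightarrow> (\<exists>y\<in>D. E y p \<and> E x y)" using union[OF p(1)] by blast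
    have "E x w" if "x \<in> insert a F" for x
    proof -
      have x: "x \<in> D" using that insert.prems by blast
      have "\<exists>y\<in>D. E y p \<and> E x y" using that u s p x by auto
      then show ?thesis using w x by blast
    qed
    then show ?case using w(1) by blast
  qed
  then obtain u where u: "u \<in> D" "\<forall>x\<in>D. E x u" by blast
  obtain s where s: "s \<in> D" "\<forall>x\<in>D. E x s \<longleftrightarrow> x = u \<or> x = u" using pairing[OF u(1) u(1)] by blast
  then have "E u s" using u by blast
  from foundation[OF s(1) u(1) this] obtain m where "m \<in> D" "E m s" "\<not> (\<exists>y\<in>D. E y m \<and> E y s)" by blast
  then have "m = u" using s by simp
  then show False using \<open>\<not> (\<exists>y\<in>D. E y m \<and> E y s)\<close> u \<open>E u s\<close> by blast
qed

text \<open>The syntactic relativisation in \<open>MZFC\<close> agrees with satisfaction in the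
  members of t, the notion for which the hull and its collapse are analysed.\<close>

lemma sat_sat_fm: "sat UNIV E I e (sat_fm t p) \<longleftrightarrow> sat {x. E x (tval I e t)} E I e p"
  by (induction p arbitrary: e t) simp_all

lemma csyms_All_pow: "csyms ((All ^^ n) p) = csyms p"
  by (induction n) auto

lemma ZFC_sentence:
  assumes "p \<in> (ZFC :: 'c fm set)"
  shows "sentence {} p"
proof -
  note fm_defs = Extensionality_def Foundation_def Pairing_def upair_fm_def Union_ax_def Power_set_def
    subset_fm_def Infinity_def inductive_fm_def empty_fm_def succ_fm_def Choice_def tlift_def
  have lit: "sentence {} (q :: 'c fm)"
    if "q \<in> {Extensionality, Foundation, Pairing, Union_ax, Power_set, Infinity, Choice}" for q
    using that unfolding sentence_def by (elim insertE emptyE) (simp_all add: fm_defs eval_nat_numeral)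
  have cs: "csyms (fsubst \<sigma> q) = {}" if "csyms q = {}" "\<And>n. tcsyms (\<sigma> n) = {}" for \<sigma> and q :: "'c fm"
    using csyms_fsubst[of \<sigma> "{}" q] that by simp
  have sep: "csyms (Separation q) = {}" if "csyms q = {}" for q :: "'c fm"
    unfolding Separation_def using that by (auto simp: cs split: nat.splits)
  have rep: "csyms (Replacement q) = {}" if "csyms q = {}" for q :: "'c fm"
    unfolding Replacement_def using that by (auto simp: cs split: nat.splits)
  have cl: "sentence {} r" if "r \<in> closures q" "csyms q = {}" for q r :: "'c fm"
    using that unfolding sentence_def closures_def by (auto simp: csyms_All_pow)
  consider
      "p \<in> {Extensionality, Foundation, Pairing, Union_ax, Power_set, Infinity, Choice}"
    | q where "csyms q = {}" "p \<in> closures (Separation q)"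
    | q where "csyms q = {}" "p \<in> closures (Replacement q)"
    using assms unfolding ZFC_def by blast
  then show ?thesis
  proof cases
    case 1
    then show ?thesis by (rule lit)
  next
    case (2 q)
    show ?thesis by (rule cl[OF 2(2) sep[OF 2(1)]])
  next
    case (3 q)
    show ?thesis by (rule cl[OF 3(2) rep[OF 3(1)]])
  qed
qed

lemma conservative:
  assumes psi: "sentence L_ZF \<psi>" and prov: "prov L_MZF MZFC \<psi>"
  shows "prov L_ZF ZFC \<psi>"
proof (rule ccontr)
  assume "\<not> prov L_ZF ZFC \<psi>"
  moreover have \<psi>: "csyms \<psi> = {}" "fv \<psi> = {}" using psi by (auto simp: sentence_def L_ZF_def)
  ultimately have "\<not> prov {} (insert (\<^bold>\<not>\<psi>) ZFC) Fls" using prov.RAA[of \<psi> "{}" ZFC] by (auto simp: L_ZF_def)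
  moreover have "sentence {} q" if "q \<in> insert (\<^bold>\<not>\<psi>) ZFC" for q
    using that ZFC_sentence \<psi> by (auto simp: sentence_def)
  ultimately obtain D :: "nat set" and E where D: "D \<noteq> {}"
    "\<And>q (I :: csym \<Rightarrow> nat) e. q \<in> insert (\<^bold>\<not>\<psi>) ZFC \<Longrightarrow> sat D E I e q"
    using model_existence[of "insert (\<^bold>\<not>\<psi>) ZFC"] by metis
  \<comment> \<open>The locale \<open>zfc\<close> and \<open>soundness\<close> work over a full
    type; infinity yields a bijection from the naturals onto \<open>D\<close>, along which the
    relation is pulled back.\<close>
  have "infinite D"
    by (rule infinite_domain[OF D(1), of E undefined undefined]) (rule D(2); simp add: ZFC_def)+
  then have h: "bij_betw (enumerate D) UNIV D" by (rule bij_enumerate)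
  define E' where "E' x y = E (enumerate D x) (enumerate D y)" for x y
  have sat': "sat UNIV E' I e q" if q: "q \<in> insert (\<^bold>\<not>\<psi>) ZFC" for q and I :: "csym \<Rightarrow> nat" and e
  proof -
    have "csyms q = {}" using q ZFC_sentence \<psi> by (auto simp: sentence_def)
    then have "sat D E I (\<lambda>n. enumerate D (e n)) q = sat UNIV E' I e q"
      by (intro sat_iso[OF h]) (auto simp: E'_def)
    then show ?thesis using D(2)[OF q] by blast
  qed
  interpret zfc E' by unfold_locales (use sat' in blast)
  obtain F where F: "F \<subseteq> MZFC" "finite F" "prov L_MZF F \<psi>" using prov_compact[OF prov] by blast
  \<comment> \<open>Pulls back the finitely many relativised axioms in the derivation to a finite
    \<open>T\<close>; only these have to hold in \<open>v\<close>.\<close>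
  have "F \<inter> sat_fm (Cst v_sym) ` ZFC \<subseteq> sat_fm (Cst v_sym) ` ZFC" by blast
  from finite_subset_image[OF _ this] obtain T where T: "T \<subseteq> ZFC" "finite T"
    "F \<inter> sat_fm (Cst v_sym) ` ZFC = sat_fm (Cst v_sym) ` T" using F(2) by blast
  obtain v where v: "sat UNIV E' (\<lambda>_. v) undefined (countable_fm (Cst v_sym))"
    "sat UNIV E' (\<lambda>_. v) undefined (transitive_fm (Cst v_sym))"
    "\<And>p I e. p \<in> T \<Longrightarrow> sat {x. E' x v} E' I e p"
    using countable_transitive_model[OF T(2,1), of undefined] ZFC_sentence T(1) by blast
  have "sat UNIV E' (\<lambda>_. v) undefined \<psi>"
  proof (rule soundness[OF F(3)])
    fix q assume "q \<in> F"
    then consider "q \<in> ZFC" | "q = (countable_fm (Cst v_sym) \<^bold>\<and> transitive_fm (Cst v_sym))"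
      | p where "p \<in> T" "q = sat_fm (Cst v_sym) p"
      using F(1) T(3) unfolding MZFC_def by blast
    then show "sat UNIV E' (\<lambda>_. v) undefined q"
    proof cases
      case 1
      then show ?thesis by (rule ZFC)
    next
      case 2
      then show ?thesis using v(1,2) by simp
    next
      case 3
      then show ?thesis using v(3) by (simp add: sat_sat_fm)
    qed
  qed
  \<comment> \<open>\<psi> is false under every interpretation of the constant, in particular with
    \<open>v\<close> as its value.\<close>
  moreover have "sat UNIV E' (\<lambda>_. v) undefined (\<^bold>\<not>\<psi>)" by (rule sat') simp
  ultimately show False by simp
qed

theorem theorem4p1:
  shows "(\<forall>\<psi>. sentence L_ZF \<psi> \<longrightarrow> (prov L_ZF ZFC \<psi> \<longleftrightarrow> prov L_MZF MZFC \<psi>)) \<and>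
         (consistent L_MZF MZFC \<longleftrightarrow> consistent L_ZF ZFC)"
proof -
  have "prov L_MZF MZFC \<psi>" if "prov L_ZF ZFC \<psi>" for \<psi>
    using that by (rule prov_mono) (auto simp: L_ZF_def MZFC_def)
  then have "prov L_ZF ZFC \<psi> \<longleftrightarrow> prov L_MZF MZFC \<psi>" if "sentence L_ZF \<psi>" for \<psi>
    using that conservative by blast
  \<comment> \<open>Equiconsistency is conservativity for falsity.\<close>
  moreover have "sentence L_ZF Fls" by (simp add: sentence_def)
  ultimately show ?thesis by (simp add: consistent_iff)
qed

end
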